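(* Let $\mathcal{G}$ be any three-dimensional point group, i.e. any group in one of the families: the icosahedral groups $\mathcal{I},\mathcal{I}_h$; the cubic groups $\mathcal{T},\mathcal{T}_h,\mathcal{T}_d,\mathcal{O},\mathcal{O}_h$; the axial groups $\mathcal{C}_n,\mathcal{C}_{nh},\mathcal{C}_{nv}$; the dihedral groups $\mathcal{D}_n,\mathcal{D}_{nh},\mathcal{D}_{nd}$; the cyclic groups $\mathcal{S}_{2n}$; and $\mathcal{C}_s,\mathcal{C}_i,\mathcal{C}_1$. Then there exists a convex polyhedron in $\mathbb{R}^3$ with all faces triangles whose point group of symmetries is $\mathcal{G}$ and such that the framework with joints at its vertices and bars along its edges is isostatic in $3$-space. In particular, every three-dimensional point group is the point group of some isostatic framework in $3$-space.
   Context: The listed groups are, in Schoenflies notation, the finite subgroups of the orthogonal group $O(3)$ up to conjugacy. A framework in $3$-space consists of a finite simple graph with $j$ vertices (joints) and $b$ edges (bars), together with an injective map $p$ from the joints to $\mathbb{R}^3$. Its rigidity matrix is the $b\times 3j$ matrix whose row for a bar $\{u,v\}$ has $p(u)-p(v)$ in the columns of $u$, $p(v)-p(u)$ in the columns of $v$, and $0$ elsewhere; let $r$ be its rank. The number of states of self-stress is $s=b-r$, and the number of infinitesimal internal mechanisms $m$ is defined by $m+6=3j-r$. The framework is isostatic if $m=s=0$. The point group of symmetries of a polyhedron is the group of isometries of $\mathbb{R}^3$ mapping it to itself; the point group of a framework is the group of isometries of $\mathbb{R}^3$ that permute the joint positions and map bars to bars. *)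

theory Defs
  imports "HOL-Analysis.Analysis" "HOL-Library.Function_Algebras"
begin

section \<open>Three-dimensional point groups\<close>

definition rotation_z :: "real \<Rightarrow> real^3 \<Rightarrow> real^3" where
  "rotation_z \<theta> x =
     vector [cos \<theta> * x$1 - sin \<theta> * x$2, sin \<theta> * x$1 + cos \<theta> * x$2, x$3]"

text \<open>For a unit vector \<open>a\<close>: the half-turn about the axis spanned by \<open>a\<close>, and the reflection in the
  plane through the origin orthogonal to \<open>a\<close>.\<close>

definition half_turn :: "real^3 \<Rightarrow> real^3 \<Rightarrow> real^3" where
  "half_turn a x = (2 * (a \<bullet> x)) *\<^sub>R a - x"

definition mirror :: "real^3 \<Rightarrow> real^3 \<Rightarrow> real^3" where
  "mirror a x = x - (2 * (a \<bullet> x)) *\<^sub>R a"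

text \<open>The group generated by an element of finite order, and the union of \<open>H\<close> with the coset \<open>s H\<close>
  (only used where \<open>s\<close> normalizes \<open>H\<close> and \<open>s\<^sup>2 = 1\<close>, so that the result is the group generated
  by \<open>H\<close> and \<open>s\<close>).\<close>

definition powers :: "('a \<Rightarrow> 'a) \<Rightarrow> ('a \<Rightarrow> 'a) set" where
  "powers g = range (\<lambda>k. g ^^ k)"

definition adjoin :: "('a \<Rightarrow> 'a) \<Rightarrow> ('a \<Rightarrow> 'a) set \<Rightarrow> ('a \<Rightarrow> 'a) set" where
  "adjoin s H = H \<union> (\<lambda>g. s \<circ> g) ` H"

definition orthogonal_symmetries :: "(real^3) set \<Rightarrow> (real^3 \<Rightarrow> real^3) set" where
  "orthogonal_symmetries X = {g. orthogonal_transformation g \<and> g ` X = X}"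

definition rotational_symmetries :: "(real^3) set \<Rightarrow> (real^3 \<Rightarrow> real^3) set" where
  "rotational_symmetries X = {g \<in> orthogonal_symmetries X. det (matrix g) = 1}"

subsection \<open>Icosahedral and cubic groups\<close>

definition tetrahedron_vertices :: "(real^3) set" where
  "tetrahedron_vertices =
     {vector [1, 1, 1], vector [1, -1, -1], vector [-1, 1, -1], vector [-1, -1, 1]}"

definition cube_vertices :: "(real^3) set" where
  "cube_vertices = {x. \<forall>i. \<bar>x$i\<bar> = 1}"

definition golden_ratio :: real where
  "golden_ratio = (1 + sqrt 5) / 2"

definition icosahedron_vertices :: "(real^3) set" where
  "icosahedron_vertices =
     (\<Union>a\<in>{1, -1}. \<Union>b\<in>{golden_ratio, - golden_ratio}.
        {vector [0, a, b], vector [b, 0, a], vector [a, b, 0]})"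

definition group_I :: "(real^3 \<Rightarrow> real^3) set" where
  "group_I = rotational_symmetries icosahedron_vertices"

definition group_Ih :: "(real^3 \<Rightarrow> real^3) set" where
  "group_Ih = orthogonal_symmetries icosahedron_vertices"

definition group_T :: "(real^3 \<Rightarrow> real^3) set" where
  "group_T = rotational_symmetries tetrahedron_vertices"

definition group_Th :: "(real^3 \<Rightarrow> real^3) set" where
  "group_Th = adjoin uminus group_T"

definition group_Td :: "(real^3 \<Rightarrow> real^3) set" where
  "group_Td = orthogonal_symmetries tetrahedron_vertices"

definition group_O :: "(real^3 \<Rightarrow> real^3) set" where
  "group_O = rotational_symmetries cube_vertices"

definition group_Oh :: "(real^3 \<Rightarrow> real^3) set" where
  "group_Oh = orthogonal_symmetries cube_vertices"

subsection \<open>Axial, dihedral and cyclic groups; the main axis is the third coordinate axis\<close>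

definition group_C :: "nat \<Rightarrow> (real^3 \<Rightarrow> real^3) set" where
  "group_C n = powers (rotation_z (2 * pi / real n))"

definition group_Ch :: "nat \<Rightarrow> (real^3 \<Rightarrow> real^3) set" where
  "group_Ch n = adjoin (mirror (axis 3 1)) (group_C n)"

definition group_Cv :: "nat \<Rightarrow> (real^3 \<Rightarrow> real^3) set" where
  "group_Cv n = adjoin (mirror (axis 2 1)) (group_C n)"

definition group_D :: "nat \<Rightarrow> (real^3 \<Rightarrow> real^3) set" where
  "group_D n = adjoin (half_turn (axis 1 1)) (group_C n)"

definition group_Dh :: "nat \<Rightarrow> (real^3 \<Rightarrow> real^3) set" where
  "group_Dh n = adjoin (mirror (axis 3 1)) (group_D n)"

text \<open>The horizontal twofold axes of \<open>group_D n\<close> are at the angles \<open>k \<pi> / n\<close>; the mirror plane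
  adjoined below contains the main axis and bisects the two adjacent axes at angles \<open>0\<close>
  and \<open>\<pi> / n\<close>.\<close>

definition group_Dd :: "nat \<Rightarrow> (real^3 \<Rightarrow> real^3) set" where
  "group_Dd n =
     adjoin (mirror (vector [- sin (pi / (2 * real n)), cos (pi / (2 * real n)), 0])) (group_D n)"

text \<open>\<open>group_S2 n\<close> is the cyclic group of order \<open>2 n\<close> written \<open>S\<^sub>2\<^sub>n\<close>.\<close>

definition group_S2 :: "nat \<Rightarrow> (real^3 \<Rightarrow> real^3) set" where
  "group_S2 n = powers (mirror (axis 3 1) \<circ> rotation_z (pi / real n))"

definition group_Cs :: "(real^3 \<Rightarrow> real^3) set" where
  "group_Cs = {id, mirror (axis 3 1)}"

definition group_Ci :: "(real^3 \<Rightarrow> real^3) set" where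
  "group_Ci = {id, uminus}"

definition group_C1 :: "(real^3 \<Rightarrow> real^3) set" where
  "group_C1 = {id}"

text \<open>Allowing \<open>n = 1\<close> in the infinite families adds nothing up to conjugacy:
  \<open>C\<^sub>1\<^sub>h\<close> and \<open>C\<^sub>1\<^sub>v\<close> are \<open>C\<^sub>s\<close>, \<open>D\<^sub>1\<close> is \<open>C\<^sub>2\<close>,
  \<open>D\<^sub>1\<^sub>h\<close> is \<open>C\<^sub>2\<^sub>v\<close>, \<open>D\<^sub>1\<^sub>d\<close> is \<open>C\<^sub>2\<^sub>h\<close>, and
  \<open>S\<^sub>2\<close> is \<open>C\<^sub>i\<close>.\<close>

definition schoenflies_groups :: "(real^3 \<Rightarrow> real^3) set set" where
  "schoenflies_groups =
     {group_I, group_Ih}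
     \<union> {group_T, group_Th, group_Td, group_O, group_Oh}
     \<union> (\<Union>n\<in>{1..}. {group_C n, group_Ch n, group_Cv n})
     \<union> (\<Union>n\<in>{1..}. {group_D n, group_Dh n, group_Dd n})
     \<union> (\<Union>n\<in>{1..}. {group_S2 n})
     \<union> {group_Cs, group_Ci, group_C1}"

definition three_dimensional_point_group :: "(real^3 \<Rightarrow> real^3) set \<Rightarrow> bool" where
  "three_dimensional_point_group G \<longleftrightarrow>
     (\<exists>H\<in>schoenflies_groups. \<exists>h. orthogonal_transformation h \<and> G = (\<lambda>g. h \<circ> g \<circ> inv h) ` H)"

section \<open>Frameworks in 3-space\<close>

record 'v framework =
  joints :: "'v set"
  bars :: "'v set set"
  position :: "'v \<Rightarrow> real^3"

definition is_framework :: "'v framework \<Rightarrow> bool" where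
  "is_framework F \<longleftrightarrow>
     finite (joints F) \<and>
     (\<forall>e\<in>bars F. e \<subseteq> joints F \<and> card e = 2) \<and>
     inj_on (position F) (joints F)"

text \<open>Row \<open>e\<close>, column \<open>(w, i)\<close>, the columns being indexed by joints and coordinates (columns outside
  the set of joints are zero). For \<open>e = {u, v}\<close> the sum has only one nonzero
  summand, which belongs to the end of \<open>e\<close> other than \<open>w\<close>.\<close>

definition rigidity_matrix :: "'v framework \<Rightarrow> 'v set \<Rightarrow> 'v \<times> 3 \<Rightarrow> real" where
  "rigidity_matrix F e =
     (\<lambda>(w, i). if w \<in> e then (\<Sum>v\<in>e. position F w - position F v) $ i else 0)"

lemma rigidity_matrix_bar:
  assumes "u \<noteq> v"
  shows "rigidity_matrix F {u, v} (w, i) =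
    (if w = u then (position F u - position F v) $ i
     else if w = v then (position F v - position F u) $ i else 0)"
  using assms by (auto simp: rigidity_matrix_def)

definition fun_scale :: "real \<Rightarrow> ('c \<Rightarrow> real) \<Rightarrow> 'c \<Rightarrow> real" where
  "fun_scale c f = (\<lambda>x. c * f x)"

interpretation fun_space: vector_space fun_scale
  by unfold_locales (auto simp: fun_scale_def fun_eq_iff algebra_simps)

text \<open>The rank, as the dimension of the row space.\<close>

definition rigidity_rank :: "'v framework \<Rightarrow> nat" where
  "rigidity_rank F = vector_space.dim fun_scale (rigidity_matrix F ` bars F)"

definition self_stresses :: "'v framework \<Rightarrow> int" where
  "self_stresses F = int (card (bars F)) - int (rigidity_rank F)"

definition internal_mechanisms :: "'v framework \<Rightarrow> int" where
  "internal_mechanisms F = 3 * int (card (joints F)) - int (rigidity_rank F) - 6"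

definition isostatic :: "'v framework \<Rightarrow> bool" where
  "isostatic F \<longleftrightarrow> is_framework F \<and> internal_mechanisms F = 0 \<and> self_stresses F = 0"

section \<open>Point groups of polyhedra and frameworks\<close>

definition isometries :: "(real^3 \<Rightarrow> real^3) set" where
  "isometries = {f. \<forall>x y. dist (f x) (f y) = dist x y}"

definition polyhedron_point_group :: "(real^3) set \<Rightarrow> (real^3 \<Rightarrow> real^3) set" where
  "polyhedron_point_group P = {f \<in> isometries. f ` P = P}"

definition framework_point_group :: "'v framework \<Rightarrow> (real^3 \<Rightarrow> real^3) set" where
  "framework_point_group F =
     {f \<in> isometries.
        f ` (position F ` joints F) = position F ` joints F \<and>
        (\<forall>e\<in>bars F. \<exists>e'\<in>bars F. f ` (position F ` e) = position F ` e')}"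

definition triangulated_convex_polyhedron :: "(real^3) set \<Rightarrow> bool" where
  "triangulated_convex_polyhedron P \<longleftrightarrow>
     polytope P \<and> aff_dim P = 3 \<and> (\<forall>F. F facet_of P \<longrightarrow> 2 simplex F)"

definition polyhedral_framework :: "(real^3) set \<Rightarrow> (real^3) framework" where
  "polyhedral_framework P =
     \<lparr>joints = {v. v extreme_point_of P},
      bars = {{u, v} |u v. closed_segment u v edge_of P},
      position = id\<rparr>"

end

theory Submission
  imports Defs
begin

text \<open>Encode a simplicial convex polyhedron around the origin by its vertices and facets: every facet has a
  supporting plane, and across every edge there is a neighbouring facet. Stacking a shallow pyramid on a
  facet adds one vertex and three edges, whose directions are independent, so it keeps the framework
  isostatic. Start from a highly symmetric polyhedron inscribed in a sphere (the bipyramid over a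
  \<open>4n\<close>-gon, the regular octahedron or icosahedron), for which the stress equations can be solved by hand. First
  stack all facets at their barycentres, then stack the \<open>G\<close>-orbit of an asymmetric point of one of the new
  facets. An isometry of the result fixes the origin, permutes the original vertices (the
  only ones on the circumscribed sphere), hence all barycentres, hence the orbit, so it lies in \<open>G\<close>.\<close>

section \<open>Triangulated spheres with supporting planes\<close>

text \<open>A facet can carry only one pyramid, so the orbit may meet each facet at most once. On
  the original facets this fails as soon as an element of G other than the identity preserves a
  facet. The barycentres cure most of it: a triangle \<open>{u, v, a}\<close> with a the apex over
  \<open>{u, v, w}\<close> is preserved only by the identity and by the map exchanging u and v and
  fixing w. One facet without such an exchange in G suffices, and unequal weights of the asymmetric
  point exclude the exchange outside G as well. For I_h, O_h and T_d every facet of the icosahedron,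
  octahedron and tetrahedron admits exchanges; these three groups are realized by the bare
  polyhedra, the tetrahedron being added for T_d. That simplicial convex polyhedra are isostatic is
  Dehn's theorem in general; stacking requires it only for the starting polyhedra, whose symmetric
  coordinates make the equations solvable. With 4n equatorial vertices the rotation by pi/n in D_nd
  and S_2n is a shift by two, and already n = 1 gives a nondegenerate, centrally symmetric
  polygon.\<close>

definition edges_of :: "'a set set \<Rightarrow> 'a set set" where
  "edges_of T = {e. card e = 2 \<and> (\<exists>t\<in>T. e \<subseteq> t)}"

text \<open>The normal is scaled to the value 1 on its facet, so no facet plane passes through the
  origin; independence makes every facet a basis of the space. The last clause is a purely local
  closedness condition, yet enough to make the cones over the facets cover everything.\<close>

definition triangulated_sphere :: "(real^3) set \<Rightarrow> (real^3) set set \<Rightarrow> bool" where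
  "triangulated_sphere V T \<longleftrightarrow>
     finite V \<and> T \<noteq> {} \<and> \<Union>T = V \<and>
     (\<forall>t\<in>T. card t = 3 \<and> independent t \<and>
        (\<exists>n. (\<forall>x\<in>t. n \<bullet> x = 1) \<and> (\<forall>x\<in>V - t. n \<bullet> x < 1))) \<and>
     (\<forall>t\<in>T. \<forall>w\<in>t. \<exists>t'\<in>T. t - {w} \<subseteq> t' \<and> w \<notin> t')"

text \<open>For a facet this is the relative interior of the triangle. Strictly positive weights
  matter: a supporting plane through such a point must contain all of t.\<close>

definition open_hull :: "(real^3) set \<Rightarrow> (real^3) set" where
  "open_hull t = {y. \<exists>c. (\<forall>x\<in>t. 0 < c x) \<and> sum c t = 1 \<and> y = (\<Sum>x\<in>t. c x *\<^sub>R x)}"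

text \<open>Coordinate functionals of a basis, represented as vectors. The two vectors other than x
  do not span the space, so some nonzero vector is orthogonal to both; it is not orthogonal to x,
  because t spans, and rescaling it gives \<open>d x\<close>.\<close>

lemma dual_basis:
  fixes t :: "(real^3) set"
  assumes "independent t" "card t = 3"
  obtains d where "\<And>x y. x \<in> t \<Longrightarrow> y \<in> t \<Longrightarrow> d x \<bullet> y = (if x = y then 1 else 0)"
    "\<And>z. z = (\<Sum>x\<in>t. (d x \<bullet> z) *\<^sub>R x)"
proof -
  have fin: "finite t" using assms(2) by (metis card.infinite zero_neq_numeral)
  have sp: "span t = UNIV"
    using card_ge_dim_independent[of t UNIV] assms by (auto simp: dim_UNIV)
  have "\<exists>a. \<forall>y\<in>t. a \<bullet> y = (if x = y then 1 else 0)" if x: "x \<in> t" for x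
  proof -
    have "dim (t - {x}) \<le> card (t - {x})" using fin by (simp add: dim_le_card')
    then have "dim (t - {x}) < DIM(real^3)" using assms x fin by simp
    then obtain a where a: "a \<noteq> 0" "\<And>y. y \<in> span (t - {x}) \<Longrightarrow> orthogonal a y"
      using orthogonal_to_subspace_exists by blast
    then have a0: "a \<bullet> y = 0" if "y \<in> t - {x}" for y
      using a(2)[OF span_base[OF that]] by (simp add: orthogonal_def)
    have "a \<bullet> x \<noteq> 0"
    proof
      assume "a \<bullet> x = 0"
      then have "orthogonal a y" if "y \<in> t" for y using a0 that by (cases "y = x") (auto simp: orthogonal_def)
      then have "orthogonal a a"
        using orthogonal_to_span[of a t a] sp by auto
      then show False using a by (simp add: orthogonal_def)
    qed
    then show ?thesis
      by (intro exI[of _ "a /\<^sub>R (a \<bullet> x)"]) (use a0 in auto)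
  qed
  then obtain d where d: "\<And>x y. x \<in> t \<Longrightarrow> y \<in> t \<Longrightarrow> d x \<bullet> y = (if x = y then 1 else 0)"
    by metis
  have "z = (\<Sum>x\<in>t. (d x \<bullet> z) *\<^sub>R x)" for z
  proof -
    obtain u where u: "z = (\<Sum>x\<in>t. u x *\<^sub>R x)"
      using sp UNIV_I[of z] unfolding span_finite[OF fin] by blast
    have "d x \<bullet> z = u x" if "x \<in> t" for x
    proof -
      have "d x \<bullet> z = (\<Sum>y\<in>t. if x = y then u y else 0)"
        unfolding u inner_sum_right by (rule sum.cong) (auto simp: d that)
      then show ?thesis using that fin by simp
    qed
    then show ?thesis unfolding u by (intro sum.cong) auto
  qed
  then show ?thesis using that d by blast
qed

text \<open>The nonnegative numbers \<open>c x * (1 - f x)\<close> have sum at most 0, so all of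
  them vanish. With f a normal of a supporting plane, this moves a whole set of vertices into the
  plane once one strict convex combination of them reaches it.\<close>

lemma convex_combination_eq_1:
  fixes c f :: "'a \<Rightarrow> real"
  assumes "finite s" "\<And>x. x \<in> s \<Longrightarrow> 0 < c x" "sum c s = 1" "\<And>x. x \<in> s \<Longrightarrow> f x \<le> 1"
    "1 \<le> (\<Sum>x\<in>s. c x * f x)" "x \<in> s"
  shows "f x = 1"
proof -
  have nn: "\<And>x. x \<in> s \<Longrightarrow> 0 \<le> c x * (1 - f x)"
    using assms(2,4) by (simp add: less_imp_le)
  have "(\<Sum>x\<in>s. c x * (1 - f x)) = sum c s - (\<Sum>x\<in>s. c x * f x)"
    by (simp add: right_diff_distrib sum_subtractf)
  then have "(\<Sum>x\<in>s. c x * (1 - f x)) \<le> 0" using assms by simp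
  then have "(\<Sum>x\<in>s. c x * (1 - f x)) = 0" using nn by (simp add: order_antisym sum_nonneg)
  then have "c x * (1 - f x) = 0"
    using sum_nonneg_eq_0_iff[of s "\<lambda>x. c x * (1 - f x)"] nn assms(1,6) by blast
  then show ?thesis using assms(2)[OF assms(6)] by simp
qed

lemma triangulated_sphereD:
  assumes "triangulated_sphere V T"
  shows "finite V" "finite T" "\<Union>T = V"
    and "t \<in> T \<Longrightarrow> t \<subseteq> V" "t \<in> T \<Longrightarrow> card t = 3" "t \<in> T \<Longrightarrow> finite t" "t \<in> T \<Longrightarrow> independent t"
    and "t \<in> T \<Longrightarrow> w \<in> t \<Longrightarrow> \<exists>t'\<in>T. t - {w} \<subseteq> t' \<and> w \<notin> t'"
proof -
  show fin: "finite V" and un: "\<Union>T = V" using assms unfolding triangulated_sphere_def by blast+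
  then show "finite T" using finite_UnionD by blast
  show "t \<subseteq> V" if "t \<in> T" using un that by blast
  then show "finite t" if "t \<in> T" using fin that finite_subset by blast
  show "card t = 3" "independent t" if "t \<in> T" using assms that unfolding triangulated_sphere_def by blast+
  show "\<exists>t'\<in>T. t - {w} \<subseteq> t' \<and> w \<notin> t'" if "t \<in> T" "w \<in> t"
    using assms that unfolding triangulated_sphere_def by blast
qed

lemma sphere_normal:
  assumes "triangulated_sphere V T" "t \<in> T"
  obtains n where "\<And>x. x \<in> t \<Longrightarrow> n \<bullet> x = 1" "\<And>x. x \<in> V - t \<Longrightarrow> n \<bullet> x < 1"
    "\<And>x. x \<in> V \<Longrightarrow> n \<bullet> x \<le> 1"
proof -
  obtain n where n: "\<forall>x\<in>t. n \<bullet> x = 1" "\<forall>x\<in>V - t. n \<bullet> x < 1"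
    using assms unfolding triangulated_sphere_def by blast
  then have "n \<bullet> x \<le> 1" if "x \<in> V" for x using that by (cases "x \<in> t") (auto simp: less_imp_le)
  then show ?thesis using that n by blast
qed

text \<open>Among the supporting planes choose one with \<open>n \<bullet> x\<close> maximal: passing to the neighbour across the
  edge opposite to \<open>w\<close> does not increase this value, which says that the \<open>w\<close>-coordinate of \<open>x\<close> is
  nonnegative.\<close>

lemma sphere_cover:
  assumes "triangulated_sphere V T"
  obtains t c where "t \<in> T" "\<And>y. y \<in> t \<Longrightarrow> 0 \<le> c y" "x = (\<Sum>y\<in>t. c y *\<^sub>R y)"
proof -
  note S = triangulated_sphereD[OF assms]
  have "\<forall>t\<in>T. \<exists>n. (\<forall>x\<in>t. n \<bullet> x = 1) \<and> (\<forall>x\<in>V - t. n \<bullet> x < 1)"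
    using assms unfolding triangulated_sphere_def by blast
  then obtain N where N: "\<And>t x. t \<in> T \<Longrightarrow> x \<in> t \<Longrightarrow> N t \<bullet> x = 1"
    "\<And>t x. t \<in> T \<Longrightarrow> x \<in> V - t \<Longrightarrow> N t \<bullet> x < 1"
    by metis
  have "T \<noteq> {}" using assms unfolding triangulated_sphere_def by blast
  define M where "M = Max ((\<lambda>t. N t \<bullet> x) ` T)"
  have "M \<in> (\<lambda>t. N t \<bullet> x) ` T" unfolding M_def using \<open>T \<noteq> {}\<close> S(2) by (intro Max_in) auto
  then obtain t where t: "t \<in> T" and tM: "N t \<bullet> x = M" by auto
  have max: "N t' \<bullet> x \<le> N t \<bullet> x" if "t' \<in> T" for t'
    unfolding tM M_def using S(2) that by simp
  obtain d where d: "\<And>x y. x \<in> t \<Longrightarrow> y \<in> t \<Longrightarrow> d x \<bullet> y = (if x = y then 1 else 0)"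
    "\<And>z. z = (\<Sum>x\<in>t. (d x \<bullet> z) *\<^sub>R x)"
    using dual_basis[OF S(7)[OF t] S(5)[OF t]] by blast
  have "0 \<le> d w \<bullet> x" if w: "w \<in> t" for w
  proof -
    obtain t' where t': "t' \<in> T" "t - {w} \<subseteq> t'" "w \<notin> t'" using S(8) t w by blast
    have expand: "n \<bullet> x = (\<Sum>y\<in>t. (d y \<bullet> x) * (n \<bullet> y))" for n
      by (subst d(2)[of x]) (simp add: inner_sum_right)
    have "N t' \<bullet> x - N t \<bullet> x = (\<Sum>y\<in>t. (d y \<bullet> x) * (N t' \<bullet> y - N t \<bullet> y))"
      unfolding expand[of "N t'"] expand[of "N t"] by (simp add: sum_subtractf right_diff_distrib)
    also have "\<dots> = (\<Sum>y\<in>t. if y = w then (d w \<bullet> x) * (N t' \<bullet> w - 1) else 0)"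
      by (rule sum.cong) (use t' N(1) t w in auto)
    also have "\<dots> = (d w \<bullet> x) * (N t' \<bullet> w - 1)" using w S(6)[OF t] by simp
    finally have "(d w \<bullet> x) * (N t' \<bullet> w - 1) \<le> 0" using max[OF t'(1)] by simp
    moreover have "N t' \<bullet> w < 1" using N(2)[OF t'(1), of w] t' w S(4)[OF t] by blast
    ultimately show ?thesis by (simp add: mult_le_0_iff)
  qed
  then show ?thesis using that[OF t, of "\<lambda>y. d y \<bullet> x"] d(2) by blast
qed

text \<open>The barycentre y of s lies in the cone over some facet t with normal N. Then 1 = n
  \<bullet> y is at most the sum of the cone coefficients, which is N \<bullet> y. As N is at most 1
  on s, it equals 1 there, and s lies in t.\<close>

lemma sphere_supported_subset:
  assumes "triangulated_sphere V T" "s \<subseteq> V" "s \<noteq> {}" "\<And>x. x \<in> V \<Longrightarrow> n \<bullet> x \<le> 1" "\<And>x. x \<in> s \<Longrightarrow> n \<bullet> x = 1"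
  obtains t where "t \<in> T" "s \<subseteq> t"
proof -
  note S = triangulated_sphereD[OF assms(1)]
  have fs: "finite s" using assms(2) S(1) finite_subset by blast
  define y where "y = (\<Sum>x\<in>s. (1 / card s) *\<^sub>R x)"
  have cs: "card s > 0" using fs assms(3) by (simp add: card_gt_0_iff)
  obtain t c where t: "t \<in> T" "\<And>x. x \<in> t \<Longrightarrow> 0 \<le> c x" "y = (\<Sum>x\<in>t. c x *\<^sub>R x)"
    using sphere_cover[OF assms(1)] by blast
  obtain N where N: "\<And>x. x \<in> t \<Longrightarrow> N \<bullet> x = 1" "\<And>x. x \<in> V - t \<Longrightarrow> N \<bullet> x < 1" "\<And>x. x \<in> V \<Longrightarrow> N \<bullet> x \<le> 1"
    using sphere_normal[OF assms(1) t(1)] by blast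
  have "1 = n \<bullet> y" unfolding y_def using cs assms(5) by (simp add: inner_sum_right)
  also have "\<dots> = (\<Sum>x\<in>t. c x * (n \<bullet> x))" by (simp add: t(3) inner_sum_right)
  also have "\<dots> \<le> (\<Sum>x\<in>t. c x * 1)"
    using t(2) assms(4) S(4)[OF t(1)] by (intro sum_mono mult_left_mono) auto
  also have "\<dots> = (\<Sum>x\<in>t. c x * (N \<bullet> x))" using N(1) by simp
  also have "\<dots> = N \<bullet> y" by (simp add: t(3) inner_sum_right)
  also have "\<dots> = (\<Sum>x\<in>s. (1 / card s) * (N \<bullet> x))" by (simp add: y_def inner_sum_right)
  finally have *: "1 \<le> (\<Sum>x\<in>s. (1 / card s) * (N \<bullet> x))" .
  have "x \<in> t" if "x \<in> s" for x
  proof -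
    have "N \<bullet> x = 1"
      by (rule convex_combination_eq_1[OF fs _ _ _ * that]) (use cs N(3) assms(2) in auto)
    then show ?thesis using N(2)[of x] that assms(2) by auto
  qed
  then show ?thesis using that t(1) by blast
qed

text \<open>The normal of one facet has the value 1 at y, hence at all vertices of the other facet.
  A facet can thus be recovered from any of its relative interior points.\<close>

lemma open_hull_unique:
  assumes "triangulated_sphere V T" "t \<in> T" "t' \<in> T" "y \<in> open_hull t" "y \<in> open_hull t'"
  shows "t = t'"
proof -
  note S = triangulated_sphereD[OF assms(1)]
  have "t' \<subseteq> t" if tt: "t \<in> T" "t' \<in> T" and y: "y \<in> open_hull t" "y \<in> open_hull t'" for t t'
  proof -
    obtain N where N: "\<And>x. x \<in> t \<Longrightarrow> N \<bullet> x = 1" "\<And>x. x \<in> V - t \<Longrightarrow> N \<bullet> x < 1" "\<And>x. x \<in> V \<Longrightarrow> N \<bullet> x \<le> 1"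
      using sphere_normal[OF assms(1) tt(1)] by blast
    obtain c where c: "\<And>x. x \<in> t \<Longrightarrow> 0 < c x" "sum c t = 1" "y = (\<Sum>x\<in>t. c x *\<^sub>R x)"
      using y(1) unfolding open_hull_def by blast
    obtain c' where c': "\<And>x. x \<in> t' \<Longrightarrow> 0 < c' x" "sum c' t' = 1" "y = (\<Sum>x\<in>t'. c' x *\<^sub>R x)"
      using y(2) unfolding open_hull_def by blast
    have "N \<bullet> y = (\<Sum>x\<in>t. c x * (N \<bullet> x))" by (simp add: c(3) inner_sum_right)
    also have "\<dots> = 1" using N(1) c(2) by simp
    finally have *: "1 \<le> (\<Sum>x\<in>t'. c' x * (N \<bullet> x))" by (simp add: c'(3) inner_sum_right)
    show ?thesis
    proof
      fix x assume x: "x \<in> t'"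
      have "N \<bullet> x = 1"
        by (rule convex_combination_eq_1[OF S(6)[OF tt(2)] c'(1,2) _ * x]) (use N(3) S(4)[OF tt(2)] in auto)
      then show "x \<in> t" using N(2)[of x] x S(4)[OF tt(2)] by auto
    qed
  qed
  then show ?thesis using assms by blast
qed

text \<open>The vertices determine the facets: the image of a supporting plane supports the image of
  t, which therefore lies in some facet and equals it by cardinality.\<close>

lemma sphere_symmetry:
  assumes "triangulated_sphere V T" "orthogonal_transformation h" "h ` V = V" "t \<in> T"
  shows "h ` t \<in> T"
proof -
  note S = triangulated_sphereD[OF assms(1)]
  obtain N where N: "\<And>x. x \<in> t \<Longrightarrow> N \<bullet> x = 1" "\<And>x. x \<in> V - t \<Longrightarrow> N \<bullet> x < 1" "\<And>x. x \<in> V \<Longrightarrow> N \<bullet> x \<le> 1"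
    using sphere_normal[OF assms(1,4)] by blast
  have card: "card (h ` t) = 3"
    using S(5)[OF assms(4)] card_image[OF inj_on_subset[OF orthogonal_transformation_inj[OF assms(2)] subset_UNIV], of t] by simp
  have eq: "h N \<bullet> h x = N \<bullet> x" for x using assms(2) by (simp add: orthogonal_transformation_def)
  have "h ` t \<subseteq> V" using assms(3) S(4)[OF assms(4)] by blast
  moreover have "h ` t \<noteq> {}" using card by auto
  moreover have "h N \<bullet> x \<le> 1" if x: "x \<in> V" for x
  proof -
    have "x \<in> h ` V" using x assms(3) by simp
    then obtain z where "z \<in> V" "x = h z" by blast
    then show ?thesis using N(3)[of z] eq[of z] by simp
  qed
  moreover have "h N \<bullet> x = 1" if "x \<in> h ` t" for x
    using that N(1) eq by auto
  ultimately obtain t' where t': "t' \<in> T" "h ` t \<subseteq> t'"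
    using sphere_supported_subset[OF assms(1), of "h ` t" "h N"] by blast
  then have "h ` t = t'" using card_subset_eq[of t' "h ` t"] S(5,6)[OF t'(1)] card by simp
  then show ?thesis using t' by simp
qed

lemma sphere_image:
  assumes "triangulated_sphere V T" "orthogonal_transformation h"
  shows "triangulated_sphere (h ` V) ((`) h ` T)"
proof -
  note S = triangulated_sphereD[OF assms(1)]
  have inj: "inj h" using assms(2) by (rule orthogonal_transformation_inj)
  have lin: "linear h" using assms(2) by (rule orthogonal_transformation_linear)
  have eq: "h a \<bullet> h x = a \<bullet> x" for a x using assms(2) by (simp add: orthogonal_transformation_def)
  have A: "card (h ` t) = 3 \<and> independent (h ` t) \<and>
        (\<exists>n. (\<forall>x\<in>h ` t. n \<bullet> x = 1) \<and> (\<forall>x\<in>h ` V - h ` t. n \<bullet> x < 1))" if t: "t \<in> T" for t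
  proof -
    obtain N where N: "\<And>x. x \<in> t \<Longrightarrow> N \<bullet> x = 1" "\<And>x. x \<in> V - t \<Longrightarrow> N \<bullet> x < 1"
      "\<And>x. x \<in> V \<Longrightarrow> N \<bullet> x \<le> 1"
      using sphere_normal[OF assms(1) t] by blast
    have "\<forall>x\<in>h ` t. h N \<bullet> x = 1" using N(1) eq by auto
    moreover have "\<forall>x\<in>h ` V - h ` t. h N \<bullet> x < 1" by (auto simp: eq intro!: N(2))
    moreover have "card (h ` t) = 3" using S(5)[OF t] card_image[OF inj_on_subset[OF inj subset_UNIV], of t] by simp
    moreover have "independent (h ` t)"
      by (rule linear_independent_injective_image[OF lin S(7)[OF t]]) (rule inj_on_subset[OF inj subset_UNIV])
    ultimately show ?thesis by blast
  qed
  have B: "\<exists>t'\<in>(`) h ` T. h ` t - {h w} \<subseteq> t' \<and> h w \<notin> t'" if tw: "t \<in> T" "w \<in> t" for t w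
  proof -
    obtain t' where t': "t' \<in> T" "t - {w} \<subseteq> t'" "w \<notin> t'" using S(8)[OF tw] by blast
    have "h ` t - {h w} \<subseteq> h ` t'" using t'(2) by blast
    moreover have "h w \<notin> h ` t'" using t'(3) inj by (simp add: inj_image_mem_iff)
    ultimately show ?thesis using t'(1) by blast
  qed
  have "T \<noteq> {}" using assms(1) unfolding triangulated_sphere_def by blast
  moreover have "\<Union>((`) h ` T) = h ` V" using S(3) by blast
  moreover have "\<forall>t\<in>(`) h ` T. card t = 3 \<and> independent t \<and>
      (\<exists>n. (\<forall>x\<in>t. n \<bullet> x = 1) \<and> (\<forall>x\<in>h ` V - t. n \<bullet> x < 1))"
    by (rule ballI, erule imageE, hypsubst, rule A)
  moreover have "\<forall>t\<in>(`) h ` T. \<forall>w\<in>t. \<exists>t'\<in>(`) h ` T. t - {w} \<subseteq> t' \<and> w \<notin> t'"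
    by (rule ballI, erule imageE, hypsubst, rule ballI, erule imageE, hypsubst, rule B)
  ultimately show ?thesis using S(1) unfolding triangulated_sphere_def by simp
qed

text \<open>Writing a itself as a nonnegative combination of vertices makes a \<bullet> a > 0 a
  nonnegative combination of the numbers a \<bullet> y, one of which must be positive.\<close>

lemma sphere_positive_vertex:
  assumes "triangulated_sphere V T" "a \<noteq> 0"
  obtains y where "y \<in> V" "0 < a \<bullet> y"
proof -
  obtain t c where t: "t \<in> T" "\<And>y. y \<in> t \<Longrightarrow> 0 \<le> c y" "a = (\<Sum>y\<in>t. c y *\<^sub>R y)"
    using sphere_cover[OF assms(1), of a] by blast
  have "\<exists>y\<in>t. 0 < a \<bullet> y"
  proof (rule ccontr)
    assume "\<not> (\<exists>y\<in>t. 0 < a \<bullet> y)"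
    then have "(\<Sum>y\<in>t. c y * (a \<bullet> y)) \<le> 0"
      using t(2) by (intro sum_nonpos mult_nonneg_nonpos) auto
    moreover have "a \<bullet> a = a \<bullet> (\<Sum>y\<in>t. c y *\<^sub>R y)" using t(3) by simp
    then have "a \<bullet> a = (\<Sum>y\<in>t. c y * (a \<bullet> y))" by (simp add: inner_sum_right)
    ultimately show False using assms(2) by (metis inner_gt_zero_iff not_le)
  qed
  then show ?thesis using that triangulated_sphereD(4)[OF assms(1) t(1)] by blast
qed

lemma sphere_zero_in_hull:
  assumes "triangulated_sphere V T"
  shows "0 \<in> convex hull V"
proof (rule ccontr)
  assume 0: "0 \<notin> convex hull V"
  have "closed (convex hull V)"
    using triangulated_sphereD(1)[OF assms] by (simp add: compact_imp_closed finite_imp_compact_convex_hull)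
  then obtain a b where ab: "a \<noteq> 0" "0 < b" "\<And>x. x \<in> convex hull V \<Longrightarrow> a \<bullet> x > b"
    using separating_hyperplane_closed_0[OF convex_convex_hull _ 0] by blast
  obtain y where y: "y \<in> V" "0 < (-a) \<bullet> y"
    using sphere_positive_vertex[OF assms, of "-a"] ab(1) by auto
  then have "a \<bullet> y > b" using ab(3) hull_inc by metis
  then show False using y ab(2) by simp
qed

lemma sphere_face:
  assumes "triangulated_sphere V T" "t \<in> T"
  shows "convex hull t face_of convex hull V"
proof -
  note S = triangulated_sphereD[OF assms(1)]
  obtain N where N: "\<And>x. x \<in> t \<Longrightarrow> N \<bullet> x = 1" "\<And>x. x \<in> V - t \<Longrightarrow> N \<bullet> x < 1" "\<And>x. x \<in> V \<Longrightarrow> N \<bullet> x \<le> 1"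
    using sphere_normal[OF assms] by blast
  let ?F = "convex hull V \<inter> {x. N \<bullet> x = 1}"
  have "convex hull V \<subseteq> {x. N \<bullet> x \<le> 1}"
    by (rule hull_minimal) (use N(3) in \<open>auto simp: convex_halfspace_le\<close>)
  then have F: "?F face_of convex hull V"
    by (intro face_of_Int_supporting_hyperplane_le) auto
  \<comment> \<open>A face of a hull is the hull of some of the given points, and N singles out
    those in t.\<close>
  obtain s where s: "s \<subseteq> V" "?F = convex hull s"
    using face_of_convex_hull_subset[OF finite_imp_compact[OF S(1)] F] by blast
  have "s \<subseteq> t"
  proof
    fix x assume "x \<in> s"
    then have "x \<in> V" "N \<bullet> x = 1" using s hull_inc[of x s convex] by auto
    then show "x \<in> t" using N(2)[of x] by auto
  qed
  moreover have "t \<subseteq> ?F" using S(4)[OF assms(2)] N(1) hull_subset[of V convex] by auto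
  then have "convex hull t \<subseteq> ?F" unfolding s(2) by (metis hull_minimal convex_convex_hull)
  ultimately have "convex hull t = ?F" unfolding s(2) using hull_mono[of s t convex] by blast
  then show ?thesis using F by simp
qed

lemma sphere_affine_independent:
  assumes "triangulated_sphere V T" "t \<in> T"
  shows "\<not> affine_dependent t"
  using triangulated_sphereD(7)[OF assms] affine_dependent_imp_dependent by blast

lemma sphere_aff_dim:
  assumes "triangulated_sphere V T"
  shows "aff_dim (convex hull V) = 3"
proof -
  note S = triangulated_sphereD[OF assms]
  obtain t where t: "t \<in> T" using assms unfolding triangulated_sphere_def by blast
  have "0 \<in> affine hull V" using sphere_zero_in_hull[OF assms] convex_hull_subset_affine_hull by blast
  then have "aff_dim V = int (dim V)" by (rule aff_dim_zero)
  moreover have "dim t \<le> dim V" using S(4)[OF t] by (rule dim_subset)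
  moreover have "dim t = 3" using S(5,7)[OF t] by (simp add: dim_eq_card_independent)
  moreover have "dim V \<le> DIM(real^3)" by (rule dim_subset_UNIV)
  ultimately show ?thesis by (simp add: aff_dim_convex_hull)
qed

text \<open>A relative interior point x of F lies in the cone over some t. The normal of t bounds
  the coefficient sum by 1 from above, and the plane of F, whose level b is positive, bounds it by 1
  from below; so x lies in the triangle t. A face meeting the relative interior of F contains F, and
  equal dimensions give equality.\<close>

lemma sphere_facet:
  assumes "triangulated_sphere V T" "F facet_of convex hull V"
  obtains t where "t \<in> T" "F = convex hull t"
proof -
  note S = triangulated_sphereD[OF assms(1)]
  have "polyhedron (convex hull V)"
    by (rule polytope_imp_polyhedron) (use S(1) in \<open>auto simp: polytope_def\<close>)
  then obtain a b where ab: "a \<noteq> 0" "convex hull V \<subseteq> {x. a \<bullet> x \<le> b}" "F = convex hull V \<inter> {x. a \<bullet> x = b}"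
    using facet_of_polyhedron assms(2) by blast
  obtain y where y: "y \<in> V" "0 < a \<bullet> y" using sphere_positive_vertex[OF assms(1) ab(1)] by blast
  have b: "0 < b" using y ab(2) hull_inc[OF y(1), of convex] by fastforce
  have F: "F face_of convex hull V" "F \<noteq> {}" "aff_dim F = 2"
    using assms(2) sphere_aff_dim[OF assms(1)] unfolding facet_of_def by auto
  obtain x where x: "x \<in> rel_interior F"
    using F rel_interior_eq_empty[OF face_of_imp_convex[OF F(1)]] by blast
  then have xF: "x \<in> F" using rel_interior_subset by blast
  obtain t c where t: "t \<in> T" "\<And>y. y \<in> t \<Longrightarrow> 0 \<le> c y" "x = (\<Sum>y\<in>t. c y *\<^sub>R y)"
    using sphere_cover[OF assms(1), of x] by blast
  obtain N where N: "\<And>x. x \<in> t \<Longrightarrow> N \<bullet> x = 1" "\<And>x. x \<in> V \<Longrightarrow> N \<bullet> x \<le> 1"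
    using sphere_normal[OF assms(1) t(1)] by metis
  have le1: "convex hull V \<subseteq> {x. N \<bullet> x \<le> 1}"
    by (rule hull_minimal) (use N(2) in \<open>auto simp: convex_halfspace_le\<close>)
  have "N \<bullet> x = (\<Sum>y\<in>t. c y * (N \<bullet> y))" by (simp add: t(3) inner_sum_right)
  also have "\<dots> = sum c t" using N(1) by simp
  finally have s1: "sum c t \<le> 1" using le1 xF ab(3) by auto
  have "b = a \<bullet> x" using xF ab(3) by simp
  also have "\<dots> = (\<Sum>y\<in>t. c y * (a \<bullet> y))" by (simp add: t(3) inner_sum_right)
  also have "\<dots> \<le> (\<Sum>y\<in>t. c y * b)"
  proof (rule sum_mono)
    fix y assume y: "y \<in> t"
    then have "y \<in> convex hull V" using S(4)[OF t(1)] hull_subset[of V convex] by blast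
    then have "a \<bullet> y \<le> b" using ab(2) by blast
    then show "c y * (a \<bullet> y) \<le> c y * b" using t(2)[OF y] by (rule mult_left_mono)
  qed
  also have "\<dots> = sum c t * b" by (simp add: sum_distrib_right)
  finally have "1 * b \<le> sum c t * b" by simp
  then have "sum c t = 1" using b s1 mult_right_le_imp_le by fastforce
  then have "x \<in> convex hull t"
    using t(2,3) S(6)[OF t(1)] unfolding convex_hull_finite[OF S(6)[OF t(1)]] by blast
  then have sub: "F \<subseteq> convex hull t"
    using subset_of_face_of[OF sphere_face[OF assms(1) t(1)] face_of_imp_subset[OF F(1)]] x by blast
  have ft: "F face_of convex hull t"
    using face_of_subset[OF F(1) sub face_of_imp_subset[OF sphere_face[OF assms(1) t(1)]]] .
  have "aff_dim (convex hull t) = 2"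
    using aff_dim_affine_independent[OF sphere_affine_independent[OF assms(1) t(1)]] S(5)[OF t(1)]
    by (simp add: aff_dim_convex_hull)
  then have "F = convex hull t"
    using face_of_aff_dim_lt[OF convex_convex_hull ft] F(3) by auto
  then show ?thesis using that t(1) by blast
qed

lemma sphere_triangulated_convex_polyhedron:
  assumes "triangulated_sphere V T"
  shows "triangulated_convex_polyhedron (convex hull V)"
  unfolding triangulated_convex_polyhedron_def
proof (intro conjI allI impI)
  note S = triangulated_sphereD[OF assms]
  show "polytope (convex hull V)" using S(1) by (auto simp: polytope_def)
  show "aff_dim (convex hull V) = 3" by (rule sphere_aff_dim[OF assms])
  fix F assume "F facet_of convex hull V"
  then obtain t where t: "t \<in> T" "F = convex hull t" using sphere_facet[OF assms] by blast
  then show "2 simplex F"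
    unfolding simplex_def using sphere_affine_independent[OF assms t(1)] S(5)[OF t(1)] by auto
qed

lemma sphere_extreme_points:
  assumes "triangulated_sphere V T"
  shows "{v. v extreme_point_of convex hull V} = V"
proof -
  note S = triangulated_sphereD[OF assms]
  have "v extreme_point_of convex hull V" if "v \<in> V" for v
  proof -
    obtain t where t: "t \<in> T" "v \<in> t" using S(3) \<open>v \<in> V\<close> by blast
    then have "v extreme_point_of convex hull t"
      using extreme_point_of_convex_hull_affine_independent[OF sphere_affine_independent[OF assms t(1)]] by blast
    then show ?thesis using extreme_point_of_face[OF sphere_face[OF assms t(1)]] by blast
  qed
  then show ?thesis using extreme_point_of_convex_hull by blast
qed

text \<open>A polytope edge is a proper face, so it lies in a facet, which is a simplex, and its
  ends are vertices of that simplex. Conversely any two vertices of a simplex span a face of it, and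
  a face of a face is a face.\<close>

lemma sphere_bars:
  assumes "triangulated_sphere V T"
  shows "{{u, v} |u v. closed_segment u v edge_of convex hull V} = edges_of T"
proof
  note S = triangulated_sphereD[OF assms]
  show "edges_of T \<subseteq> {{u, v} |u v. closed_segment u v edge_of convex hull V}"
  proof
    fix e assume "e \<in> edges_of T"
    then obtain t u v where t: "t \<in> T" "e = {u, v}" "u \<noteq> v" "e \<subseteq> t"
      unfolding edges_of_def card_2_iff by blast
    then have "closed_segment u v face_of convex hull t"
      using face_of_convex_hull_affine_independent[OF sphere_affine_independent[OF assms t(1)]]
      unfolding segment_convex_hull by blast
    then have "closed_segment u v face_of convex hull V"
      using sphere_face[OF assms t(1)] face_of_trans by blast
    moreover have "aff_dim (closed_segment u v) = 1"
      using t(3) by (simp add: segment_convex_hull aff_dim_convex_hull)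
    ultimately show "e \<in> {{u, v} |u v. closed_segment u v edge_of convex hull V}"
      unfolding edge_of_def using t(2) by blast
  qed
  show "{{u, v} |u v. closed_segment u v edge_of convex hull V} \<subseteq> edges_of T"
  proof
    fix e assume "e \<in> {{u, v} |u v. closed_segment u v edge_of convex hull V}"
    then obtain u v where e: "e = {u, v}" "closed_segment u v face_of convex hull V"
      "aff_dim (closed_segment u v) = 1" unfolding edge_of_def by blast
    have uv: "u \<noteq> v" using e(3) by auto
    have "polyhedron (convex hull V)"
      by (rule polytope_imp_polyhedron) (use S(1) in \<open>auto simp: polytope_def\<close>)
    moreover have "closed_segment u v \<noteq> convex hull V" using e(3) sphere_aff_dim[OF assms] by auto
    ultimately obtain F where F: "F facet_of convex hull V" "closed_segment u v \<subseteq> F"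
      using face_of_polyhedron_subset_facet[OF _ e(2)] by auto
    obtain t where t: "t \<in> T" "F = convex hull t" using sphere_facet[OF assms F(1)] by blast
    have "closed_segment u v face_of convex hull t"
      using face_of_subset[OF e(2) _ face_of_imp_subset[OF sphere_face[OF assms t(1)]]] F(2) t(2) by blast
    then have "u \<in> t" "v \<in> t"
      using extreme_point_of_face[of "closed_segment u v" "convex hull t"]
        extreme_point_of_convex_hull[of _ t] by (auto simp: extreme_point_of_segment)
    then show "e \<in> edges_of T" unfolding edges_of_def using t(1) uv e(1) by auto
  qed
qed

section \<open>Isometries and the point groups of the polyhedron and its framework\<close>

lemma isometry_affine:
  assumes "f \<in> isometries"
  obtains g where "orthogonal_transformation g" "f = (\<lambda>x. f 0 + g x)"
proof -
  define g where "g x = f x - f 0" for x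
  have "orthogonal_transformation g"
    using assms unfolding orthogonal_transformation_isometry isometries_def g_def
    by (simp add: dist_norm)
  then show ?thesis using that[of g] by (simp add: g_def)
qed

lemma isometry_convex_hull:
  assumes "f \<in> isometries"
  shows "f ` (convex hull X) = convex hull (f ` X)"
proof -
  obtain g where g: "orthogonal_transformation g" "f = (\<lambda>x. f 0 + g x)"
    using isometry_affine[OF assms] by blast
  have f: "f ` X = (\<lambda>x. f 0 + x) ` g ` X" for X by (subst g(2)) (simp add: image_image)
  show ?thesis
    unfolding f by (simp add: convex_hull_translation convex_hull_linear_image orthogonal_transformation_linear[OF g(1)])
qed

lemma isometry_face_of:
  assumes "f \<in> isometries" "E face_of P"
  shows "f ` E face_of f ` P"
proof -
  obtain g where g: "orthogonal_transformation g" "f = (\<lambda>x. f 0 + g x)"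
    using isometry_affine[OF assms(1)] by blast
  have f: "f ` X = (+) (f 0) ` g ` X" for X by (subst g(2)) (simp add: image_image)
  show ?thesis unfolding f
    by (simp add: assms(2) face_of_linear_image orthogonal_transformation_linear[OF g(1)]
        orthogonal_transformation_inj[OF g(1)])
qed

lemma isometry_inj: "f \<in> isometries \<Longrightarrow> inj f"
  unfolding isometries_def inj_on_def by (metis (mono_tags, lifting) dist_eq_0_iff mem_Collect_eq)

lemma sphere_polyhedron_point_group:
  assumes "triangulated_sphere V T"
  shows "polyhedron_point_group (convex hull V) = {f \<in> isometries. f ` V = V}"
proof -
  have "f ` V = V" if f: "f \<in> isometries" "f ` (convex hull V) = convex hull V" for f
  proof -
    have E: "v \<in> V \<longleftrightarrow> v extreme_point_of convex hull V" for v using sphere_extreme_points[OF assms] by blast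
    have sub: "f ` V \<subseteq> V"
    proof
      fix x assume "x \<in> f ` V"
      then obtain v where v: "v \<in> V" "x = f v" by blast
      then have "{v} face_of convex hull V" by (simp add: E face_of_singleton)
      then have "{f v} face_of convex hull V" using isometry_face_of[OF f(1)] f(2) by fastforce
      then show "x \<in> V" by (simp add: E v(2) face_of_singleton)
    qed
    show ?thesis
      using endo_inj_surj[OF triangulated_sphereD(1)[OF assms] sub] isometry_inj[OF f(1)] inj_on_subset by blast
  qed
  moreover have "f ` (convex hull V) = convex hull V" if "f \<in> isometries" "f ` V = V" for f
    using isometry_convex_hull[OF that(1), of V] that(2) by simp
  ultimately show ?thesis unfolding polyhedron_point_group_def by blast
qed

text \<open>The condition on bars is automatic: an isometry permuting the vertices preserves the
  convex hull, hence its edges, and these are the bars.\<close>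

lemma sphere_framework_point_group:
  assumes "triangulated_sphere V T"
  shows "framework_point_group (polyhedral_framework (convex hull V)) = {f \<in> isometries. f ` V = V}"
proof -
  have *: "\<exists>e'\<in>edges_of T. f ` e = e'"
    if f: "f \<in> isometries" "f ` V = V" and "e \<in> edges_of T" for f e
  proof -
    have "e \<in> {{u, v} |u v. closed_segment u v edge_of convex hull V}"
      using \<open>e \<in> edges_of T\<close> sphere_bars[OF assms] by simp
    then obtain u v where e: "e = {u, v}" "closed_segment u v face_of convex hull V"
      "aff_dim (closed_segment u v) = 1" unfolding edge_of_def by blast
    have "f ` closed_segment u v = closed_segment (f u) (f v)"
      using isometry_convex_hull[OF f(1), of "{u, v}"] by (simp add: segment_convex_hull)
    then have "closed_segment (f u) (f v) face_of convex hull V"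
      using isometry_face_of[OF f(1) e(2)] isometry_convex_hull[OF f(1), of V] f(2) by simp
    moreover have "f u \<noteq> f v" using e(3) isometry_inj[OF f(1)] by (auto simp: inj_eq)
    then have "aff_dim (closed_segment (f u) (f v)) = 1"
      by (simp add: segment_convex_hull aff_dim_convex_hull)
    ultimately have "closed_segment (f u) (f v) edge_of convex hull V" unfolding edge_of_def by simp
    then have "{f u, f v} \<in> edges_of T" using sphere_bars[OF assms] by blast
    then show ?thesis using e(1) by simp
  qed
  have "framework_point_group (polyhedral_framework (convex hull V)) =
      {f \<in> isometries. f ` V = V \<and> (\<forall>e\<in>edges_of T. \<exists>e'\<in>edges_of T. f ` e = e')}"
    unfolding framework_point_group_def polyhedral_framework_def sphere_bars[OF assms]
    by (simp only: sphere_extreme_points[OF assms] framework.simps image_id id_apply)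
  also have "\<dots> = {f \<in> isometries. f ` V = V}" by (rule Collect_cong) (use * in blast)
  finally show ?thesis .
qed

section \<open>Isostatic graphs\<close>

text \<open>\<omega> is a linear relation among the rows of the rigidity matrix. For
  \<open>e = {u, v}\<close> the inner sum is \<open>v - u\<close>, the summand of v itself being
  zero; points on no edge give an empty sum, so v may range over the whole space.\<close>

definition stress_free :: "(real^3) set set \<Rightarrow> bool" where
  "stress_free E \<longleftrightarrow>
     (\<forall>\<omega>. (\<forall>v. (\<Sum>e | e \<in> E \<and> v \<in> e. \<omega> e *\<^sub>R (\<Sum>u\<in>e. v - u)) = 0) \<longrightarrow> (\<forall>e\<in>E. \<omega> e = 0))"

text \<open>Without self-stress the rank is the number of edges, and the count, written without
  subtraction, says that there is no internal mechanism.\<close>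

definition isostatic_graph :: "(real^3) set \<Rightarrow> (real^3) set set \<Rightarrow> bool" where
  "isostatic_graph V E \<longleftrightarrow>
     finite V \<and> (\<forall>e\<in>E. e \<subseteq> V \<and> card e = 2) \<and> card E + 6 = 3 * card V \<and> stress_free E"

lemma isostatic_graph_finite: "isostatic_graph V E \<Longrightarrow> finite E"
  unfolding isostatic_graph_def by (rule finite_subset[of _ "Pow V"]) auto

lemma equilibrium_sum:
  assumes "finite E" "\<And>e. e \<in> E \<Longrightarrow> card e = 2"
  shows "(\<Sum>e | e \<in> E \<and> v \<in> e. \<omega> e *\<^sub>R (\<Sum>u\<in>e. v - u)) = (\<Sum>u | {v, u} \<in> E. \<omega> {v, u} *\<^sub>R (v - u :: real^3))"
proof -
  have ne: "u \<noteq> v" if "{v, u} \<in> E" for u using assms(2)[OF that] by auto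
  have "inj_on (\<lambda>u. {v, u}) {u. {v, u} \<in> E}"
    using ne by (auto simp: inj_on_def doubleton_eq_iff)
  moreover have "{e. e \<in> E \<and> v \<in> e} = (\<lambda>u. {v, u}) ` {u. {v, u} \<in> E}"
  proof
    show "{e. e \<in> E \<and> v \<in> e} \<subseteq> (\<lambda>u. {v, u}) ` {u. {v, u} \<in> E}"
    proof
      fix e assume e: "e \<in> {e. e \<in> E \<and> v \<in> e}"
      then obtain x y where "e = {x, y}" using assms(2)[of e] by (auto simp: card_2_iff)
      then show "e \<in> (\<lambda>u. {v, u}) ` {u. {v, u} \<in> E}" using e by (auto simp: insert_commute)
    qed
  qed auto
  ultimately have "(\<Sum>e | e \<in> E \<and> v \<in> e. \<omega> e *\<^sub>R (\<Sum>u\<in>e. v - u)) =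
      (\<Sum>u | {v, u} \<in> E. \<omega> {v, u} *\<^sub>R (\<Sum>w\<in>{v, u}. v - w))"
    by (simp only: sum.reindex o_def)
  also have "\<dots> = (\<Sum>u | {v, u} \<in> E. \<omega> {v, u} *\<^sub>R (v - u))"
  proof (rule sum.cong[OF refl])
    fix u assume "u \<in> {u. {v, u} \<in> E}"
    then have "v \<noteq> u" using ne by blast
    then show "\<omega> {v, u} *\<^sub>R (\<Sum>w\<in>{v, u}. v - w) = \<omega> {v, u} *\<^sub>R (v - u)" by simp
  qed
  finally show ?thesis .
qed

section \<open>Stress-freeness and the rank of the rigidity matrix\<close>

lemma fun_space_sum_apply: "(\<Sum>e\<in>E. fun_scale (\<omega> e) (r e)) x = (\<Sum>e\<in>E. \<omega> e * r e x)"
  by (induction E rule: infinite_finite_induct) (auto simp: fun_scale_def)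

lemma rank_of_independent_family:
  assumes "finite E" and ind: "\<And>\<omega>. (\<Sum>e\<in>E. fun_scale (\<omega> e) (r e)) = 0 \<Longrightarrow> \<forall>e\<in>E. \<omega> e = 0"
  shows "fun_space.dim (r ` E) = card E"
proof -
  have inj: "inj_on r E"
  proof (rule inj_onI, rule ccontr)
    fix e e' assume e: "e \<in> E" "e' \<in> E" "r e = r e'" "e \<noteq> e'"
    \<comment> \<open>Two equal rows would satisfy this relation, so passing from the family of rows
      to the set of rows loses nothing.\<close>
    define \<omega> where "\<omega> x = (if x = e then 1 else if x = e' then - 1 else 0 :: real)" for x
    have "(\<Sum>x\<in>E. \<omega> x * r x y) = 0" for y
    proof -
      have "(\<Sum>x\<in>E. \<omega> x * r x y) = (\<Sum>x\<in>{e, e'}. \<omega> x * r x y)"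
        by (rule sum.mono_neutral_right) (use assms(1) e in \<open>auto simp: \<omega>_def\<close>)
      also have "\<dots> = 0" using e by (simp add: \<omega>_def)
      finally show ?thesis .
    qed
    then have "(\<Sum>x\<in>E. fun_scale (\<omega> x) (r x)) = 0"
      by (simp add: fun_eq_iff fun_space_sum_apply)
    then have "\<omega> e = 0" using ind e(1) by blast
    then show False by (simp add: \<omega>_def)
  qed
  have "\<not> fun_space.dependent (r ` E)"
  proof
    assume "fun_space.dependent (r ` E)"
    then obtain u where u: "\<exists>v\<in>r ` E. u v \<noteq> 0" "(\<Sum>v\<in>r ` E. fun_scale (u v) v) = 0"
      using fun_space.dependent_finite[of "r ` E"] assms(1) by auto
    then have "(\<Sum>e\<in>E. fun_scale (u (r e)) (r e)) = 0" by (simp add: sum.reindex[OF inj])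
    then have "\<forall>e\<in>E. u (r e) = 0" using ind[of "\<lambda>e. u (r e)"] by blast
    then show False using u(1) by blast
  qed
  then have "fun_space.dim (r ` E) = card (r ` E)" by (rule fun_space.dim_eq_card_independent)
  then show ?thesis using card_image[OF inj] by simp
qed

lemma isostatic_polyhedral_framework:
  assumes "triangulated_sphere V T" "isostatic_graph V (edges_of T)"
  shows "isostatic (polyhedral_framework (convex hull V))"
proof -
  let ?F = "polyhedral_framework (convex hull V)"
  have J: "joints ?F = V" "bars ?F = edges_of T" "position ?F = id"
    unfolding polyhedral_framework_def using sphere_extreme_points[OF assms(1)] sphere_bars[OF assms(1)] by auto
  note G = assms(2)[unfolded isostatic_graph_def]
  have fin: "finite (edges_of T)" using isostatic_graph_finite[OF assms(2)] .
  have fe: "finite e" if "e \<in> edges_of T" for e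
    using that unfolding edges_of_def by (intro card_ge_0_finite) simp
  have "rigidity_rank ?F = card (edges_of T)"
    unfolding rigidity_rank_def J
  proof (rule rank_of_independent_family[OF fin])
    fix \<omega> assume *: "(\<Sum>e\<in>edges_of T. fun_scale (\<omega> e) (rigidity_matrix ?F e)) = 0"
    \<comment> \<open>Column \<open>(v, i)\<close> of the relation among the rows is the i-th
      coordinate of the equilibrium at v.\<close>
    have "(\<Sum>e | e \<in> edges_of T \<and> v \<in> e. \<omega> e *\<^sub>R (\<Sum>u\<in>e. v - u)) = 0" for v
    proof (rule vec_eq_iff[THEN iffD2], rule allI)
      fix i
      have "(\<Sum>e | e \<in> edges_of T \<and> v \<in> e. \<omega> e *\<^sub>R (\<Sum>u\<in>e. v - u)) $ i =
        (\<Sum>e | e \<in> edges_of T \<and> v \<in> e. \<omega> e * (\<Sum>u\<in>e. v - u) $ i)" by simp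
      also have "\<dots> = (\<Sum>e\<in>edges_of T. \<omega> e * rigidity_matrix ?F e (v, i))"
        by (rule sum.mono_neutral_cong_left) (use fin in \<open>auto simp: rigidity_matrix_def J\<close>)
      also have "\<dots> = (\<Sum>e\<in>edges_of T. fun_scale (\<omega> e) (rigidity_matrix ?F e)) (v, i)"
        by (simp add: fun_space_sum_apply)
      finally show "(\<Sum>e | e \<in> edges_of T \<and> v \<in> e. \<omega> e *\<^sub>R (\<Sum>u\<in>e. v - u)) $ i = 0 $ i"
        using * by simp
    qed
    then show "\<forall>e\<in>edges_of T. \<omega> e = 0" using G unfolding stress_free_def by blast
  qed
  then show ?thesis
    using G unfolding isostatic_def is_framework_def internal_mechanisms_def self_stresses_def J by auto
qed

text \<open>Equilibrium at the new vertex a involves only its three edges, whose directions are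
  independent, so their stresses vanish and a stress of the old graph remains. The count grows by
  three edges for one vertex.\<close>

lemma isostatic_graph_insert:
  assumes "isostatic_graph V E" "a \<notin> V" "t \<subseteq> V" "card t = 3"
    and ind: "\<And>c. (\<Sum>x\<in>t. c x *\<^sub>R (a - x)) = 0 \<Longrightarrow> \<forall>x\<in>t. c x = 0"
  shows "isostatic_graph (insert a V) (E \<union> (\<lambda>x. {a, x}) ` t)"
proof -
  note G = assms(1)[unfolded isostatic_graph_def]
  let ?E = "E \<union> (\<lambda>x. {a, x}) ` t"
  have fin: "finite E" by (rule isostatic_graph_finite[OF assms(1)])
  have ft: "finite t" using assms(4) by (metis card.infinite zero_neq_numeral)
  have at: "a \<notin> t" using assms(2,3) by blast
  have dis: "E \<inter> (\<lambda>x. {a, x}) ` t = {}" using G assms(2) by auto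
  have inj: "inj_on (\<lambda>x. {a, x}) t" using at by (auto simp: inj_on_def doubleton_eq_iff)
  have c2: "card e = 2" if "e \<in> ?E" for e using that G at by (auto simp: card_insert_if)
  have "stress_free ?E"
    unfolding stress_free_def
  proof (intro allI impI)
    fix \<omega> assume eq: "\<forall>v. (\<Sum>e | e \<in> ?E \<and> v \<in> e. \<omega> e *\<^sub>R (\<Sum>u\<in>e. v - u)) = 0"
    have "{u. {a, u} \<in> ?E} = t" using G assms(2) by (auto simp: doubleton_eq_iff)
    then have "(\<Sum>x\<in>t. \<omega> {a, x} *\<^sub>R (a - x)) = 0"
      using eq equilibrium_sum[of ?E \<omega> a] c2 fin ft by simp
    then have "\<forall>x\<in>t. \<omega> {a, x} = 0" by (rule ind)
    then have z: "\<omega> {a, x} = 0" if "x \<in> t" for x using that by blast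
    have "(\<Sum>e | e \<in> E \<and> v \<in> e. \<omega> e *\<^sub>R (\<Sum>u\<in>e. v - u)) = 0" for v
    proof -
      have "(\<Sum>e | e \<in> E \<and> v \<in> e. \<omega> e *\<^sub>R (\<Sum>u\<in>e. v - u)) =
          (\<Sum>e | e \<in> ?E \<and> v \<in> e. \<omega> e *\<^sub>R (\<Sum>u\<in>e. v - u))"
        by (rule sum.mono_neutral_left) (use fin ft z in auto)
      then show ?thesis using eq by simp
    qed
    then have "\<forall>e\<in>E. \<omega> e = 0" using G unfolding stress_free_def by blast
    then show "\<forall>e\<in>?E. \<omega> e = 0" using z by auto
  qed
  moreover have "card ?E = card E + 3"
    using card_Un_disjoint[OF fin finite_imageI[OF ft] dis] card_image[OF inj] assms(4) by simp
  ultimately show ?thesis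
    unfolding isostatic_graph_def using G assms(2,3) c2 by auto
qed

text \<open>Every new vertex is attached to V and never to another new vertex, so they can be
  inserted one at a time.\<close>

lemma isostatic_graph_insert_family:
  assumes "isostatic_graph V E" "finite Y" "inj_on a Y"
    and "\<And>y. y \<in> Y \<Longrightarrow> a y \<notin> V" "\<And>y. y \<in> Y \<Longrightarrow> t y \<subseteq> V" "\<And>y. y \<in> Y \<Longrightarrow> card (t y) = 3"
    and "\<And>y c. y \<in> Y \<Longrightarrow> (\<Sum>x\<in>t y. c x *\<^sub>R (a y - x)) = 0 \<Longrightarrow> \<forall>x\<in>t y. c x = 0"
  shows "isostatic_graph (V \<union> a ` Y) (E \<union> (\<Union>y\<in>Y. (\<lambda>x. {a y, x}) ` t y))"
  using assms(2,3-)
proof (induction Y rule: finite_induct)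
  case empty
  then show ?case using assms(1) by simp
next
  case (insert y Y)
  have "isostatic_graph (V \<union> a ` Y) (E \<union> (\<Union>y\<in>Y. (\<lambda>x. {a y, x}) ` t y))"
  proof (rule insert.IH)
    show "inj_on a Y" using insert.prems(1) by simp
    show "\<forall>x\<in>t z. c x = 0" if "z \<in> Y" "(\<Sum>x\<in>t z. c x *\<^sub>R (a z - x)) = 0" for z c
      by (rule insert.prems(5)) (use that in auto)
  qed (use insert.prems(2-4) in auto)
  moreover have "a y \<notin> V \<union> a ` Y" using insert by (auto simp: inj_on_def)
  moreover have "t y \<subseteq> V \<union> a ` Y" "card (t y) = 3" using insert.prems by auto
  moreover have "\<forall>x\<in>t y. c x = 0" if "(\<Sum>x\<in>t y. c x *\<^sub>R (a y - x)) = 0" for c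
    by (rule insert.prems(5)) (use that in auto)
  ultimately have "isostatic_graph (insert (a y) (V \<union> a ` Y))
      ((E \<union> (\<Union>y\<in>Y. (\<lambda>x. {a y, x}) ` t y)) \<union> (\<lambda>x. {a y, x}) ` t y)"
    by (rule isostatic_graph_insert)
  then show ?case by (simp add: Un_ac)
qed

lemma isostatic_graph_image:
  assumes "isostatic_graph V E" "linear h" "inj h"
  shows "isostatic_graph (h ` V) ((`) h ` E)"
proof -
  note G = assms(1)[unfolded isostatic_graph_def]
  have fin: "finite E" by (rule isostatic_graph_finite[OF assms(1)])
  have card_h: "card (h ` X) = card X" for X
    by (rule card_image[OF inj_on_subset[OF assms(3) subset_UNIV]])
  have inj': "inj ((`) h)" by (rule injI) (use assms(3) in \<open>simp add: inj_image_eq_iff\<close>)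
  have "stress_free ((`) h ` E)"
    unfolding stress_free_def
  proof (intro allI impI)
    fix \<omega> assume eq: "\<forall>v. (\<Sum>e | e \<in> (`) h ` E \<and> v \<in> e. \<omega> e *\<^sub>R (\<Sum>u\<in>e. v - u)) = 0"
    have "(\<Sum>e | e \<in> E \<and> v \<in> e. \<omega> (h ` e) *\<^sub>R (\<Sum>u\<in>e. v - u)) = 0" for v
    proof -
      have S: "{e. e \<in> (`) h ` E \<and> h v \<in> e} = (`) h ` {e. e \<in> E \<and> v \<in> e}"
        using assms(3) by (auto simp: inj_image_mem_iff inj_eq)
      have "h (\<Sum>e | e \<in> E \<and> v \<in> e. \<omega> (h ` e) *\<^sub>R (\<Sum>u\<in>e. v - u)) =
        (\<Sum>e | e \<in> E \<and> v \<in> e. \<omega> (h ` e) *\<^sub>R (\<Sum>u\<in>e. h v - h u))"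
        by (simp add: linear_sum[OF assms(2)] linear_scale[OF assms(2)] linear_diff[OF assms(2)])
      also have "\<dots> = (\<Sum>e | e \<in> E \<and> v \<in> e. \<omega> (h ` e) *\<^sub>R (\<Sum>u\<in>h ` e. h v - u))"
        by (simp add: sum.reindex[OF inj_on_subset[OF assms(3) subset_UNIV]])
      also have "\<dots> = (\<Sum>e\<in>(`) h ` {e. e \<in> E \<and> v \<in> e}. \<omega> e *\<^sub>R (\<Sum>u\<in>e. h v - u))"
        by (simp add: sum.reindex[OF inj_on_subset[OF inj' subset_UNIV]])
      also have "\<dots> = 0" unfolding S[symmetric] using eq by blast
      finally have "h (\<Sum>e | e \<in> E \<and> v \<in> e. \<omega> (h ` e) *\<^sub>R (\<Sum>u\<in>e. v - u)) = h 0"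
        by (simp add: linear_0[OF assms(2)])
      then show ?thesis by (rule injD[OF assms(3)])
    qed
    then have "\<forall>e\<in>E. \<omega> (h ` e) = 0"
      using G[unfolded stress_free_def] by (auto dest!: spec[of _ "\<lambda>e. \<omega> (h ` e)"])
    then show "\<forall>e\<in>(`) h ` E. \<omega> e = 0" by blast
  qed
  moreover have "card ((`) h ` E) = card E" by (rule card_image[OF inj_on_subset[OF inj' subset_UNIV]])
  ultimately show ?thesis
    unfolding isostatic_graph_def using G by (auto simp: card_h)
qed

lemma edges_of_image:
  assumes "inj h"
  shows "edges_of ((`) h ` T) = (`) h ` edges_of T"
proof -
  have card_h: "card (h ` X) = card X" for X
    by (rule card_image[OF inj_on_subset[OF assms subset_UNIV]])
  show ?thesis
  proof
    show "edges_of ((`) h ` T) \<subseteq> (`) h ` edges_of T"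
    proof
      fix e assume "e \<in> edges_of ((`) h ` T)"
      then obtain t where t: "t \<in> T" "e \<subseteq> h ` t" "card e = 2" unfolding edges_of_def by blast
      then obtain d where "d \<subseteq> t" "e = h ` d" by (meson subset_imageE)
      then show "e \<in> (`) h ` edges_of T" using t(1,3) unfolding edges_of_def by (auto simp: card_h)
    qed
    show "(`) h ` edges_of T \<subseteq> edges_of ((`) h ` T)"
      unfolding edges_of_def by (auto simp: card_h)
  qed
qed

section \<open>Stacking pyramids on facets\<close>

text \<open>A facet with a point of Y in its interior gives way to the three triangles joining an
  apex to its edges. The apex is that point moved radially, so that stacking commutes with linear
  symmetries.\<close>

definition stack :: "(real^3) set set \<Rightarrow> (real^3) set \<Rightarrow> real \<Rightarrow> (real^3) set set" where
  "stack T Y \<epsilon> = {t \<in> T. Y \<inter> open_hull t = {}} \<union>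
     {insert ((1 + \<epsilon>) *\<^sub>R y) (t - {w}) |t w y. t \<in> T \<and> w \<in> t \<and> y \<in> Y \<and> y \<in> open_hull t}"

lemma open_hull_coordinates:
  assumes "finite t" "y \<in> open_hull t"
  shows "(\<And>x. x \<in> t \<Longrightarrow> n \<bullet> x = 1) \<Longrightarrow> n \<bullet> y = 1"
    and "w \<in> t \<Longrightarrow> (\<And>x. x \<in> t \<Longrightarrow> d \<bullet> x = (if w = x then 1 else 0)) \<Longrightarrow> 0 < d \<bullet> y"
proof -
  obtain c where c: "\<And>x. x \<in> t \<Longrightarrow> 0 < c x" "sum c t = 1" "y = (\<Sum>x\<in>t. c x *\<^sub>R x)"
    using assms(2) unfolding open_hull_def by blast
  show "n \<bullet> y = 1" if "\<And>x. x \<in> t \<Longrightarrow> n \<bullet> x = 1"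
    unfolding c(3) inner_sum_right using that c(2) by simp
  assume w: "w \<in> t" and d: "\<And>x. x \<in> t \<Longrightarrow> d \<bullet> x = (if w = x then 1 else 0)"
  have "d \<bullet> y = (\<Sum>x\<in>t. if w = x then c x else 0)"
    unfolding c(3) inner_sum_right by (rule sum.cong) (auto simp: d)
  then show "0 < d \<bullet> y" using w c(1) assms(1) by simp
qed

text \<open>If the value were 1, all vertices of \<open>t'\<close> would lie in the plane of t, and
  \<open>t'\<close> would be t.\<close>

lemma open_hull_below:
  assumes S: "triangulated_sphere V T" and "t \<in> T" "t' \<in> T" "y \<in> open_hull t'" "y \<notin> open_hull t"
    and N: "\<And>x. x \<in> V - t \<Longrightarrow> n \<bullet> x < 1" "\<And>x. x \<in> V \<Longrightarrow> n \<bullet> x \<le> 1"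
  shows "n \<bullet> y < 1"
proof (rule ccontr)
  note D = triangulated_sphereD[OF S]
  assume "\<not> n \<bullet> y < 1"
  obtain c where c: "\<And>x. x \<in> t' \<Longrightarrow> 0 < c x" "sum c t' = 1" "y = (\<Sum>x\<in>t'. c x *\<^sub>R x)"
    using assms(4) unfolding open_hull_def by blast
  have *: "1 \<le> (\<Sum>x\<in>t'. c x * (n \<bullet> x))"
    using \<open>\<not> n \<bullet> y < 1\<close> by (simp add: c(3) inner_sum_right)
  have "t' \<subseteq> t"
  proof
    fix x assume x: "x \<in> t'"
    have "n \<bullet> x = 1"
      by (rule convex_combination_eq_1[OF D(6)[OF assms(3)] c(1,2) _ * x]) (use N(2) D(4)[OF assms(3)] in auto)
    then show "x \<in> t" using N(1)[of x] x D(4)[OF assms(3)] by auto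
  qed
  then have "t' = t" using card_subset_eq[OF D(6)[OF assms(2)]] D(5) assms(2,3) by simp
  then show False using assms(4,5) by simp
qed

text \<open>The triangle from the apex \<open>(1 + \<epsilon>) *\<^sub>R y\<close> to the edge of a
  facet opposite w has as its normal the facet normal n tilted along the coordinate functional d of
  w. As d vanishes on that edge, the value 1 is kept there; with c = d \<bullet> y the coefficient
  \<open>\<epsilon> / ((1 + \<epsilon>) * c)\<close> is the one giving the value 1 at the apex. The
  tilt tends to 0 with \<epsilon>, so strict inequalities for n persist.\<close>

lemma eventually_tilted_normal_less:
  fixes n d x :: "real^3"
  assumes "n \<bullet> x < 1" "0 < c"
  shows "\<forall>\<^sub>F \<epsilon> in at_right 0. (n - (\<epsilon> / ((1 + \<epsilon>) * c)) *\<^sub>R d) \<bullet> x < 1"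
    and "\<forall>\<^sub>F \<epsilon> in at_right 0. (n - (\<epsilon> / ((1 + \<epsilon>) * c)) *\<^sub>R d) \<bullet> ((1 + \<epsilon>) *\<^sub>R x) < 1"
proof -
  have "((\<lambda>\<epsilon>. (n - (\<epsilon> / ((1 + \<epsilon>) * c)) *\<^sub>R d) \<bullet> x) \<longlongrightarrow> (n - (0 / ((1 + 0) * c)) *\<^sub>R d) \<bullet> x) (at_right 0)"
    by (intro tendsto_intros) (use assms(2) in auto)
  then show "\<forall>\<^sub>F \<epsilon> in at_right 0. (n - (\<epsilon> / ((1 + \<epsilon>) * c)) *\<^sub>R d) \<bullet> x < 1"
    by (rule order_tendstoD(2)) (use assms(1) in simp)
  have "((\<lambda>\<epsilon>. (n - (\<epsilon> / ((1 + \<epsilon>) * c)) *\<^sub>R d) \<bullet> ((1 + \<epsilon>) *\<^sub>R x)) \<longlongrightarrow>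
      (n - (0 / ((1 + 0) * c)) *\<^sub>R d) \<bullet> ((1 + 0) *\<^sub>R x)) (at_right 0)"
    by (intro tendsto_intros) (use assms(2) in auto)
  then show "\<forall>\<^sub>F \<epsilon> in at_right 0. (n - (\<epsilon> / ((1 + \<epsilon>) * c)) *\<^sub>R d) \<bullet> ((1 + \<epsilon>) *\<^sub>R x) < 1"
    by (rule order_tendstoD(2)) (use assms(1) in simp)
qed

text \<open>All that depends on the size of \<epsilon> is collected in \<open>below\<close> and
  \<open>tilt\<close>, finitely many strict inequalities saying that the old and the tilted planes
  still support the larger vertex set.\<close>

lemma stack_sphere:
  fixes Y :: "(real^3) set"
  assumes S: "triangulated_sphere V T"
    and Y: "finite Y" "\<And>y. y \<in> Y \<Longrightarrow> \<exists>t\<in>T. y \<in> open_hull t"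
    and inj_Y: "\<And>t y y'. t \<in> T \<Longrightarrow> y \<in> Y \<Longrightarrow> y' \<in> Y \<Longrightarrow> y \<in> open_hull t \<Longrightarrow> y' \<in> open_hull t \<Longrightarrow> y = y'"
    and "0 < \<epsilon>"
    and N: "\<And>t x. t \<in> T \<Longrightarrow> x \<in> t \<Longrightarrow> N t \<bullet> x = 1" "\<And>t x. t \<in> T \<Longrightarrow> x \<in> V - t \<Longrightarrow> N t \<bullet> x < 1"
    and d: "\<And>t w x. t \<in> T \<Longrightarrow> w \<in> t \<Longrightarrow> x \<in> t \<Longrightarrow> d t w \<bullet> x = (if w = x then 1 else 0)"
    and below: "\<And>t y. t \<in> T \<Longrightarrow> y \<in> Y \<Longrightarrow> y \<notin> open_hull t \<Longrightarrow> N t \<bullet> ((1 + \<epsilon>) *\<^sub>R y) < 1"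
    and tilt: "\<And>t w y x. t \<in> T \<Longrightarrow> w \<in> t \<Longrightarrow> y \<in> Y \<Longrightarrow> y \<in> open_hull t \<Longrightarrow> x \<in> V - t \<Longrightarrow>
        (N t - (\<epsilon> / ((1 + \<epsilon>) * (d t w \<bullet> y))) *\<^sub>R d t w) \<bullet> x < 1"
      "\<And>t w y x. t \<in> T \<Longrightarrow> w \<in> t \<Longrightarrow> y \<in> Y \<Longrightarrow> y \<in> open_hull t \<Longrightarrow> x \<in> Y - {y} \<Longrightarrow>
        (N t - (\<epsilon> / ((1 + \<epsilon>) * (d t w \<bullet> y))) *\<^sub>R d t w) \<bullet> ((1 + \<epsilon>) *\<^sub>R x) < 1"
  shows "triangulated_sphere (V \<union> (*\<^sub>R) (1 + \<epsilon>) ` Y) (stack T Y \<epsilon>)"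
    and "V \<inter> (*\<^sub>R) (1 + \<epsilon>) ` Y = {}"
    and "isostatic_graph V (edges_of T) \<Longrightarrow>
      isostatic_graph (V \<union> (*\<^sub>R) (1 + \<epsilon>) ` Y) (edges_of (stack T Y \<epsilon>))"
proof -
  note D = triangulated_sphereD[OF S]
  define L where "L y = (1 + \<epsilon>) *\<^sub>R y" for y :: "real^3"
  have L_image: "(*\<^sub>R) (1 + \<epsilon>) ` Y = L ` Y" by (simp add: L_def)
  have L_inj: "L y = L y' \<longleftrightarrow> y = y'" for y y' using \<open>0 < \<epsilon>\<close> by (simp add: L_def)
  have Ny: "N t \<bullet> y = 1" if "t \<in> T" "y \<in> open_hull t" for t y
    using open_hull_coordinates(1)[OF D(6)[OF that(1)] that(2)] N(1)[OF that(1)] by blast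
  have dy: "0 < d t w \<bullet> y" if "t \<in> T" "w \<in> t" "y \<in> open_hull t" for t w y
    using open_hull_coordinates(2)[OF D(6)[OF that(1)] that(3,2)] d[OF that(1,2)] by blast
  have Nle: "N t \<bullet> x \<le> 1" if "t \<in> T" "x \<in> V" for t x
    using N(1)[OF that(1), of x] N(2)[OF that(1), of x] that(2) by (cases "x \<in> t") auto
  have LV: "L y \<notin> V" if "y \<in> Y" for y
  proof
    assume "L y \<in> V"
    obtain t where t: "t \<in> T" "y \<in> open_hull t" using Y(2)[OF \<open>y \<in> Y\<close>] by blast
    then have "N t \<bullet> L y = 1 + \<epsilon>" by (simp add: L_def Ny)
    then show False using Nle[OF t(1) \<open>L y \<in> V\<close>] \<open>0 < \<epsilon>\<close> by simp
  qed
  then show dis: "V \<inter> (*\<^sub>R) (1 + \<epsilon>) ` Y = {}" unfolding L_image by blast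
  have stack: "stack T Y \<epsilon> = {t \<in> T. Y \<inter> open_hull t = {}} \<union>
     {insert (L y) (t - {w}) |t w y. t \<in> T \<and> w \<in> t \<and> y \<in> Y \<and> y \<in> open_hull t}"
    unfolding stack_def L_def ..
  have third: "\<exists>w\<in>t. w \<noteq> x" if "t \<in> T" for t x
  proof (rule ccontr)
    assume "\<not> (\<exists>w\<in>t. w \<noteq> x)"
    then have "t \<subseteq> {x}" by blast
    then have "card t \<le> 1" using card_mono[of "{x}" t] by simp
    then show False using D(5)[OF that] by simp
  qed
  \<comment> \<open>Every edge of an old facet persists in some triangle over that same
    facet.\<close>
  have refine: "\<exists>s\<in>stack T Y \<epsilon>. t - {w} \<subseteq> s \<and> s \<subseteq> t \<union> L ` (Y \<inter> open_hull t)" if "t \<in> T" "w \<in> t" for t w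
  proof (cases "Y \<inter> open_hull t = {}")
    case True
    then show ?thesis using that unfolding stack by blast
  next
    case False
    then obtain y where "y \<in> Y" "y \<in> open_hull t" by blast
    then have "insert (L y) (t - {w}) \<in> stack T Y \<epsilon>" using that unfolding stack by blast
    then show ?thesis using \<open>y \<in> Y\<close> \<open>y \<in> open_hull t\<close> by blast
  qed
  \<comment> \<open>Beyond the edge \<open>t - {w}\<close> a triangle over the neighbouring facet
    contains this edge. It avoids w, and it avoids the apex over t because no point lies in the
    interior of two facets.\<close>
  have across: "\<exists>s\<in>stack T Y \<epsilon>. t - {w} \<subseteq> s \<and> w \<notin> s \<and> L ` (Y \<inter> open_hull t) \<inter> s = {}"
    if tw: "t \<in> T" "w \<in> t" for t w
  proof -
    obtain t' where t': "t' \<in> T" "t - {w} \<subseteq> t'" "w \<notin> t'" using D(8)[OF tw] by blast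
    have "card (t' - (t - {w})) = 1"
      using t' tw D(5,6) by (subst card_Diff_subset) auto
    then obtain w' where w': "t' - (t - {w}) = {w'}" by (auto simp: card_1_singleton_iff)
    then have "w' \<in> t'" "t' - {w'} = t - {w}" using t' by blast+
    then obtain s where s: "s \<in> stack T Y \<epsilon>" "t - {w} \<subseteq> s" "s \<subseteq> t' \<union> L ` (Y \<inter> open_hull t')"
      using refine[OF t'(1), of w'] by metis
    have "w \<in> V" using D(4) tw by blast
    then have "w \<notin> s" using s(3) t'(3) LV by blast
    moreover have "L y \<notin> s" if y: "y \<in> Y" "y \<in> open_hull t" for y
    proof
      assume "L y \<in> s"
      then have "y \<in> open_hull t'" using s(3) LV[OF y(1)] D(4)[OF t'(1)] by (auto simp: L_inj)
      then have "t = t'" using open_hull_unique[OF S tw(1) t'(1) y(2)] by blast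
      then show False using t'(3) tw(2) by blast
    qed
    ultimately show ?thesis using s by blast
  qed
  have facet: "card s = 3 \<and> independent s \<and>
      (\<exists>n. (\<forall>x\<in>s. n \<bullet> x = 1) \<and> (\<forall>x\<in>V \<union> L ` Y - s. n \<bullet> x < 1))" if s: "s \<in> stack T Y \<epsilon>" for s
  proof -
    consider "s \<in> T" "Y \<inter> open_hull s = {}"
      | t w y where "t \<in> T" "w \<in> t" "y \<in> Y" "y \<in> open_hull t" "s = insert (L y) (t - {w})"
      using s unfolding stack by blast
    then show ?thesis
    proof cases
      case 1
      have "N s \<bullet> x < 1" if "x \<in> V \<union> L ` Y - s" for x
        using that N(2)[OF 1(1)] below[OF 1(1)] 1(2) unfolding L_def by blast
      then show ?thesis using D(5,7)[OF 1(1)] N(1)[OF 1(1)] by blast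
    next
      case 2
      note t = 2(1-4)
      define \<delta> where "\<delta> = \<epsilon> / ((1 + \<epsilon>) * (d t w \<bullet> y))"
      define n where "n = N t - \<delta> *\<^sub>R d t w"
      have \<delta>: "0 < \<delta>" using dy[OF t(1,2,4)] \<open>0 < \<epsilon>\<close> by (simp add: \<delta>_def)
      have "\<delta> * (d t w \<bullet> y) = \<epsilon> / (1 + \<epsilon>)"
        using dy[OF t(1,2,4)] by (simp add: \<delta>_def)
      then have "n \<bullet> L y = (1 + \<epsilon>) * (1 - \<epsilon> / (1 + \<epsilon>))"
        by (simp add: n_def L_def inner_diff_left Ny[OF t(1,4)])
      also have "\<dots> = 1" using \<open>0 < \<epsilon>\<close> by (simp add: field_simps)
      finally have nL: "n \<bullet> L y = 1" .
      have nt: "n \<bullet> x = 1" if "x \<in> t - {w}" for x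
        using that N(1)[OF t(1)] d[OF t(1,2)] by (auto simp: n_def inner_diff_left)
      have nw: "n \<bullet> w < 1" using N(1)[OF t(1,2)] d[OF t(1,2,2)] \<delta> by (simp add: n_def inner_diff_left)
      have "n \<bullet> x < 1" if x: "x \<in> V \<union> L ` Y - s" for x
      proof -
        consider "x = w" | "x \<in> V - t" | y' where "x = L y'" "y' \<in> Y - {y}"
          using x 2(5) by blast
        then show ?thesis
          by cases (use nw tilt[OF t] in \<open>auto simp: n_def \<delta>_def L_def\<close>)
      qed
      moreover have "\<forall>x\<in>s. n \<bullet> x = 1" using nL nt 2(5) by blast
      moreover have "card s = 3"
        using LV[OF t(3)] D(4,5,6)[OF t(1)] t(2) unfolding 2(5) by (subst card_insert_disjoint) auto
      \<comment> \<open>The functional \<open>d t w\<close> vanishes on this span but is positive at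
        the apex.\<close>
      moreover have "L y \<notin> span (t - {w})"
      proof
        assume "L y \<in> span (t - {w})"
        moreover have "orthogonal (d t w) x" if "x \<in> t - {w}" for x
          using that d[OF t(1,2)] by (auto simp: orthogonal_def)
        ultimately have "orthogonal (d t w) (L y)" using orthogonal_to_span by blast
        then show False using dy[OF t(1,2,4)] \<open>0 < \<epsilon>\<close> by (simp add: orthogonal_def L_def)
      qed
      then have "independent s"
        unfolding 2(5) using independent_insertI independent_mono[OF D(7)[OF t(1)]] by blast
      ultimately show ?thesis by blast
    qed
  qed
  have un: "\<Union>(stack T Y \<epsilon>) = V \<union> L ` Y"
  proof
    show "\<Union>(stack T Y \<epsilon>) \<subseteq> V \<union> L ` Y" unfolding stack using D(4) by blast
    show "V \<union> L ` Y \<subseteq> \<Union>(stack T Y \<epsilon>)"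
    proof
      fix x assume "x \<in> V \<union> L ` Y"
      then consider t where "t \<in> T" "x \<in> t" | y where "y \<in> Y" "x = L y" using D(3) by blast
      then show "x \<in> \<Union>(stack T Y \<epsilon>)"
      proof cases
        case 1
        obtain w where "w \<in> t" "w \<noteq> x" using third[OF 1(1)] by blast
        then show ?thesis using refine[OF 1(1)] 1(2) by blast
      next
        case 2
        obtain t where t: "t \<in> T" "y \<in> open_hull t" using Y(2)[OF 2(1)] by blast
        obtain w where "w \<in> t" using third[OF t(1)] by blast
        then have "insert (L y) (t - {w}) \<in> stack T Y \<epsilon>" using t 2(1) unfolding stack by blast
        then show ?thesis using 2(2) by blast
      qed
    qed
  qed
  have neighbour: "\<exists>s'\<in>stack T Y \<epsilon>. s - {z} \<subseteq> s' \<and> z \<notin> s'" if s: "s \<in> stack T Y \<epsilon>" and "z \<in> s" for s z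
  proof -
    consider "s \<in> T" "Y \<inter> open_hull s = {}"
      | t w y where "t \<in> T" "w \<in> t" "y \<in> Y" "y \<in> open_hull t" "s = insert (L y) (t - {w})"
      using s unfolding stack by blast
    then show ?thesis
    proof cases
      case 1
      show ?thesis using across[OF 1(1) \<open>z \<in> s\<close>] by blast
    next
      case 2
      \<comment> \<open>Opposite the apex is an old edge, whose neighbour lies over another facet;
        opposite any other vertex is a side of the pyramid, shared with a second triangle over the
        same facet.\<close>
      show ?thesis
      proof (cases "z = L y")
        case True
        obtain s' where s': "s' \<in> stack T Y \<epsilon>" "t - {w} \<subseteq> s'" "L ` (Y \<inter> open_hull t) \<inter> s' = {}"
          using across[OF 2(1,2)] by blast
        have "s - {z} \<subseteq> s'" using s'(2) unfolding True 2(5) by blast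
        moreover have "z \<notin> s'" using s'(3) 2(3,4) unfolding True by blast
        ultimately show ?thesis using s'(1) by blast
      next
        case False
        then have "z \<in> t" using 2(5) \<open>z \<in> s\<close> by blast
        then have "insert (L y) (t - {z}) \<in> stack T Y \<epsilon>" unfolding stack using 2(1,3,4) by blast
        moreover have "s - {z} \<subseteq> insert (L y) (t - {z})" unfolding 2(5) by blast
        moreover have "z \<notin> insert (L y) (t - {z})" using False by blast
        ultimately show ?thesis by blast
      qed
    qed
  qed
  obtain t0 where "t0 \<in> T" using S unfolding triangulated_sphere_def by blast
  moreover obtain w0 where "w0 \<in> t0" using third[OF \<open>t0 \<in> T\<close>] by blast
  ultimately obtain s0 where "s0 \<in> stack T Y \<epsilon>" using refine[of t0 w0] by blast
  then have ne: "stack T Y \<epsilon> \<noteq> {}" by blast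
  have "finite (V \<union> L ` Y)" using D(1) Y(1) by simp
  then show "triangulated_sphere (V \<union> (*\<^sub>R) (1 + \<epsilon>) ` Y) (stack T Y \<epsilon>)"
    unfolding triangulated_sphere_def L_image
    by (intro conjI[OF _ conjI[OF ne conjI[OF un conjI]]] ballI facet neighbour)
  assume iso: "isostatic_graph V (edges_of T)"
  obtain tri where tri: "\<And>y. y \<in> Y \<Longrightarrow> tri y \<in> T" "\<And>y. y \<in> Y \<Longrightarrow> y \<in> open_hull (tri y)"
    using Y(2) by metis
  have tri_unique: "t = tri y" if "t \<in> T" "y \<in> Y" "y \<in> open_hull t" for t y
    using open_hull_unique[OF S that(1) tri(1)[OF that(2)] that(3) tri(2)[OF that(2)]] .
  have edges: "edges_of (stack T Y \<epsilon>) = edges_of T \<union> (\<Union>y\<in>Y. (\<lambda>x. {L y, x}) ` tri y)"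
  proof
    show "edges_of (stack T Y \<epsilon>) \<subseteq> edges_of T \<union> (\<Union>y\<in>Y. (\<lambda>x. {L y, x}) ` tri y)"
    proof
      fix e assume "e \<in> edges_of (stack T Y \<epsilon>)"
      then obtain s where s: "s \<in> stack T Y \<epsilon>" "e \<subseteq> s" "card e = 2" unfolding edges_of_def by blast
      then consider "s \<in> T"
        | t w y where "t \<in> T" "w \<in> t" "y \<in> Y" "y \<in> open_hull t" "s = insert (L y) (t - {w})"
        unfolding stack by blast
      then show "e \<in> edges_of T \<union> (\<Union>y\<in>Y. (\<lambda>x. {L y, x}) ` tri y)"
      proof cases
        case 1
        then show ?thesis using s unfolding edges_of_def by blast
      next
        case 2
        show ?thesis
        proof (cases "L y \<in> e")
          case True
          then obtain x where x: "e = {L y, x}" "x \<noteq> L y" using s(3) by (auto simp: card_2_iff)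
          then have "x \<in> t" using s(2) unfolding 2(5) by blast
          then have "x \<in> tri y" using tri_unique[OF 2(1,3,4)] by simp
          then show ?thesis unfolding x(1) using 2(3) by blast
        next
          case False
          then have "e \<subseteq> t" using s(2) unfolding 2(5) by blast
          then show ?thesis using 2(1) s(3) unfolding edges_of_def by blast
        qed
      qed
    qed
    have "e \<in> edges_of (stack T Y \<epsilon>)" if "e \<in> edges_of T" for e
    proof -
      obtain t where t: "t \<in> T" "e \<subseteq> t" "card e = 2" using \<open>e \<in> edges_of T\<close> unfolding edges_of_def by blast
      then have "e \<noteq> t" using D(5) by fastforce
      then obtain w where w: "w \<in> t" "w \<notin> e" using t(2) by blast
      then have "e \<subseteq> t - {w}" using t(2) by blast
      moreover obtain s where "s \<in> stack T Y \<epsilon>" "t - {w} \<subseteq> s" using refine[OF t(1) w(1)] by blast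
      ultimately show ?thesis unfolding edges_of_def using t(3) by blast
    qed
    moreover have "{L y, x} \<in> edges_of (stack T Y \<epsilon>)" if "y \<in> Y" "x \<in> tri y" for x y
    proof -
      obtain w where w: "w \<in> tri y" "w \<noteq> x" using third[OF tri(1)] \<open>y \<in> Y\<close> by blast
      have "insert (L y) (tri y - {w}) \<in> stack T Y \<epsilon>" using w tri \<open>y \<in> Y\<close> unfolding stack by blast
      moreover have "{L y, x} \<subseteq> insert (L y) (tri y - {w})" using w that by blast
      moreover have "x \<noteq> L y" using that LV D(4) tri(1) by blast
      then have "card {L y, x} = 2" by (auto simp: card_insert_if)
      ultimately show ?thesis unfolding edges_of_def by blast
    qed
    ultimately show "edges_of T \<union> (\<Union>y\<in>Y. (\<lambda>x. {L y, x}) ` tri y) \<subseteq> edges_of (stack T Y \<epsilon>)" by blast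
  qed
  show "isostatic_graph (V \<union> (*\<^sub>R) (1 + \<epsilon>) ` Y) (edges_of (stack T Y \<epsilon>))"
    unfolding L_image edges
  proof (rule isostatic_graph_insert_family[OF iso Y(1)])
    show "inj_on L Y" by (simp add: inj_on_def L_inj)
    fix y assume y: "y \<in> Y"
    show "L y \<notin> V" "tri y \<subseteq> V" "card (tri y) = 3" using LV D(4,5) tri(1) y by auto
    fix c assume c: "(\<Sum>x\<in>tri y. c x *\<^sub>R (L y - x)) = 0"
    note t = tri(1)[OF y]
    \<comment> \<open>The normal of the facet is 1 on its vertices and \<open>1 + \<epsilon>\<close>
      at the apex, so pairing with it forces the coefficient sum to vanish. What remains is a linear
      relation among basis vectors.\<close>
    have *: "sum c (tri y) *\<^sub>R L y = (\<Sum>x\<in>tri y. c x *\<^sub>R x)"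
      using c by (simp add: scaleR_diff_right sum_subtractf scaleR_left.sum)
    have "N (tri y) \<bullet> (sum c (tri y) *\<^sub>R L y) = sum c (tri y) * (1 + \<epsilon>)"
      using Ny[OF t tri(2)[OF y]] by (simp add: L_def)
    moreover have "N (tri y) \<bullet> (\<Sum>x\<in>tri y. c x *\<^sub>R x) = sum c (tri y)"
      using N(1)[OF t] by (simp add: inner_sum_right)
    ultimately have "sum c (tri y) * (1 + \<epsilon>) = sum c (tri y)" using * by simp
    then have "sum c (tri y) = 0" using \<open>0 < \<epsilon>\<close> by (simp add: distrib_left)
    then have z: "(\<Sum>x\<in>tri y. c x *\<^sub>R x) = 0" using * by simp
    show "\<forall>x\<in>tri y. c x = 0"
    proof
      fix w assume w: "w \<in> tri y"
      have "d (tri y) w \<bullet> (\<Sum>x\<in>tri y. c x *\<^sub>R x) = (\<Sum>x\<in>tri y. if w = x then c x else 0)"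
        unfolding inner_sum_right by (rule sum.cong) (auto simp: d[OF t w])
      also have "\<dots> = c w" using w D(6)[OF t] by simp
      finally show "c w = 0" using z by simp
    qed
  qed
qed

definition stackable :: "(real^3) set \<Rightarrow> (real^3) set set \<Rightarrow> (real^3) set \<Rightarrow> real \<Rightarrow> bool" where
  "stackable V T Y \<epsilon> \<longleftrightarrow> triangulated_sphere (V \<union> (*\<^sub>R) (1 + \<epsilon>) ` Y) (stack T Y \<epsilon>) \<and>
    isostatic_graph (V \<union> (*\<^sub>R) (1 + \<epsilon>) ` Y) (edges_of (stack T Y \<epsilon>)) \<and> V \<inter> (*\<^sub>R) (1 + \<epsilon>) ` Y = {}"

text \<open>Each of the finitely many inequalities is strict in the limit \<epsilon> = 0. For apexes
  over other facets this uses that every other point of Y lies off the open hull of t, hence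
  strictly below its plane.\<close>

lemma eventually_stackable:
  fixes Y :: "(real^3) set"
  assumes S: "triangulated_sphere V T" and iso: "isostatic_graph V (edges_of T)"
    and Y: "finite Y" "\<And>y. y \<in> Y \<Longrightarrow> \<exists>t\<in>T. y \<in> open_hull t"
    and inj_Y: "\<And>t y y'. t \<in> T \<Longrightarrow> y \<in> Y \<Longrightarrow> y' \<in> Y \<Longrightarrow> y \<in> open_hull t \<Longrightarrow> y' \<in> open_hull t \<Longrightarrow> y = y'"
  shows "\<forall>\<^sub>F \<epsilon> in at_right 0. stackable V T Y \<epsilon>"
proof -
  note D = triangulated_sphereD[OF S]
  have "\<exists>n. (\<forall>x\<in>t. n \<bullet> x = 1) \<and> (\<forall>x\<in>V - t. n \<bullet> x < 1) \<and> (\<forall>x\<in>V. n \<bullet> x \<le> 1)" if "t \<in> T" for t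
    using sphere_normal[OF S that] by metis
  then obtain N where N: "\<And>t x. t \<in> T \<Longrightarrow> x \<in> t \<Longrightarrow> N t \<bullet> x = 1" "\<And>t x. t \<in> T \<Longrightarrow> x \<in> V - t \<Longrightarrow> N t \<bullet> x < 1"
    "\<And>t x. t \<in> T \<Longrightarrow> x \<in> V \<Longrightarrow> N t \<bullet> x \<le> 1"
    by metis
  have "\<exists>d. \<forall>w\<in>t. \<forall>x\<in>t. d w \<bullet> x = (if w = x then 1 else 0)" if "t \<in> T" for t
    using dual_basis[OF D(7,5)[OF that]] by metis
  then obtain d where d: "\<And>t w x. t \<in> T \<Longrightarrow> w \<in> t \<Longrightarrow> x \<in> t \<Longrightarrow> d t w \<bullet> x = (if w = x then 1 else 0)"
    by metis
  have Ny: "N t \<bullet> y < 1" if "t \<in> T" "y \<in> Y" "y \<notin> open_hull t" for t y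
    using open_hull_below[OF S that(1) _ _ that(3) N(2,3)[OF that(1)]] Y(2)[OF that(2)] by blast
  have dy: "0 < d t w \<bullet> y" if "t \<in> T" "w \<in> t" "y \<in> open_hull t" for t w y
    using open_hull_coordinates(2)[OF D(6)[OF that(1)] that(3,2)] d[OF that(1,2)] by blast
  have fV: "finite V" "finite (V - t)" for t using D(1) by auto
  have "\<forall>\<^sub>F \<epsilon> in at_right 0. \<forall>t\<in>T. \<forall>y\<in>Y. y \<notin> open_hull t \<longrightarrow> N t \<bullet> ((1 + \<epsilon>) *\<^sub>R y) < 1"
  proof (intro eventually_ball_finite ballI D(2) Y(1))
    fix t y assume ty: "t \<in> T" "y \<in> Y"
    show "\<forall>\<^sub>F \<epsilon> in at_right 0. y \<notin> open_hull t \<longrightarrow> N t \<bullet> ((1 + \<epsilon>) *\<^sub>R y) < 1"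
    proof (cases "y \<in> open_hull t")
      case False
      \<comment> \<open>The choice \<open>d = 0\<close> specializes the tilted estimate to the
        untilted normal.\<close>
      then show ?thesis
        using eventually_tilted_normal_less(2)[OF Ny[OF ty False] zero_less_one, where d = 0] by simp
    qed simp
  qed
  moreover have "\<forall>\<^sub>F \<epsilon> in at_right 0. \<forall>t\<in>T. \<forall>w\<in>t. \<forall>y\<in>Y \<inter> open_hull t. \<forall>x\<in>V - t.
      (N t - (\<epsilon> / ((1 + \<epsilon>) * (d t w \<bullet> y))) *\<^sub>R d t w) \<bullet> x < 1"
    by (intro eventually_ball_finite ballI D(2) D(6) fV finite_Int disjI1 Y(1) eventually_tilted_normal_less(1) N(2) dy) auto
  moreover have "\<forall>\<^sub>F \<epsilon> in at_right 0. \<forall>t\<in>T. \<forall>w\<in>t. \<forall>y\<in>Y \<inter> open_hull t. \<forall>x\<in>Y - {y}.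
      (N t - (\<epsilon> / ((1 + \<epsilon>) * (d t w \<bullet> y))) *\<^sub>R d t w) \<bullet> ((1 + \<epsilon>) *\<^sub>R x) < 1"
    by (intro eventually_ball_finite ballI D(2) D(6) finite_Int finite_Diff disjI1 Y(1) eventually_tilted_normal_less(2) Ny dy)
      (use inj_Y in auto)
  moreover have "\<forall>\<^sub>F \<epsilon> in at_right 0. 0 < (\<epsilon> :: real)" by (simp add: eventually_at_right_less)
  ultimately show ?thesis
  proof eventually_elim
    case (elim \<epsilon>)
    have B1: "N t \<bullet> ((1 + \<epsilon>) *\<^sub>R y) < 1" if "t \<in> T" "y \<in> Y" "y \<notin> open_hull t" for t y
      using elim(1) that by blast
    have B2: "(N t - (\<epsilon> / ((1 + \<epsilon>) * (d t w \<bullet> y))) *\<^sub>R d t w) \<bullet> x < 1"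
      if "t \<in> T" "w \<in> t" "y \<in> Y" "y \<in> open_hull t" "x \<in> V - t" for t w y x
      using elim(2) that by blast
    have B3: "(N t - (\<epsilon> / ((1 + \<epsilon>) * (d t w \<bullet> y))) *\<^sub>R d t w) \<bullet> ((1 + \<epsilon>) *\<^sub>R x) < 1"
      if "t \<in> T" "w \<in> t" "y \<in> Y" "y \<in> open_hull t" "x \<in> Y - {y}" for t w y x
      using elim(3) that by blast
    note R = stack_sphere[where N = N and d = d, OF S Y inj_Y elim(4) N(1,2) d B1 B2 B3]
    show ?case unfolding stackable_def by (intro conjI R iso)
  qed
qed

section \<open>Realizable groups\<close>

text \<open>Symmetry is stated for the vertex set alone, to which both the point group of the
  polyhedron and that of its framework reduce.\<close>

definition realizable :: "(real^3 \<Rightarrow> real^3) set \<Rightarrow> bool" where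
  "realizable G \<longleftrightarrow> (\<exists>V T. triangulated_sphere V T \<and> isostatic_graph V (edges_of T) \<and>
     {f \<in> isometries. f ` V = V} = G)"

lemma orthogonal_in_isometries: "orthogonal_transformation g \<Longrightarrow> g \<in> isometries"
  unfolding isometries_def orthogonal_transformation_isometry by blast

text \<open>Moving the polyhedron by h conjugates its symmetry group, so one representative of each
  conjugacy class suffices.\<close>

lemma realizable_conjugate:
  assumes "realizable G" "orthogonal_transformation h"
  shows "realizable ((\<lambda>g. h \<circ> g \<circ> inv h) ` G)"
proof -
  obtain V T where V: "triangulated_sphere V T" "isostatic_graph V (edges_of T)" "{f \<in> isometries. f ` V = V} = G"
    using assms(1) unfolding realizable_def by blast
  have inj: "inj h" and surj: "surj h" and lin: "linear h"
    using assms(2) orthogonal_transformation_inj orthogonal_transformation_surj orthogonal_transformation_linear by auto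
  have hi: "h (inv h x) = x" "inv h (h x) = x" for x using inj surj by (simp_all add: surj_f_inv_f)
  have dist_h: "dist (h x) (h y) = dist x y" for x y
    using assms(2) unfolding orthogonal_transformation_isometry by blast
  have dist_inv: "dist (inv h x) (inv h y) = dist x y" for x y using dist_h[of "inv h x" "inv h y"] hi by simp
  have inv_V: "inv h ` h ` V = V" by (simp add: image_image hi)
  have "{f \<in> isometries. f ` h ` V = h ` V} = (\<lambda>g. h \<circ> g \<circ> inv h) ` {f \<in> isometries. f ` V = V}"
  proof
    show "{f \<in> isometries. f ` h ` V = h ` V} \<subseteq> (\<lambda>g. h \<circ> g \<circ> inv h) ` {f \<in> isometries. f ` V = V}"
    proof
      fix f assume f: "f \<in> {f \<in> isometries. f ` h ` V = h ` V}"
      define g where "g = inv h \<circ> f \<circ> h"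
      have "g \<in> isometries" using f by (simp add: g_def isometries_def dist_h dist_inv)
      moreover have "g ` V = V"
      proof -
        have "g ` V = inv h ` f ` h ` V" by (simp add: g_def image_image)
        moreover have "f ` h ` V = h ` V" using f by simp
        ultimately show ?thesis by (simp only: inv_V)
      qed
      moreover have "f = h \<circ> g \<circ> inv h" by (simp add: g_def fun_eq_iff hi)
      ultimately show "f \<in> (\<lambda>g. h \<circ> g \<circ> inv h) ` {f \<in> isometries. f ` V = V}" by blast
    qed
    show "(\<lambda>g. h \<circ> g \<circ> inv h) ` {f \<in> isometries. f ` V = V} \<subseteq> {f \<in> isometries. f ` h ` V = h ` V}"
    proof
      fix f assume "f \<in> (\<lambda>g. h \<circ> g \<circ> inv h) ` {f \<in> isometries. f ` V = V}"
      then obtain g where g: "g \<in> isometries" "g ` V = V" "f = h \<circ> g \<circ> inv h" by blast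
      have "f \<in> isometries" using g(1) unfolding g(3) by (simp add: isometries_def dist_h dist_inv)
      moreover have "f ` h ` V = h ` V"
      proof -
        have "f ` h ` V = h ` g ` inv h ` h ` V" unfolding g(3) by (simp add: image_image)
        then show ?thesis by (simp only: inv_V g(2))
      qed
      ultimately show "f \<in> {f \<in> isometries. f ` h ` V = h ` V}" by simp
    qed
  qed
  moreover have "isostatic_graph (h ` V) (edges_of ((`) h ` T))"
    using isostatic_graph_image[OF V(2) lin inj] edges_of_image[OF inj, of T] by simp
  ultimately show ?thesis
    unfolding realizable_def V(3) using sphere_image[OF V(1) assms(2)] by blast
qed

text \<open>A ball containing points of a sphere with barycentre at the centre of the sphere is at least as large
  as the sphere, with equality only for concentric balls; so an isometry permuting \<open>V\<close> fixes
  the origin.\<close>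

lemma isometry_fixing_origin:
  assumes "finite B" "B \<noteq> {}" "B \<subseteq> V" "\<Sum>B = 0" "\<And>x. x \<in> B \<Longrightarrow> norm x = r" "\<And>x. x \<in> V \<Longrightarrow> norm x \<le> r"
    and f: "f \<in> isometries" "f ` V = V"
  shows "orthogonal_transformation f"
proof -
  have le: "norm (b - f 0) \<le> r" if b: "b \<in> B" for b
  proof -
    have "b \<in> f ` V" using b assms(3) f(2) by blast
    then obtain x where x: "x \<in> V" "b = f x" by blast
    have "dist (f x) (f 0) = dist x 0" using f(1) unfolding isometries_def by blast
    then show ?thesis using assms(6)[OF x(1)] x(2) by (simp add: dist_norm)
  qed
  have sq: "b \<bullet> b = r\<^sup>2" if "b \<in> B" for b
    using assms(5)[OF that] by (simp add: power2_norm_eq_inner[symmetric])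
  have "(\<Sum>b\<in>B. (norm (b - f 0))\<^sup>2) = (\<Sum>b\<in>B. r\<^sup>2 - 2 * (b \<bullet> f 0) + (norm (f 0))\<^sup>2)"
    by (rule sum.cong[OF refl])
      (simp add: power2_norm_eq_inner inner_diff_left inner_diff_right inner_commute sq)
  also have "\<dots> = card B * r\<^sup>2 - 2 * (\<Sum>B \<bullet> f 0) + card B * (norm (f 0))\<^sup>2"
    by (simp add: sum.distrib sum_subtractf sum_distrib_left inner_sum_left)
  finally have "card B * r\<^sup>2 + card B * (norm (f 0))\<^sup>2 = (\<Sum>b\<in>B. (norm (b - f 0))\<^sup>2)"
    using assms(4) by simp
  also have "\<dots> \<le> (\<Sum>b\<in>B. r\<^sup>2)"
    by (intro sum_mono power_mono le) auto
  finally have "card B * (norm (f 0))\<^sup>2 \<le> 0" by simp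
  moreover have "0 < card B" using assms(1,2) by (simp add: card_gt_0_iff)
  ultimately have "f 0 = 0" by (simp add: mult_le_0_iff)
  then show ?thesis using f(1) unfolding orthogonal_transformation_isometry isometries_def by blast
qed

lemma sphere_nonempty: "triangulated_sphere V T \<Longrightarrow> V \<noteq> {}"
  using triangulated_sphereD(3,5) unfolding triangulated_sphere_def by fastforce

text \<open>The bare polyhedron serves here. This covers the groups in which every facet is
  preserved by reflections, where no asymmetric point with a usable orbit is available.\<close>

lemma realizable_full_symmetry:
  assumes S: "triangulated_sphere V T" "isostatic_graph V (edges_of T)"
    and "\<Sum>V = 0" "\<And>x. x \<in> V \<Longrightarrow> norm x = r"
  shows "realizable (orthogonal_symmetries V)"
proof -
  have "{f \<in> isometries. f ` V = V} = orthogonal_symmetries V"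
    unfolding orthogonal_symmetries_def
    using isometry_fixing_origin[OF triangulated_sphereD(1)[OF S(1)] sphere_nonempty[OF S(1)] order_refl assms(3,4)]
      assms(4) orthogonal_in_isometries by auto
  then show ?thesis using S unfolding realizable_def by blast
qed

lemma open_hull_image:
  assumes "linear g" "inj g" "y \<in> open_hull t"
  shows "g y \<in> open_hull (g ` t)"
proof -
  obtain c where c: "\<And>x. x \<in> t \<Longrightarrow> 0 < c x" "sum c t = 1" "y = (\<Sum>x\<in>t. c x *\<^sub>R x)"
    using assms(3) unfolding open_hull_def by blast
  have g: "inj_on g t" using assms(2) inj_on_subset by blast
  have "g y = (\<Sum>x\<in>g ` t. c (inv g x) *\<^sub>R x)"
    by (simp add: c(3) linear_sum[OF assms(1)] linear_scale[OF assms(1)] sum.reindex[OF g] assms(2))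
  moreover have "(\<Sum>x\<in>g ` t. c (inv g x)) = 1" using c(2) by (simp add: sum.reindex[OF g] assms(2))
  moreover have "\<forall>x\<in>g ` t. 0 < c (inv g x)" using c(1) assms(2) by auto
  ultimately show ?thesis
    unfolding open_hull_def by (intro CollectI exI[of _ "\<lambda>x. c (inv g x)"]) simp
qed

lemma orthogonal_image_eq:
  assumes "orthogonal_transformation g" "finite V" "g ` V \<subseteq> V"
  shows "g ` V = V"
  using endo_inj_surj[OF assms(2,3)] inj_on_subset[OF orthogonal_transformation_inj[OF assms(1)]] by blast

lemma linear_eq_id_on_basis:
  assumes "linear h" "independent t" "card t = 3" "\<And>x. x \<in> t \<Longrightarrow> h x = (x :: real^3)"
  shows "h = id"
proof
  fix z
  obtain d where "\<And>x y. x \<in> t \<Longrightarrow> y \<in> t \<Longrightarrow> d x \<bullet> y = (if x = y then 1 else 0)"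
    and d: "\<And>z. z = (\<Sum>x\<in>t. (d x \<bullet> z) *\<^sub>R x)"
    using dual_basis[OF assms(2,3)] by blast
  have z: "z = (\<Sum>x\<in>t. (d x \<bullet> z) *\<^sub>R x)" by (rule d)
  have "h (\<Sum>x\<in>t. (d x \<bullet> z) *\<^sub>R x) = (\<Sum>x\<in>t. (d x \<bullet> z) *\<^sub>R x)"
    unfolding linear_sum[OF assms(1)] linear_scale[OF assms(1)] by (rule sum.cong) (auto simp: assms(4))
  then show "h z = id z" by (simp only: z[symmetric] id_apply)
qed

text \<open>A facet is a basis contained in V, so a linear map permuting V is determined by its
  restriction to V, and there are finitely many maps from V to V.\<close>

lemma finite_symmetries:
  assumes "triangulated_sphere V T"
  shows "finite (orthogonal_symmetries V)"
proof -
  note D = triangulated_sphereD[OF assms]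
  obtain t where t: "t \<in> T" using assms unfolding triangulated_sphere_def by blast
  have "(\<lambda>g. restrict g V) ` orthogonal_symmetries V \<subseteq> V \<rightarrow>\<^sub>E V"
    unfolding orthogonal_symmetries_def by auto
  moreover have "finite (V \<rightarrow>\<^sub>E V)" using D(1) by (intro finite_PiE) auto
  moreover have "inj_on (\<lambda>g. restrict g V) (orthogonal_symmetries V)"
  proof (rule inj_onI)
    fix g h assume g: "g \<in> orthogonal_symmetries V" and h: "h \<in> orthogonal_symmetries V"
      and eq: "restrict g V = restrict h V"
    have og: "orthogonal_transformation g" "orthogonal_transformation h"
      using g h unfolding orthogonal_symmetries_def by auto
    have "g x = h x" if "x \<in> t" for x using fun_cong[OF eq, of x] that D(4)[OF t] by (auto simp: restrict_def split: if_splits)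
    then have "(inv g \<circ> h) x = x" if "x \<in> t" for x
      using that inv_f_f[OF orthogonal_transformation_inj[OF og(1)], of x] by (simp flip: \<open>\<And>x. x \<in> t \<Longrightarrow> g x = h x\<close>)
    moreover have "linear (inv g \<circ> h)"
      using og orthogonal_transformation_inv orthogonal_transformation_linear linear_compose by blast
    ultimately have "inv g \<circ> h = id" using linear_eq_id_on_basis[OF _ D(7,5)[OF t]] by blast
    then have "g (inv g (h x)) = g x" for x by (simp add: fun_eq_iff)
    then show "g = h" using surj_f_inv_f[OF orthogonal_transformation_surj[OF og(1)]] by (simp add: fun_eq_iff)
  qed
  ultimately show ?thesis using finite_imageD finite_subset by metis
qed

text \<open>Left multiplication by g is injective on the finite set G, hence surjective. Closure
  under composition therefore already makes a nonempty finite set of bijections a group.\<close>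

lemma finite_closed_inverse:
  assumes "finite G" "\<And>g h. g \<in> G \<Longrightarrow> h \<in> G \<Longrightarrow> g \<circ> h \<in> G" "g \<in> G" "bij g"
  shows "id \<in> G" "inv g \<in> G"
proof -
  have inj: "inj_on ((\<circ>) g) G"
    using bij_is_inj[OF assms(4)] by (auto simp: inj_on_def fun_eq_iff)
  have "(\<circ>) g ` G = G"
    using endo_inj_surj[OF assms(1) _ inj] assms(2,3) by blast
  then have surj: "\<exists>h\<in>G. k = g \<circ> h" if "k \<in> G" for k using that by blast
  obtain e where e: "e \<in> G" "g = g \<circ> e" using surj[OF assms(3)] by blast
  have "e x = x" for x 
    using fun_cong[OF e(2), of x] bij_is_inj[OF assms(4)] by (simp add: inj_eq)
  then have "e = id" by auto
  then show "id \<in> G" using e(1) by simp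
  then obtain h where h: "h \<in> G" "id = g \<circ> h" using surj by blast
  have "inv g x = h x" for x
    using fun_cong[OF h(2), of x] inv_f_f[OF bij_is_inj[OF assms(4)], of "h x"] by simp
  then have "inv g = h" by (rule ext)
  then show "inv g \<in> G" using h(1) by simp
qed

text \<open>By the parallelogram law. It places the barycentre of a facet strictly inside the sphere
  through the vertices.\<close>

lemma norm_add_less_double:
  fixes a b :: "real^3"
  assumes "norm a = r" "norm b = r" "a \<noteq> b"
  shows "norm (a + b) < 2 * r"
proof -
  have "(norm (a + b))\<^sup>2 + (norm (a - b))\<^sup>2 = 2 * (norm a)\<^sup>2 + 2 * (norm b)\<^sup>2"
    by (simp add: power2_norm_eq_inner inner_simps inner_commute[of b a])
  moreover have "0 < (norm (a - b))\<^sup>2" using assms(3) by simp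
  ultimately have "(norm (a + b))\<^sup>2 < 2 * r\<^sup>2 + 2 * r\<^sup>2" unfolding assms(1,2) by linarith
  then have "(norm (a + b))\<^sup>2 < (2 * r)\<^sup>2" by (simp add: power_mult_distrib)
  then show ?thesis by (rule power2_less_imp_less) (use assms(1) in auto)
qed

text \<open>The vanishing sum and the common norm make the origin and V recognizable inside the
  final vertex set. \<open>asym\<close> concerns a single labelled facet: u and v are the vertices
  kept in the triangle \<open>{u, v, a}\<close>, and w is the one replaced by the apex a. An
  exchange in G would place two points of the orbit in this triangle.\<close>

lemma realizable_subgroup:
  assumes S: "triangulated_sphere V T" "isostatic_graph V (edges_of T)"
    and V: "\<Sum>V = 0" "\<And>x. x \<in> V \<Longrightarrow> norm x = r"
    and G: "G \<subseteq> orthogonal_symmetries V" "G \<noteq> {}" "\<And>g h. g \<in> G \<Longrightarrow> h \<in> G \<Longrightarrow> g \<circ> h \<in> G"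
    and t0: "{u, v, w} \<in> T"
    and asym: "\<And>h. h \<in> G \<Longrightarrow> \<not> (h u = v \<and> h v = u \<and> h w = w)"
  shows "realizable G"
proof -
  note D = triangulated_sphereD[OF S(1)]
  have G_orth: "orthogonal_transformation g" "g ` V = V" if "g \<in> G" for g
    using G(1) that unfolding orthogonal_symmetries_def by auto
  have finG: "finite G" using G(1) finite_symmetries[OF S(1)] finite_subset by blast
  have bijG: "bij g" if "g \<in> G" for g
    using orthogonal_transformation_bij[OF G_orth(1)[OF that]] .
  have G_inv: "inv g \<in> G" if "g \<in> G" for g
    using finite_closed_inverse(2)[OF finG G(3) that bijG[OF that]] .
  have G_id: "id \<in> G"
    using G(2) finite_closed_inverse(1)[OF finG G(3) _ bijG] by blast
  have distinct: "u \<noteq> v" "u \<noteq> w" "v \<noteq> w"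
    using D(5)[OF t0] by (auto simp: card_insert_if split: if_splits)
  have uvV: "u \<in> V" "v \<in> V" "w \<in> V" using D(4)[OF t0] by auto

  define c where "c t = (1 / 3) *\<^sub>R \<Sum>t" for t :: "(real^3) set"
  have c_hull: "c t \<in> open_hull t" if "t \<in> T" for t
    unfolding open_hull_def c_def using D(5)[OF that]
    by (intro CollectI exI[of _ "\<lambda>_. 1 / 3"]) (simp add: scaleR_sum_right)
  have c_less: "norm (c t) < r" if t: "t \<in> T" for t
  proof -
    obtain a b e where abe: "t = {a, b, e}" "a \<noteq> b" "b \<noteq> e" "a \<noteq> e"
      using D(5)[OF t] by (auto simp: card_3_iff)
    have n: "norm a = r" "norm b = r" "norm e = r" using V(2) D(4)[OF t] abe(1) by auto
    have "norm (\<Sum>t) = norm ((a + b) + e)" using abe by (simp add: add.assoc)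
    also have "\<dots> \<le> norm (a + b) + norm e" by (rule norm_triangle_ineq)
    also have "\<dots> < 3 * r" using norm_add_less_double[OF n(1,2) abe(2)] n(3) by simp
    finally show ?thesis by (simp add: c_def)
  qed
  \<comment> \<open>Keeping the new vertices strictly inside the sphere is what allows V to be
    recognized by the norm r.\<close>
  have "\<forall>\<^sub>F \<epsilon> in at_right 0. \<forall>t\<in>T. (1 + \<epsilon>) * norm (c t) < r"
  proof (intro eventually_ball_finite D(2) ballI)
    fix t assume t: "t \<in> T"
    have "((\<lambda>\<epsilon>. (1 + \<epsilon>) * norm (c t)) \<longlongrightarrow> (1 + 0) * norm (c t)) (at_right 0)"
      by (intro tendsto_intros)
    then show "\<forall>\<^sub>F \<epsilon> in at_right 0. (1 + \<epsilon>) * norm (c t) < r"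
      by (rule order_tendstoD(2)) (use c_less[OF t] in simp)
  qed
  moreover have "\<forall>\<^sub>F \<epsilon> in at_right 0. stackable V T (c ` T) \<epsilon>"
  proof (rule eventually_stackable[OF S])
    show "finite (c ` T)" using D(2) by simp
    show "\<exists>t\<in>T. y \<in> open_hull t" if "y \<in> c ` T" for y using that c_hull by blast
    fix t y y' assume t: "t \<in> T" and y: "y \<in> c ` T" "y' \<in> c ` T" "y \<in> open_hull t" "y' \<in> open_hull t"
    have *: "z = c t" if z: "z \<in> c ` T" "z \<in> open_hull t" for z
    proof -
      obtain t' where t': "t' \<in> T" "z = c t'" using z(1) by blast
      then show ?thesis using open_hull_unique[OF S(1) t t'(1) z(2)] c_hull by simp
    qed
    show "y = y'" using *[OF y(1,3)] *[OF y(2,4)] by simp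
  qed
  moreover have "\<forall>\<^sub>F \<epsilon> in at_right 0. 0 < (\<epsilon> :: real)" by (simp add: eventually_at_right_less)
  ultimately have "\<forall>\<^sub>F \<epsilon> in at_right 0. 0 < \<epsilon> \<and> (\<forall>t\<in>T. (1 + \<epsilon>) * norm (c t) < r) \<and> stackable V T (c ` T) \<epsilon>"
    by eventually_elim simp
  then obtain \<epsilon> where \<epsilon>: "0 < \<epsilon>" "\<And>t. t \<in> T \<Longrightarrow> (1 + \<epsilon>) * norm (c t) < r" and stackable: "stackable V T (c ` T) \<epsilon>"
    using eventually_happens'[OF trivial_limit_at_right_real] by blast
  define C where "C = (*\<^sub>R) (1 + \<epsilon>) ` c ` T"
  define V1 where "V1 = V \<union> C"
  define T1 where "T1 = stack T (c ` T) \<epsilon>"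
  have S1: "triangulated_sphere V1 T1" "isostatic_graph V1 (edges_of T1)" and VC: "V \<inter> C = {}"
    using stackable unfolding stackable_def V1_def C_def T1_def by simp_all
  note D1 = triangulated_sphereD[OF S1(1)]
  have C_norm: "norm x < r" if "x \<in> C" for x
    using that \<epsilon> by (auto simp: C_def)
  have V1_image: "h ` V1 = V1" if h: "orthogonal_transformation h" "h ` V = V" for h
  proof (rule orthogonal_image_eq[OF h(1) D1(1)])
    have "h ((1 + \<epsilon>) *\<^sub>R c t) \<in> C" if t: "t \<in> T" for t
    proof -
      have lin: "linear h" using h(1) by (rule orthogonal_transformation_linear)
      have "inj_on h t" using orthogonal_transformation_inj[OF h(1)] inj_on_subset by blast
      then have "h (c t) = c (h ` t)"
        by (simp add: c_def linear_scale[OF lin] linear_sum[OF lin] sum.reindex)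
      then have "h ((1 + \<epsilon>) *\<^sub>R c t) = (1 + \<epsilon>) *\<^sub>R c (h ` t)" by (simp add: linear_scale[OF lin])
      then show ?thesis unfolding C_def using sphere_symmetry[OF S(1) h t] by blast
    qed
    then have "h ` C \<subseteq> C" unfolding C_def by blast
    then show "h ` V1 \<subseteq> V1" unfolding V1_def using h(2) by blast
  qed

  define a where "a = (1 + \<epsilon>) *\<^sub>R c {u, v, w}"
  have aC: "a \<in> C" unfolding a_def C_def using t0 by blast
  have a_expand: "a = ((1 + \<epsilon>) / 3) *\<^sub>R (u + v + w)"
    using distinct by (simp add: a_def c_def add.assoc)
  have ne: "a \<noteq> u" "a \<noteq> v" using aC VC uvV by auto
  have t1: "{u, v, a} \<in> T1"
  proof -
    have "insert a ({u, v, w} - {w}) \<in> T1"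
      unfolding T1_def stack_def a_def using t0 c_hull[OF t0] by blast
    moreover have "insert a ({u, v, w} - {w}) = {u, v, a}" using distinct by auto
    ultimately show ?thesis by simp
  qed
  have fix_facet: "h = id \<or> (h u = v \<and> h v = u \<and> h w = w \<and> h a = a)"
    if h: "orthogonal_transformation h" "h ` V = V" "h ` {u, v, a} = {u, v, a}" for h
  proof -
    have inj: "inj h" and lin: "linear h"
      using h(1) orthogonal_transformation_inj orthogonal_transformation_linear by auto
    \<comment> \<open>The apex a is the only vertex of this triangle outside V, so h fixes it; since
      a is a multiple of u + v + w and h preserves \<open>{u, v}\<close>, w is fixed as
      well.\<close>
    have "h u \<in> V" "h v \<in> V" "a \<notin> V" using h(2) uvV aC VC by auto
    moreover have "h u \<in> {u, v, a}" "h v \<in> {u, v, a}" "h a \<in> {u, v, a}" using h(3) by blast+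
    moreover have "h u \<noteq> h v" "h u \<noteq> h a" "h v \<noteq> h a" using distinct ne inj by (auto simp: inj_eq)
    ultimately have cases: "h a = a" "(h u = u \<and> h v = v) \<or> (h u = v \<and> h v = u)" by auto
    have "((1 + \<epsilon>) / 3) *\<^sub>R (h u + h v + h w) = ((1 + \<epsilon>) / 3) *\<^sub>R (u + v + w)"
      using cases(1) unfolding a_expand by (simp add: linear_scale[OF lin] linear_add[OF lin])
    then have "h u + h v + h w = u + v + w" using \<epsilon>(1) by simp
    then have hw: "h w = w" using cases(2) by (auto simp: algebra_simps)
    show ?thesis
    proof (cases "h u = u")
      case True
      then have "h x = x" if "x \<in> {u, v, w}" for x using that hw cases(2) distinct by auto
      then have "h = id" using linear_eq_id_on_basis[OF lin D(7,5)[OF t0]] by blast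
      then show ?thesis by simp
    next
      case False
      then show ?thesis using cases hw by blast
    qed
  qed

  \<comment> \<open>The weights of u and v differ, so that the exchange of u and v moves y.\<close>
  define y where "y = (1 / 2) *\<^sub>R u + (1 / 3) *\<^sub>R v + (1 / 6) *\<^sub>R a"
  have y_hull: "y \<in> open_hull {u, v, a}"
    unfolding open_hull_def y_def using distinct ne
    by (intro CollectI exI[of _ "\<lambda>x. if x = u then 1 / 2 else if x = v then 1 / 3 else 1 / 6"]) auto
  have y_norm: "norm y < r"
  proof -
    have "norm y \<le> norm ((1 / 2) *\<^sub>R u) + norm ((1 / 3) *\<^sub>R v) + norm ((1 / 6) *\<^sub>R a)"
      unfolding y_def by (metis (no_types) norm_triangle_ineq norm_triangle_mono order_refl)
    also have "\<dots> < r" using V(2) uvV C_norm[OF aC] by simp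
    finally show ?thesis .
  qed
  define Y where "Y = (\<lambda>g. g y) ` G"
  have g_t1: "g ` {u, v, a} \<in> T1" "g y \<in> open_hull (g ` {u, v, a})" if "g \<in> G" for g
    using sphere_symmetry[OF S1(1) G_orth(1)[OF that] V1_image[OF G_orth[OF that]] t1]
      open_hull_image[OF orthogonal_transformation_linear[OF G_orth(1)[OF that]]
        orthogonal_transformation_inj[OF G_orth(1)[OF that]] y_hull] by auto
  have Y_norm: "norm x = norm y" if "x \<in> Y" for x
    using that G_orth(1) unfolding Y_def by (auto simp: orthogonal_transformation)
  have "\<forall>\<^sub>F \<epsilon> in at_right 0. stackable V1 T1 Y \<epsilon>"
  proof (rule eventually_stackable[OF S1])
    show "finite Y" using finG by (simp add: Y_def)
    show "\<exists>t\<in>T1. x \<in> open_hull t" if "x \<in> Y" for x using that g_t1 unfolding Y_def by blast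
    fix t x x' assume t: "t \<in> T1" and x: "x \<in> Y" "x' \<in> Y" "x \<in> open_hull t" "x' \<in> open_hull t"
    obtain g g' where g: "g \<in> G" "x = g y" "g' \<in> G" "x' = g' y" using x(1,2) unfolding Y_def by blast
    \<comment> \<open>Two elements of G carrying \<open>{u, v, a}\<close> to the same triangle
      differ by an element of G preserving \<open>{u, v, a}\<close>, and \<open>asym\<close> leaves
      only the identity.\<close>
    have "t = g ` {u, v, a}" "t = g' ` {u, v, a}"
      using open_hull_unique[OF S1(1) t] g_t1 g x(3,4) by auto
    then have "g' ` {u, v, a} = g ` {u, v, a}" by simp
    then have im: "(inv g \<circ> g') ` {u, v, a} = {u, v, a}"
      by (simp only: image_comp[symmetric] image_inv_f_f[OF bij_is_inj[OF bijG[OF g(1)]]])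
    have h: "inv g \<circ> g' \<in> G" by (rule G(3)[OF G_inv[OF g(1)] g(3)])
    have "inv g \<circ> g' = id"
      using fix_facet[OF G_orth[OF h] im] asym[OF h] by blast
    then have "g (inv g (g' y)) = g y" by (simp add: fun_eq_iff)
    then show "x = x'" using g surj_f_inv_f[OF bij_is_surj[OF bijG[OF g(1)]]] by simp
  qed
  moreover have "\<forall>\<^sub>F \<epsilon> in at_right 0. (1 + \<epsilon>) * norm y < r"
  proof -
    have "((\<lambda>\<epsilon>. (1 + \<epsilon>) * norm y) \<longlongrightarrow> (1 + 0) * norm y) (at_right 0)"
      by (intro tendsto_intros)
    then show ?thesis by (rule order_tendstoD(2)) (use y_norm in simp)
  qed
  moreover have "\<forall>\<^sub>F \<epsilon> in at_right 0. 0 < (\<epsilon> :: real)" by (simp add: eventually_at_right_less)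
  ultimately have "\<forall>\<^sub>F \<epsilon> in at_right 0. 0 < \<epsilon> \<and> (1 + \<epsilon>) * norm y < r \<and> stackable V1 T1 Y \<epsilon>"
    by eventually_elim simp
  then obtain \<eta> where \<eta>: "0 < \<eta>" "(1 + \<eta>) * norm y < r" and stackable1: "stackable V1 T1 Y \<eta>"
    using eventually_happens'[OF trivial_limit_at_right_real] by blast
  note S2 = stackable1[unfolded stackable_def, THEN conjunct1] stackable1[unfolded stackable_def, THEN conjunct2, THEN conjunct1]
    stackable1[unfolded stackable_def, THEN conjunct2, THEN conjunct2]
  define V2 where "V2 = V1 \<union> (*\<^sub>R) (1 + \<eta>) ` Y"
  note D2 = triangulated_sphereD[OF S2(1), folded V2_def]
  have V_V2: "V \<subseteq> V2" unfolding V2_def V1_def by blast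
  have V2_less: "norm x < r" if "x \<in> V2" "x \<notin> V" for x
    using that C_norm Y_norm \<eta> unfolding V2_def V1_def by auto
  have V2_le: "norm x \<le> r" if "x \<in> V2" for x
    using that V2_less V(2) by (cases "x \<in> V") (auto simp: less_imp_le)
  have "{f \<in> isometries. f ` V2 = V2} = G"
  proof
    show "G \<subseteq> {f \<in> isometries. f ` V2 = V2}"
    proof
      fix g assume g: "g \<in> G"
      have lin: "linear g" using G_orth(1)[OF g] by (rule orthogonal_transformation_linear)
      have "g ((1 + \<eta>) *\<^sub>R x) \<in> (*\<^sub>R) (1 + \<eta>) ` Y" if x: "x \<in> Y" for x
      proof -
        obtain g' where g': "g' \<in> G" "x = g' y" using x unfolding Y_def by blast
        have "(g \<circ> g') y \<in> Y" unfolding Y_def using G(3)[OF g g'(1)] by (rule imageI)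
        then have "(1 + \<eta>) *\<^sub>R g x \<in> (*\<^sub>R) (1 + \<eta>) ` Y" using g'(2) by (intro imageI) simp
        then show ?thesis by (simp only: linear_scale[OF lin])
      qed
      then have "g ` V2 \<subseteq> V2"
        unfolding V2_def using V1_image[OF G_orth[OF g]] by blast
      then have "g ` V2 = V2" by (rule orthogonal_image_eq[OF G_orth(1)[OF g] D2(1)])
      then show "g \<in> {f \<in> isometries. f ` V2 = V2}" using orthogonal_in_isometries[OF G_orth(1)[OF g]] by simp
    qed
    show "{f \<in> isometries. f ` V2 = V2} \<subseteq> G"
    proof
      fix f assume "f \<in> {f \<in> isometries. f ` V2 = V2}"
      then have f: "f \<in> isometries" "f ` V2 = V2" by auto
      have orth: "orthogonal_transformation f"
        by (rule isometry_fixing_origin[OF D(1) sphere_nonempty[OF S(1)] V_V2 V(1,2) V2_le f])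
      have inj: "inj f" using orth by (rule orthogonal_transformation_inj)
      have lin: "linear f" using orth by (rule orthogonal_transformation_linear)
      have "f ` V \<subseteq> V"
      proof
        fix x assume "x \<in> f ` V"
        then obtain z where z: "z \<in> V" "x = f z" by blast
        then have "norm x = r" using orth V(2) by (simp add: orthogonal_transformation)
        moreover have "x \<in> V2" using z V_V2 f(2) by blast
        ultimately show "x \<in> V" using V2_less by force
      qed
      then have fV: "f ` V = V" by (rule orthogonal_image_eq[OF orth D(1)])
      have fV1: "f ` V1 = V1" by (rule V1_image[OF orth fV])
      have "y \<in> Y" unfolding Y_def using imageI[OF G_id, of "\<lambda>g. g y"] by simp
      then have y2: "(1 + \<eta>) *\<^sub>R y \<in> V2" "(1 + \<eta>) *\<^sub>R y \<notin> V1" using S2(3) unfolding V2_def by auto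
      have "f ((1 + \<eta>) *\<^sub>R y) \<in> V2" using y2(1) f(2) by blast
      moreover have "f ((1 + \<eta>) *\<^sub>R y) \<notin> V1"
      proof
        assume "f ((1 + \<eta>) *\<^sub>R y) \<in> V1"
        then have "f ((1 + \<eta>) *\<^sub>R y) \<in> f ` V1" using fV1 by simp
        then show False using y2(2) inj by (simp add: inj_image_mem_iff)
      qed
      ultimately obtain x where x: "x \<in> Y" "f ((1 + \<eta>) *\<^sub>R y) = (1 + \<eta>) *\<^sub>R x" unfolding V2_def by blast
      then have "f y = x" using \<eta>(1) by (simp add: linear_scale[OF lin])
      then obtain g where g: "g \<in> G" "f y = g y" using x(1) unfolding Y_def by blast
      \<comment> \<open>This map fixes y, hence the only triangle having y in its open hull. It is
        not yet known to lie in G, so \<open>asym\<close> does not apply; the unequal weights of y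
        exclude the exchange instead.\<close>
      define h where "h = inv g \<circ> f"
      have gi: "inv g (g z) = z" "g (inv g z) = z" for z
        using bijG[OF g(1)] by (simp_all add: bij_is_inj bij_is_surj surj_f_inv_f)
      have h: "orthogonal_transformation h" "h ` V = V"
      proof -
        show "orthogonal_transformation h"
          unfolding h_def by (rule orthogonal_transformation_compose[OF G_orth(1)[OF G_inv[OF g(1)]] orth])
        have "h ` V = inv g ` f ` V" by (simp add: h_def image_image)
        then show "h ` V = V" by (simp only: fV G_orth(2)[OF G_inv[OF g(1)]])
      qed
      have hy: "h y = y" by (simp add: h_def g(2) gi)
      have "h ` {u, v, a} \<in> T1" by (rule sphere_symmetry[OF S1(1) h(1) V1_image[OF h] t1])
      moreover have "y \<in> open_hull (h ` {u, v, a})"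
        using open_hull_image[OF orthogonal_transformation_linear[OF h(1)] orthogonal_transformation_inj[OF h(1)] y_hull] hy
        by simp
      ultimately have "h ` {u, v, a} = {u, v, a}"
        using open_hull_unique[OF S1(1) _ t1 _ y_hull] by blast
      then have "h = id \<or> (h u = v \<and> h v = u \<and> h w = w \<and> h a = a)" by (rule fix_facet[OF h])
      moreover have "\<not> (h u = v \<and> h v = u \<and> h a = a)"
      proof
        assume swap: "h u = v \<and> h v = u \<and> h a = a"
        have hl: "linear h" using h(1) by (rule orthogonal_transformation_linear)
        have "h y = (1 / 2) *\<^sub>R v + (1 / 3) *\<^sub>R u + (1 / 6) *\<^sub>R a"
          using swap by (simp add: y_def linear_add[OF hl] linear_scale[OF hl])
        then have e: "y = (1 / 2) *\<^sub>R v + (1 / 3) *\<^sub>R u + (1 / 6) *\<^sub>R a" by (simp only: hy)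
        have "u $ i = v $ i" for i
          using arg_cong[OF e, of "\<lambda>x. x $ i"] by (simp add: y_def)
        then show False using distinct(1) by (simp add: vec_eq_iff)
      qed
      ultimately have "h = id" by blast
      then have "f z = g z" for z using gi(2)[of "f z"] by (simp add: h_def fun_eq_iff)
      then have "f = g" by (rule ext)
      then show "f \<in> G" using g(1) by simp
    qed
  qed
  then show ?thesis unfolding realizable_def V2_def using S2(1,2) by blast
qed

lemma realizable_imp:
  assumes "realizable G"
  shows "(\<exists>P. triangulated_convex_polyhedron P \<and> polyhedron_point_group P = G \<and>
              isostatic (polyhedral_framework P)) \<and>
         (\<exists>F :: (real^3) framework. isostatic F \<and> framework_point_group F = G)"
proof -
  obtain V T where V: "triangulated_sphere V T" "isostatic_graph V (edges_of T)" "{f \<in> isometries. f ` V = V} = G"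
    using assms unfolding realizable_def by blast
  show ?thesis
    using sphere_triangulated_convex_polyhedron[OF V(1)] isostatic_polyhedral_framework[OF V(1,2)]
      sphere_polyhedron_point_group[OF V(1)] sphere_framework_point_group[OF V(1)] V(3) by blast
qed

section \<open>Bipyramids\<close>

text \<open>Pairing a linear relation with the cross product of two of the vectors isolates the
  coefficient of the third, multiplied each time by the same determinant.\<close>

lemma triple_product_imp_independent:
  fixes u v w :: "real^3"
  assumes "u \<bullet> cross3 v w \<noteq> 0"
  shows "card {u, v, w} = 3" "independent {u, v, w}"
proof -
  have ne: "u \<noteq> v" "u \<noteq> w" "v \<noteq> w" using assms by (auto simp: dot_cross_self cross_refl)
  then show "card {u, v, w} = 3" by simp
  show "independent {u, v, w}"
  proof
    assume "dependent {u, v, w}"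
    then obtain f where f: "\<exists>x\<in>{u, v, w}. f x \<noteq> 0" "(\<Sum>x\<in>{u, v, w}. f x *\<^sub>R x) = 0"
      using dependent_finite[of "{u, v, w}"] by auto
    have s: "f u *\<^sub>R u + f v *\<^sub>R v + f w *\<^sub>R w = 0" using f(2) ne by (simp add: add.assoc)
    have "f u * (u \<bullet> cross3 v w) = 0"
      using arg_cong[OF s, of "\<lambda>x. x \<bullet> cross3 v w"] by (simp add: inner_add_left dot_cross_self)
    moreover have "f v * (v \<bullet> cross3 w u) = 0"
      using arg_cong[OF s, of "\<lambda>x. x \<bullet> cross3 w u"] by (simp add: inner_add_left dot_cross_self)
    moreover have "f w * (w \<bullet> cross3 u v) = 0"
      using arg_cong[OF s, of "\<lambda>x. x \<bullet> cross3 u v"] by (simp add: inner_add_left dot_cross_self)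
    moreover have "v \<bullet> cross3 w u = u \<bullet> cross3 v w" "w \<bullet> cross3 u v = u \<bullet> cross3 v w"
      by (simp_all add: cross3_simps)
    ultimately show False using assms f(1) by auto
  qed
qed

lemma sum_zero_of_antipodal:
  fixes V :: "(real^3) set"
  assumes "uminus ` V = V"
  shows "\<Sum>V = 0"
proof -
  have "\<Sum>V = \<Sum>(uminus ` V)" using assms by simp
  also have "\<dots> = - \<Sum>V" by (subst sum.reindex) (auto simp: sum_negf)
  finally show ?thesis by (simp add: eq_neg_iff_add_eq_0 flip: scaleR_2)
qed

text \<open>A regular polygon indexed by all integers, so that the neighbours of j are j + 1 and j -
  1 without reduction modulo N.\<close>

definition equator :: "nat \<Rightarrow> int \<Rightarrow> real^3" where
  "equator N j = vector [cos (2 * pi * j / N), sin (2 * pi * j / N), 0]"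

definition pole :: "real \<Rightarrow> real^3" where
  "pole s = vector [0, 0, s]"

definition bipyramid_vertices :: "nat \<Rightarrow> (real^3) set" where
  "bipyramid_vertices N = range (equator N) \<union> {pole 1, pole (-1)}"

definition bipyramid_facets :: "nat \<Rightarrow> (real^3) set set" where
  "bipyramid_facets N = {{pole s, equator N j, equator N (j + 1)} |s j. s \<in> {1, -1}}"

lemma equator_components [simp]:
  "equator N j $ 1 = cos (2 * pi * j / N)" "equator N j $ 2 = sin (2 * pi * j / N)" "equator N j $ 3 = 0"
  by (simp_all add: equator_def)

lemma pole_components [simp]: "pole s $ 1 = 0" "pole s $ 2 = 0" "pole s $ 3 = s"
  by (simp_all add: pole_def)

lemma equator_neq_pole [simp]: "s \<noteq> 0 \<Longrightarrow> equator N j \<noteq> pole s" "s \<noteq> 0 \<Longrightarrow> pole s \<noteq> equator N j"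
  by (metis equator_components(3) pole_components(3))+

lemma pole_eq_iff [simp]: "pole s = pole s' \<longleftrightarrow> s = s'"
  by (metis pole_components(3))

lemma equator_eq_iff:
  assumes "N > 0"
  shows "equator N j = equator N k \<longleftrightarrow> int N dvd j - k"
proof -
  have "equator N j = equator N k \<longleftrightarrow>
      sin (2 * pi * j / N) = sin (2 * pi * k / N) \<and> cos (2 * pi * j / N) = cos (2 * pi * k / N)"
    by (auto simp: vec_eq_iff forall_3)
  also have "\<dots> \<longleftrightarrow> (\<exists>q::int. 2 * pi * j / N = 2 * pi * k / N + 2 * pi * q)"
    by (rule sin_cos_eq_iff)
  also have "\<dots> \<longleftrightarrow> (\<exists>q::int. j - k = int N * q)"
  proof (rule ex_cong1)
    fix q :: int
    have "2 * pi * j / N = 2 * pi * k / N + 2 * pi * q \<longleftrightarrow> 2 * pi * real_of_int j = 2 * pi * (real_of_int k + N * q)"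
      using assms by (simp add: field_simps)
    also have "\<dots> \<longleftrightarrow> real_of_int j = real_of_int k + N * q" by simp
    also have "\<dots> \<longleftrightarrow> real_of_int j = real_of_int (k + int N * q)" by simp
    also have "\<dots> \<longleftrightarrow> j = k + int N * q" by (rule of_int_eq_iff)
    finally show "2 * pi * j / N = 2 * pi * k / N + 2 * pi * q \<longleftrightarrow> j - k = int N * q" by auto
  qed
  finally show ?thesis by (auto simp: dvd_def)
qed

lemma equator_mod: "N > 0 \<Longrightarrow> equator N (j mod int N) = equator N j"
  by (simp add: equator_eq_iff mod_eq_dvd_iff[symmetric])

lemma range_equator:
  assumes "N > 0"
  shows "range (equator N) = equator N ` {0..<int N}"
proof
  show "range (equator N) \<subseteq> equator N ` {0..<int N}"
  proof
    fix x assume "x \<in> range (equator N)"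
    then obtain j where "x = equator N (j mod int N)" using equator_mod[OF assms] by auto
    then show "x \<in> equator N ` {0..<int N}" using assms by simp
  qed
qed blast

lemma inj_on_equator: "N > 0 \<Longrightarrow> inj_on (equator N) {0..<int N}"
  by (auto simp: inj_on_def equator_eq_iff simp flip: mod_eq_dvd_iff)

text \<open>The line through an edge of a regular polygon has all other vertices strictly on its
  inner side. With r = m mod N the difference of the two cosines is 2 sin(pi r / N) sin(pi (r - 1) /
  N), positive because 2 \<le> r < N.\<close>

lemma cos_mid_edge_less:
  assumes "N \<ge> 3" "\<not> int N dvd m" "\<not> int N dvd m - 1"
  shows "cos (2 * pi * m / N - pi / N) < cos (pi / N)"
proof -
  define r where "r = m mod int N"
  have r: "0 \<le> r" "r < int N" using assms(1) by (auto simp: r_def)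
  have "r \<noteq> 0" using assms(2) by (auto simp: r_def dvd_eq_mod_eq_0)
  moreover have "r \<noteq> 1"
  proof
    assume "r = 1"
    then have "m mod int N = 1 mod int N" using assms(1) by (simp add: r_def)
    then show False using assms(3) by (simp add: mod_eq_dvd_iff)
  qed
  ultimately have r2: "2 \<le> r" using r by linarith
  define q where "q = m div int N"
  have "m = r + int N * q" by (simp add: r_def q_def)
  then have m: "real_of_int m = real_of_int r + real N * real_of_int q" by simp
  have sin_gt: "0 < sin (pi * x / N)" if "0 < x" "x < N" for x :: real
    using that by (intro sin_gt_zero) (simp_all add: pos_divide_less_eq)
  have shift: "2 * pi * m / N - pi / N = (2 * pi * r / N - pi / N) + 2 * pi * q"
    using assms(1) by (simp add: m field_simps)
  have "cos (2 * pi * m / N - pi / N) = cos (2 * pi * r / N - pi / N)"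
    unfolding shift cos_add[of _ "2 * pi * q"] cos_int_2pin sin_int_2pin by simp
  moreover have "cos (pi / N) - cos (2 * pi * r / N - pi / N) = 2 * sin (pi * r / N) * sin (pi * (r - 1) / N)"
  proof -
    have 1: "pi / N = pi * r / N - pi * (r - 1) / N" "2 * pi * r / N - pi / N = pi * r / N + pi * (r - 1) / N"
      using assms(1) by (simp_all add: field_simps)
    show ?thesis unfolding 1(2) by (subst 1(1)) (simp add: cos_add cos_diff)
  qed
  moreover have "0 < sin (pi * r / N)" "0 < sin (pi * (r - 1) / N)"
    using r r2 by (auto intro!: sin_gt)
  ultimately show ?thesis 
    using mult_pos_pos[of "sin (pi * r / N)" "sin (pi * (r - 1) / N)"] by linarith
qed

lemma bipyramid_sphere:
  assumes N: "N \<ge> 3"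
  shows "triangulated_sphere (bipyramid_vertices N) (bipyramid_facets N)"
proof -
  have N0: "N > 0" using N by simp
  have half: "0 < pi / N" "pi / N < pi / 2" using N by (auto simp: field_simps)
  then have cpos: "0 < cos (pi / N)" by (intro cos_gt_zero) auto
  have spos: "0 < sin (pi / N)" using half pi_gt_zero by (intro sin_gt_zero) linarith+
  have fin: "finite (bipyramid_vertices N)"
    unfolding bipyramid_vertices_def range_equator[OF N0] by simp
  have ne_facets: "bipyramid_facets N \<noteq> {}" unfolding bipyramid_facets_def by blast
  have un: "\<Union>(bipyramid_facets N) = bipyramid_vertices N"
    unfolding bipyramid_facets_def bipyramid_vertices_def by blast
  have facet: "card t = 3 \<and> independent t \<and>
      (\<exists>n. (\<forall>x\<in>t. n \<bullet> x = 1) \<and> (\<forall>x\<in>bipyramid_vertices N - t. n \<bullet> x < 1))" if t_in: "t \<in> bipyramid_facets N" for t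
  proof -
    obtain s j where s: "s = 1 \<or> s = - 1" and t: "t = {pole s, equator N j, equator N (j + 1)}"
      using t_in unfolding bipyramid_facets_def by blast
    \<comment> \<open>\<alpha> is the direction of the midpoint of the edge, at distance cos(pi / N)
      from the axis. Division by this distance gives the value 1 at both ends of the edge; the third
      component s gives it at the pole.\<close>
    define \<alpha> where "\<alpha> = 2 * pi * j / N + pi / N"
    define n :: "real^3" where "n = vector [cos \<alpha> / cos (pi / N), sin \<alpha> / cos (pi / N), s]"
    have pn: "n \<bullet> pole s' = s * s'" for s' by (simp add: n_def inner_vec_def sum_3)
    have en: "n \<bullet> equator N k = cos (2 * pi * (k - j) / N - pi / N) / cos (pi / N)" for k
    proof -
      have "2 * pi * (k - j) / N - pi / N = 2 * pi * k / N - \<alpha>"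
        by (simp add: \<alpha>_def right_diff_distrib diff_divide_distrib)
      then show ?thesis by (simp add: n_def inner_vec_def sum_3 cos_diff add_divide_distrib mult.commute)
    qed
    have "pole s \<bullet> cross3 (equator N j) (equator N (j + 1)) = s * sin (2 * pi * (j + 1) / N - 2 * pi * j / N)"
      by (simp add: cross3_def inner_vec_def sum_3 sin_diff algebra_simps)
    also have "2 * pi * (j + 1) / N - 2 * pi * j / N = 2 * (pi / N)"
      by (simp add: add_divide_distrib ring_distribs)
    finally have "pole s \<bullet> cross3 (equator N j) (equator N (j + 1)) = s * (2 * sin (pi / N) * cos (pi / N))"
      by (simp only: sin_double)
    then have "pole s \<bullet> cross3 (equator N j) (equator N (j + 1)) \<noteq> 0"
      using s spos cpos by auto
    note ind = triple_product_imp_independent[OF this, folded t]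
    have "n \<bullet> x = 1" if x: "x \<in> t" for x
    proof -
      consider "x = pole s" | "x = equator N j" | "x = equator N (j + 1)" using x unfolding t by blast
      then show ?thesis
      proof cases
        case 1 then show ?thesis using s by (auto simp: pn)
      next
        case 2 then show ?thesis using cpos by (simp add: en)
      next
        case 3
        have "2 * pi / N - pi / N = pi / N" by (simp add: field_simps)
        then show ?thesis using 3 cpos by (simp add: en)
      qed
    qed
    moreover have "n \<bullet> x < 1" if x: "x \<in> bipyramid_vertices N - t" for x
    proof -
      consider k where "x = equator N k" | s' where "s' \<in> {1, -1}" "x = pole s'"
        using x unfolding bipyramid_vertices_def by blast
      then show ?thesis
      proof cases
        case 1
        then have "equator N k \<noteq> equator N j" "equator N k \<noteq> equator N (j + 1)" using x t by auto
        then have "\<not> int N dvd k - j" "\<not> int N dvd (k - j) - 1"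
          by (auto simp: equator_eq_iff[OF N0] diff_diff_eq)
        from cos_mid_edge_less[OF N this] show ?thesis using cpos by (simp add: 1 en)
      next
        case 2
        then have "s' \<noteq> s" using x t by auto
        then show ?thesis using 2 s by (auto simp: pn)
      qed
    qed
    ultimately show ?thesis using ind by blast
  qed
  have neighbour: "\<exists>t'\<in>bipyramid_facets N. t - {w} \<subseteq> t' \<and> w \<notin> t'" if "t \<in> bipyramid_facets N" "w \<in> t" for t w
  proof -
    obtain s j where s: "s = 1 \<or> s = - 1" and t: "t = {pole s, equator N j, equator N (j + 1)}"
      using \<open>t \<in> _\<close> unfolding bipyramid_facets_def by blast
    have F: "{pole s', equator N k, equator N (k + 1)} \<in> bipyramid_facets N" if "s' \<in> {1, -1}" for s' k
      using that unfolding bipyramid_facets_def by blast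
    have ne: "equator N k \<noteq> equator N (k + 1)" "equator N k \<noteq> equator N (k + 2)" for k
    proof -
      have "\<not> int N dvd 1" "\<not> int N dvd 2" using N zdvd_imp_le[of "int N"] by fastforce+
      then show "equator N k \<noteq> equator N (k + 1)" "equator N k \<noteq> equator N (k + 2)"
        by (simp_all add: equator_eq_iff[OF N0])
    qed
    consider "w = pole s" | "w = equator N j" | "w = equator N (j + 1)" using \<open>w \<in> t\<close> unfolding t by blast
    then show ?thesis
    proof cases
      case 1
      then show ?thesis using s t F[of "- s" j] by (intro bexI[of _ "{pole (- s), equator N j, equator N (j + 1)}"]) auto
    next
      case 2
      have "{pole s, equator N (j + 1), equator N (j + 2)} \<in> bipyramid_facets N"
        using s F[of s "j + 1"] by (auto simp: add.commute)
      then show ?thesis using 2 s t ne[of j]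
        by (intro bexI[of _ "{pole s, equator N (j + 1), equator N (j + 2)}"]) auto
    next
      case 3
      have "equator N (j + 1) \<noteq> equator N (j - 1)" using ne(2)[of "j - 1"] by (simp add: add.commute)
      moreover have "{pole s, equator N (j - 1), equator N j} \<in> bipyramid_facets N" using s F[of s "j - 1"] by auto
      ultimately show ?thesis using 3 s t ne(1)[of j]
        by (intro bexI[of _ "{pole s, equator N (j - 1), equator N j}"]) auto
    qed
  qed
  show ?thesis unfolding triangulated_sphere_def
    by (intro conjI[OF fin conjI[OF ne_facets conjI[OF un conjI]]] ballI facet neighbour)
qed

lemma two_subset_of_triple:
  assumes "e \<subseteq> {x, y, z}" "card e = 2"
  shows "e = {x, y} \<or> e = {x, z} \<or> e = {y, z}"
proof -
  obtain a b where ab: "e = {a, b}" "a \<noteq> b" using assms(2) by (auto simp: card_2_iff)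
  then have "a \<in> {x, y, z}" "b \<in> {x, y, z}" using assms(1) by auto
  then show ?thesis using ab by (auto simp: insert_commute)
qed

lemma equator_neq:
  assumes "N \<ge> 3"
  shows "equator N k \<noteq> equator N (k + 1)" "equator N k \<noteq> equator N (k - 1)" "equator N (k + 1) \<noteq> equator N (k - 1)"
proof -
  have N0: "N > 0" using assms by simp
  have "\<not> int N dvd 1" "\<not> int N dvd 2" using assms zdvd_imp_le[of "int N"] by fastforce+
  then show "equator N k \<noteq> equator N (k + 1)" "equator N k \<noteq> equator N (k - 1)" "equator N (k + 1) \<noteq> equator N (k - 1)"
    by (simp_all add: equator_eq_iff[OF N0])
qed

lemma bipyramid_edges:
  assumes "N \<ge> 3"
  shows "edges_of (bipyramid_facets N) =
    {{pole s, equator N j} |s j. s \<in> {1, -1}} \<union> {{equator N j, equator N (j + 1)} |j. True}" (is "?E = ?A \<union> ?B")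
proof
  show "?E \<subseteq> ?A \<union> ?B"
  proof
    fix e assume "e \<in> ?E"
    then obtain s j where s: "s \<in> {1, -1}" and e: "e \<subseteq> {pole s, equator N j, equator N (j + 1)}" "card e = 2"
      unfolding edges_of_def bipyramid_facets_def by blast
    show "e \<in> ?A \<union> ?B" using two_subset_of_triple[OF e] s by blast
  qed
  have F: "{pole s, equator N j, equator N (j + 1)} \<in> bipyramid_facets N" if "s \<in> {1, -1}" for s j
    using that unfolding bipyramid_facets_def by blast
  have "?A \<subseteq> ?E"
  proof
    fix e assume "e \<in> ?A"
    then obtain s j where s: "s \<in> {1, -1}" and e: "e = {pole s, equator N j}" by blast
    have "pole s \<noteq> equator N j" using s by auto
    then have "card e = 2" unfolding e by simp
    moreover have "e \<subseteq> {pole s, equator N j, equator N (j + 1)}" unfolding e by blast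
    ultimately show "e \<in> ?E" unfolding edges_of_def using F[OF s] by blast
  qed
  moreover have "?B \<subseteq> ?E"
  proof
    fix e assume "e \<in> ?B"
    then obtain j where e: "e = {equator N j, equator N (j + 1)}" by blast
    have "card e = 2" unfolding e using equator_neq(1)[OF assms] by simp
    moreover have "e \<subseteq> {pole 1, equator N j, equator N (j + 1)}" unfolding e by blast
    ultimately show "e \<in> ?E" unfolding edges_of_def using F[of 1 j] by blast
  qed
  ultimately show "?A \<union> ?B \<subseteq> ?E" by blast
qed

lemma bipyramid_neighbours:
  assumes "N \<ge> 3"
  shows "{u. {equator N j, u} \<in> edges_of (bipyramid_facets N)} =
      {pole 1, pole (-1), equator N (j + 1), equator N (j - 1)}"
    and "{u. {pole 1, u} \<in> edges_of (bipyramid_facets N)} = range (equator N)"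
proof -
  have N0: "N > 0" using assms by simp
  have shift: "equator N (i + 1) = equator N (k + 1)" "equator N (i - 1) = equator N (k - 1)"
    if "equator N i = equator N k" for i k
    using that by (simp_all add: equator_eq_iff[OF N0])
  show "{u. {equator N j, u} \<in> edges_of (bipyramid_facets N)} =
      {pole 1, pole (-1), equator N (j + 1), equator N (j - 1)}" (is "?L = ?R")
  proof
    show "?L \<subseteq> ?R"
    proof
      fix u assume "u \<in> ?L"
      then consider s k where "s \<in> {1, -1}" "{equator N j, u} = {pole s, equator N k}"
        | k where "{equator N j, u} = {equator N k, equator N (k + 1)}"
        unfolding bipyramid_edges[OF assms] by blast
      then show "u \<in> ?R"
      proof cases
        case 1
        then have "u = pole s" by (auto simp: doubleton_eq_iff)
        then show ?thesis using 1(1) by blast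
      next
        case 2
        then consider "equator N j = equator N k" "u = equator N (k + 1)" | "equator N j = equator N (k + 1)" "u = equator N k"
          by (auto simp: doubleton_eq_iff)
        then show ?thesis
        proof cases
          case 1
          then show ?thesis using shift(1)[OF 1(1)] by simp
        next
          case 2
          then show ?thesis using shift(2)[OF 2(1)] by simp
        qed
      qed
    qed
    have P: "{equator N j, pole s} \<in> edges_of (bipyramid_facets N)" if "s \<in> {1, -1}" for s
      using that unfolding bipyramid_edges[OF assms] by (auto simp: insert_commute)
    have "{equator N j, equator N (j + 1)} \<in> edges_of (bipyramid_facets N)"
      unfolding bipyramid_edges[OF assms] by blast
    moreover have "{equator N (j - 1), equator N (j - 1 + 1)} \<in> edges_of (bipyramid_facets N)"
      unfolding bipyramid_edges[OF assms] by blast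
    ultimately show "?R \<subseteq> ?L" using P[of 1] P[of "-1"] by (auto simp: insert_commute)
  qed
  show "{u. {pole 1, u} \<in> edges_of (bipyramid_facets N)} = range (equator N)"
    unfolding bipyramid_edges[OF assms] by (auto simp: doubleton_eq_iff)
qed

lemma bipyramid_edges_finite:
  assumes "N \<ge> 3"
  shows "finite (edges_of (bipyramid_facets N))"
proof -
  have "edges_of (bipyramid_facets N) \<subseteq> Pow (bipyramid_vertices N)"
    using triangulated_sphereD(4)[OF bipyramid_sphere[OF assms]] unfolding edges_of_def by blast
  then show ?thesis
    using triangulated_sphereD(1)[OF bipyramid_sphere[OF assms]] by (auto intro: finite_subset)
qed

text \<open>At an equatorial vertex the vertical component of equilibrium equates the stresses to
  the two poles, the tangential one equates the stresses of the two adjacent rim edges, and the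
  radial one expresses the former through the latter. So one unknown is left, and vertical
  equilibrium at a pole, a sum of N equal terms, kills it.\<close>

lemma bipyramid_stress_free:
  assumes N: "N \<ge> 3"
  shows "stress_free (edges_of (bipyramid_facets N))"
  unfolding stress_free_def
proof (intro allI impI)
  let ?E = "edges_of (bipyramid_facets N)"
  have N0: "N > 0" using N by simp
  fix \<omega> assume eq: "\<forall>v. (\<Sum>e | e \<in> ?E \<and> v \<in> e. \<omega> e *\<^sub>R (\<Sum>u\<in>e. v - u)) = 0"
  have c2: "card e = 2" if "e \<in> ?E" for e using that unfolding edges_of_def by blast
  have eq': "(\<Sum>u | {v, u} \<in> ?E. \<omega> {v, u} *\<^sub>R (v - u)) = 0" for v
    using eq equilibrium_sum[OF bipyramid_edges_finite[OF N] c2, of \<omega> v] by simp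
  define a where "a j = \<omega> {equator N j, pole 1}" for j
  define b where "b j = \<omega> {equator N j, pole (-1)}" for j
  define c where "c j = \<omega> {equator N j, equator N (j + 1)}" for j
  define \<theta> where "\<theta> = 2 * pi / N"
  have half: "0 < pi / N" "pi / N < pi / 2" using N by (auto simp: field_simps)
  have \<theta>: "0 < \<theta>" "\<theta> < pi" using half unfolding \<theta>_def by linarith+
  have s: "0 < sin \<theta>" by (rule sin_gt_zero[OF \<theta>])
  have cs: "cos \<theta> < 1" using cos_monotone_0_pi[of 0 \<theta>] \<theta> by simp
  have comp: "equator N (j + 1) $ 1 = cos (2 * pi * j / N) * cos \<theta> - sin (2 * pi * j / N) * sin \<theta>"
    "equator N (j + 1) $ 2 = sin (2 * pi * j / N) * cos \<theta> + cos (2 * pi * j / N) * sin \<theta>"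
    "equator N (j - 1) $ 1 = cos (2 * pi * j / N) * cos \<theta> + sin (2 * pi * j / N) * sin \<theta>"
    "equator N (j - 1) $ 2 = sin (2 * pi * j / N) * cos \<theta> - cos (2 * pi * j / N) * sin \<theta>" for j
  proof -
    have e: "2 * pi * (j + 1) / N = 2 * pi * j / N + \<theta>" "2 * pi * (j - 1) / N = 2 * pi * j / N - \<theta>"
      by (simp_all add: \<theta>_def add_divide_distrib diff_divide_distrib ring_distribs)
    show "equator N (j + 1) $ 1 = cos (2 * pi * j / N) * cos \<theta> - sin (2 * pi * j / N) * sin \<theta>"
      "equator N (j + 1) $ 2 = sin (2 * pi * j / N) * cos \<theta> + cos (2 * pi * j / N) * sin \<theta>"
      "equator N (j - 1) $ 1 = cos (2 * pi * j / N) * cos \<theta> + sin (2 * pi * j / N) * sin \<theta>"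
      "equator N (j - 1) $ 2 = sin (2 * pi * j / N) * cos \<theta> - cos (2 * pi * j / N) * sin \<theta>"
      unfolding equator_components e cos_add sin_add cos_diff sin_diff by simp_all
  qed
  have vertex: "b j = a j" "c j = c (j - 1)" "a j = - c j * (1 - cos \<theta>)" for j
  proof -
    define C where "C = cos (2 * pi * j / N)"
    define S where "S = sin (2 * pi * j / N)"
    have CS: "C * C + S * S = 1" using sin_cos_squared_add3[of "2 * pi * j / N"] by (simp add: C_def S_def)
    have "\<omega> {equator N j, equator N (j - 1)} = c (j - 1)" by (simp add: c_def insert_commute)
    then have "a j *\<^sub>R (equator N j - pole 1) + b j *\<^sub>R (equator N j - pole (-1)) +
      c j *\<^sub>R (equator N j - equator N (j + 1)) + c (j - 1) *\<^sub>R (equator N j - equator N (j - 1)) = 0" (is "?v = 0")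
      using eq'[of "equator N j"] equator_neq[OF N]
      unfolding bipyramid_neighbours[OF N] by (simp add: a_def b_def c_def add.assoc)
    then have z: "?v $ 1 = 0" "?v $ 2 = 0" "?v $ 3 = 0" by simp_all
    show ba: "b j = a j" using z(3) by simp
    have x1: "2 * a j * C + c j * (C - (C * cos \<theta> - S * sin \<theta>)) + c (j - 1) * (C - (C * cos \<theta> + S * sin \<theta>)) = 0"
      using z(1) ba by (simp add: comp equator_components(1,2)[of N j] C_def S_def del: equator_components)
    have x2: "2 * a j * S + c j * (S - (S * cos \<theta> + C * sin \<theta>)) + c (j - 1) * (S - (S * cos \<theta> - C * sin \<theta>)) = 0"
      using z(2) ba by (simp add: comp equator_components(1,2)[of N j] C_def S_def del: equator_components)
    \<comment> \<open>The tangential component, up to sign.\<close>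
    have "(C * C + S * S) * ((c j - c (j - 1)) * sin \<theta>) =
        S * (2 * a j * C + c j * (C - (C * cos \<theta> - S * sin \<theta>)) + c (j - 1) * (C - (C * cos \<theta> + S * sin \<theta>))) -
        C * (2 * a j * S + c j * (S - (S * cos \<theta> + C * sin \<theta>)) + c (j - 1) * (S - (S * cos \<theta> - C * sin \<theta>)))"
      by (simp add: algebra_simps)
    then have "(c j - c (j - 1)) * sin \<theta> = 0" unfolding CS x1 x2 by simp
    then show cc: "c j = c (j - 1)" using s by simp
    \<comment> \<open>The radial component.\<close>
    have "(C * C + S * S) * (2 * a j + (c j + c (j - 1)) * (1 - cos \<theta>)) =
        C * (2 * a j * C + c j * (C - (C * cos \<theta> - S * sin \<theta>)) + c (j - 1) * (C - (C * cos \<theta> + S * sin \<theta>))) +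
        S * (2 * a j * S + c j * (S - (S * cos \<theta> + C * sin \<theta>)) + c (j - 1) * (S - (S * cos \<theta> - C * sin \<theta>)))"
      by (simp add: algebra_simps)
    then have "2 * a j + (c j + c (j - 1)) * (1 - cos \<theta>) = 0" unfolding CS x1 x2 by simp
    then show "a j = - c j * (1 - cos \<theta>)" unfolding cc[symmetric] by (simp add: algebra_simps)
  qed
  have cc: "c j = c 0" for j
  proof (induction j rule: int_induct[where k = 0])
    case (step1 i)
    then show ?case using vertex(2)[of "i + 1"] by simp
  next
    case (step2 i)
    then show ?case using vertex(2)[of i] by simp
  qed simp
  \<comment> \<open>All equatorial vertices have the same height difference 1 from the pole, so only
    the equal stresses are summed.\<close>
  have "(\<Sum>u\<in>range (equator N). \<omega> {pole 1, u} *\<^sub>R (pole 1 - u)) $ 3 = 0"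
    using eq'[of "pole 1"] unfolding bipyramid_neighbours[OF N] by simp
  then have "(\<Sum>u\<in>range (equator N). \<omega> {pole 1, u} * (1 - u $ 3)) = 0" by simp
  moreover have "(\<Sum>u\<in>range (equator N). \<omega> {pole 1, u} * (1 - u $ 3)) = (\<Sum>u\<in>range (equator N). - c 0 * (1 - cos \<theta>))"
  proof (rule sum.cong[OF refl])
    fix u assume "u \<in> range (equator N)"
    then obtain j where u: "u = equator N j" by blast
    have "\<omega> {pole 1, u} = a j" by (simp add: a_def u insert_commute)
    then show "\<omega> {pole 1, u} * (1 - u $ 3) = - c 0 * (1 - cos \<theta>)" using vertex(3)[of j] cc[of j] by (simp add: u)
  qed
  ultimately have "real (card (range (equator N))) * (c 0 * (1 - cos \<theta>)) = 0" by simp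
  moreover have "card (range (equator N)) = N"
    unfolding range_equator[OF N0] using card_image[OF inj_on_equator[OF N0]] by simp
  ultimately have c0: "c 0 = 0" using N0 cs by simp
  have z: "a j = 0" "b j = 0" "c j = 0" for j using vertex(1,3)[of j] cc[of j] c0 by simp_all
  show "\<forall>e\<in>?E. \<omega> e = 0"
  proof
    fix e assume "e \<in> ?E"
    then consider s j where "s \<in> {1, -1}" "e = {pole s, equator N j}" | j where "e = {equator N j, equator N (j + 1)}"
      unfolding bipyramid_edges[OF N] by blast
    then show "\<omega> e = 0"
    proof cases
      case 1
      have "e = {equator N j, pole s}" using 1(2) by (simp add: insert_commute)
      then show ?thesis using z(1,2)[of j] 1(1) by (auto simp: a_def b_def)
    next
      case 2
      then show ?thesis using z(3)[of j] by (simp add: c_def)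
    qed
  qed
qed

text \<open>There are N + 2 vertices and 3N edges: N at each pole and N along the rim.\<close>

lemma bipyramid_isostatic:
  assumes N: "N \<ge> 3"
  shows "isostatic_graph (bipyramid_vertices N) (edges_of (bipyramid_facets N))"
proof -
  have N0: "N > 0" using N by simp
  let ?R = "range (equator N)"
  have fR: "finite ?R" and cR: "card ?R = N"
    unfolding range_equator[OF N0] using card_image[OF inj_on_equator[OF N0]] by auto
  have "?R \<inter> {pole 1, pole (-1)} = {}" by auto
  then have cV: "card (bipyramid_vertices N) = N + 2"
    unfolding bipyramid_vertices_def using fR cR by (subst card_Un_disjoint) auto
  let ?P = "\<lambda>s. (\<lambda>u. {pole s, u}) ` ?R" and ?B = "(\<lambda>j. {equator N j, equator N (j + 1)}) ` {0..<int N}"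
  have E: "edges_of (bipyramid_facets N) = ?P 1 \<union> ?P (-1) \<union> ?B"
  proof -
    have "{equator N j, equator N (j + 1)} \<in> ?B" for j
    proof -
      have "equator N (j + 1) = equator N (j mod int N + 1)"
        using equator_mod[OF N0, of j] by (simp add: equator_eq_iff[OF N0])
      then have "{equator N j, equator N (j + 1)} = {equator N (j mod int N), equator N (j mod int N + 1)}"
        by (simp add: equator_mod[OF N0])
      then show ?thesis using N0 by (intro image_eqI[of _ _ "j mod int N"]) auto
    qed
    then show ?thesis unfolding bipyramid_edges[OF N] by blast
  qed
  have cP: "card (?P s) = N" if "s \<noteq> 0" for s
    using cR that by (subst card_image) (auto simp: inj_on_def doubleton_eq_iff)
  have cB: "card ?B = N"
  proof -
    have "inj_on (\<lambda>j. {equator N j, equator N (j + 1)}) {0..<int N}"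
    proof (rule inj_onI)
      fix i j assume ij: "i \<in> {0..<int N}" "j \<in> {0..<int N}" "{equator N i, equator N (i + 1)} = {equator N j, equator N (j + 1)}"
      have "\<not> (equator N i = equator N (j + 1) \<and> equator N (i + 1) = equator N j)"
      proof
        assume "equator N i = equator N (j + 1) \<and> equator N (i + 1) = equator N j"
        then have "int N dvd (i - (j + 1)) - (i + 1 - j)"
          using dvd_diff[of "int N" "i - (j + 1)" "i + 1 - j"] unfolding equator_eq_iff[OF N0] by blast
        then have "int N dvd 2" by simp
        then show False using N zdvd_imp_le[of "int N" 2] by simp
      qed
      then have "equator N i = equator N j" using ij(3) by (auto simp: doubleton_eq_iff)
      then show "i = j" using ij(1,2) inj_on_equator[OF N0] by (simp add: inj_on_def)
    qed
    then show ?thesis by (simp add: card_image)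
  qed
  have "?P 1 \<inter> ?P (-1) = {}" "(?P 1 \<union> ?P (-1)) \<inter> ?B = {}" by (auto simp: doubleton_eq_iff)
  then have "card (edges_of (bipyramid_facets N)) = 3 * N"
    unfolding E using fR cP[of 1] cP[of "-1"] cB by (simp add: card_Un_disjoint)
  moreover have "e \<subseteq> bipyramid_vertices N \<and> card e = 2" if "e \<in> edges_of (bipyramid_facets N)" for e
    using that triangulated_sphereD(4)[OF bipyramid_sphere[OF N]] unfolding edges_of_def by blast
  ultimately show ?thesis
    unfolding isostatic_graph_def
    using bipyramid_stress_free[OF N] triangulated_sphereD(1)[OF bipyramid_sphere[OF N]] cV by simp
qed

lemma bipyramid_norm: "x \<in> bipyramid_vertices N \<Longrightarrow> norm x = 1"
  unfolding bipyramid_vertices_def by (auto simp: norm_eq_1 inner_vec_def sum_3 simp flip: power2_eq_square)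

lemma bipyramid_sum_zero:
  assumes "n \<ge> 1"
  shows "\<Sum>(bipyramid_vertices (4 * n)) = 0"
proof (rule sum_zero_of_antipodal)
  have e: "- equator (4 * n) j = equator (4 * n) (j + 2 * int n)" for j
  proof -
    have "2 * pi * (j + 2 * int n) / (4 * n) = 2 * pi * j / (4 * n) + pi"
      using assms by (simp add: field_simps)
    then have "equator (4 * n) (j + 2 * int n) $ 1 = cos (2 * pi * j / (4 * n) + pi)"
      "equator (4 * n) (j + 2 * int n) $ 2 = sin (2 * pi * j / (4 * n) + pi)" by simp_all
    then show ?thesis by (simp add: vec_eq_iff forall_3 del: of_int_add)
  qed
  have p: "- pole s = pole (- s)" for s by (simp add: vec_eq_iff forall_3)
  have sub: "uminus ` bipyramid_vertices (4 * n) \<subseteq> bipyramid_vertices (4 * n)"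
    unfolding bipyramid_vertices_def by (auto simp: e p)
  have "x \<in> uminus ` bipyramid_vertices (4 * n)" if "x \<in> bipyramid_vertices (4 * n)" for x
    using sub that by (intro image_eqI[of _ _ "- x"]) auto
  then show "uminus ` bipyramid_vertices (4 * n) = bipyramid_vertices (4 * n)" using sub by blast
qed

section \<open>Axial groups\<close>

text \<open>Signs b and s on the second and third coordinates, followed by the rotation by \<theta>
  about the main axis; the determinant is b s. For b = -1 this is the reflection in the vertical
  plane at angle \<theta>/2 if s = 1, and the half-turn about the horizontal axis at that angle if s
  = -1.\<close>

definition axial :: "real \<Rightarrow> int \<Rightarrow> int \<Rightarrow> real^3 \<Rightarrow> real^3" where
  "axial \<theta> b s x = vector [cos \<theta> * x$1 - sin \<theta> * (b * x$2), sin \<theta> * x$1 + cos \<theta> * (b * x$2), s * x$3]"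

text \<open>A homomorphism from the integers to the signs. It tells the multiples of pi/n that are
  rotations in C_n, the even ones, from the others.\<close>

definition sgn_parity :: "int \<Rightarrow> int" where
  "sgn_parity k = (if even k then 1 else -1)"

text \<open>For a subgroup \<open>A\<close> of \<open>{1, -1}\<^sup>3\<close>; every group of an axial family has this form.\<close>

definition axial_group :: "nat \<Rightarrow> (int \<times> int \<times> int) set \<Rightarrow> (real^3 \<Rightarrow> real^3) set" where
  "axial_group n A = {axial (k * pi / n) b s |(k::int) b s. (sgn_parity k, b, s) \<in> A}"

definition sign_mult :: "int \<times> int \<times> int \<Rightarrow> int \<times> int \<times> int \<Rightarrow> int \<times> int \<times> int" where
  "sign_mult x y = (fst x * fst y, fst (snd x) * fst (snd y), snd (snd x) * snd (snd y))"

definition signs :: "(int \<times> int \<times> int) set" where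
  "signs = {1, -1} \<times> {1, -1} \<times> {1, -1}"

lemma axial_components [simp]:
  "axial \<theta> b s x $ 1 = cos \<theta> * x$1 - sin \<theta> * (b * x$2)"
  "axial \<theta> b s x $ 2 = sin \<theta> * x$1 + cos \<theta> * (b * x$2)"
  "axial \<theta> b s x $ 3 = s * x$3"
  by (simp_all add: axial_def)

text \<open>Changing the sign of the second coordinate inverts rotations about the main axis, hence
  the factor b before the second angle.\<close>

lemma axial_compose:
  assumes "b = 1 \<or> b = -1"
  shows "axial \<theta> b s \<circ> axial \<theta>' b' s' = axial (\<theta> + b * \<theta>') (b * b') (s * s')"
  using assms by (auto simp: fun_eq_iff vec_eq_iff forall_3 cos_add sin_add algebra_simps)

lemma orthogonal_axial:
  assumes "b = 1 \<or> b = -1" "s = 1 \<or> s = -1"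
  shows "orthogonal_transformation (axial \<theta> b s)"
  unfolding orthogonal_transformation
proof (intro conjI allI)
  show "linear (axial \<theta> b s)"
    by (rule linearI) (simp_all add: vec_eq_iff forall_3 algebra_simps)
  fix v :: "real^3"
  have "(C * x - S * y)\<^sup>2 + (S * x + C * y)\<^sup>2 = (x\<^sup>2 + y\<^sup>2) * (S\<^sup>2 + C\<^sup>2)" for x y S C :: real
    by (simp add: power2_eq_square algebra_simps)
  then have *: "(cos \<theta> * x - sin \<theta> * y)\<^sup>2 + (sin \<theta> * x + cos \<theta> * y)\<^sup>2 = x\<^sup>2 + y\<^sup>2" for x y
    by simp
  have "(b * v$2)\<^sup>2 = (v$2)\<^sup>2" "(s * v$3)\<^sup>2 = (v$3)\<^sup>2" using assms by auto
  then have "axial \<theta> b s v \<bullet> axial \<theta> b s v = v \<bullet> v"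
    using *[of "v$1" "b * v$2"] by (simp add: inner_vec_def sum_3 flip: power2_eq_square)
  then show "norm (axial \<theta> b s v) = norm v" by (simp add: norm_eq)
qed

lemma axial_periodic: "axial (\<theta> + 2 * pi * of_int q) b s = axial \<theta> b s"
  by (auto simp: axial_def fun_eq_iff cos_add sin_add)

lemma sgn_parity_add:
  assumes "b = 1 \<or> b = -1"
  shows "sgn_parity (k + b * k') = sgn_parity k * sgn_parity k'"
  using assms by (auto simp: sgn_parity_def)

lemma axial_group_compose:
  assumes A: "A \<subseteq> signs" "\<And>x y. x \<in> A \<Longrightarrow> y \<in> A \<Longrightarrow> sign_mult x y \<in> A"
    and "g \<in> axial_group n A" "h \<in> axial_group n A"
  shows "g \<circ> h \<in> axial_group n A"
proof -
  obtain k b s where g: "g = axial (of_int k * pi / n) b s" "(sgn_parity k, b, s) \<in> A"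
    using assms(3) unfolding axial_group_def by blast
  obtain k' b' s' where h: "h = axial (of_int k' * pi / n) b' s'" "(sgn_parity k', b', s') \<in> A"
    using assms(4) unfolding axial_group_def by blast
  have b: "b = 1 \<or> b = -1" using g(2) A(1) by (auto simp: signs_def)
  have "of_int k * pi / n + b * (of_int k' * pi / n) = of_int (k + b * k') * pi / n"
    by (simp add: add_divide_distrib ring_distribs)
  then have "g \<circ> h = axial (of_int (k + b * k') * pi / n) (b * b') (s * s')"
    unfolding g(1) h(1) axial_compose[OF b] by simp
  moreover have "(sgn_parity (k + b * k'), b * b', s * s') \<in> A"
    using A(2)[OF g(2) h(2)] by (simp add: sign_mult_def sgn_parity_add[OF b])
  ultimately show ?thesis unfolding axial_group_def by blast
qed

text \<open>The angle pi/n is two steps of the 4n-gon, and b = -1 reverses the index.\<close>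

lemma axial_equator:
  assumes "n \<ge> 1" "b = 1 \<or> b = -1"
  shows "axial (of_int k * pi / n) b s (equator (4 * n) j) = equator (4 * n) (2 * k + b * j)"
proof -
  have "2 * pi * of_int (2 * k + b * j) / (4 * n) = of_int k * pi / n + b * (2 * pi * j / (4 * n))"
    using assms(1) by (simp add: field_simps)
  moreover have "cos (b * x) = cos x" "sin (b * x) = b * sin x" for x :: real using assms(2) by auto
  ultimately have "equator (4 * n) (2 * k + b * j) $ 1 = axial (of_int k * pi / n) b s (equator (4 * n) j) $ 1"
    "equator (4 * n) (2 * k + b * j) $ 2 = axial (of_int k * pi / n) b s (equator (4 * n) j) $ 2"
    unfolding equator_components axial_components by (simp_all only: cos_add sin_add of_nat_mult of_nat_numeral)
  then show ?thesis by (simp add: vec_eq_iff forall_3)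
qed

lemma axial_pole: "axial \<theta> b s (pole t) = pole (s * t)"
  by (simp add: vec_eq_iff forall_3)

text \<open>Every map of the group takes poles to poles. With a pole as u and an equatorial vertex
  as v no exchange is possible, whatever reflections the group contains, so all families are covered
  at once.\<close>

lemma realizable_axial_group:
  assumes n: "n \<ge> 1" and A: "A \<subseteq> signs" "(1, 1, 1) \<in> A" "\<And>x y. x \<in> A \<Longrightarrow> y \<in> A \<Longrightarrow> sign_mult x y \<in> A"
  shows "realizable (axial_group n A)"
proof (rule realizable_subgroup)
  have N: "4 * n \<ge> 3" using n by simp
  let ?V = "bipyramid_vertices (4 * n)"
  show "triangulated_sphere ?V (bipyramid_facets (4 * n))" by (rule bipyramid_sphere[OF N])
  show "isostatic_graph ?V (edges_of (bipyramid_facets (4 * n)))" by (rule bipyramid_isostatic[OF N])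
  show "\<Sum>?V = 0" by (rule bipyramid_sum_zero[OF n])
  show "norm x = 1" if "x \<in> ?V" for x using that by (rule bipyramid_norm)
  have b: "b = 1 \<or> b = -1" "s = 1 \<or> s = -1" if "(sgn_parity k, b, s) \<in> A" for k b s
    using that A(1) by (auto simp: signs_def)
  show "axial_group n A \<subseteq> orthogonal_symmetries ?V"
  proof
    fix g assume "g \<in> axial_group n A"
    then obtain k b s where g: "g = axial (of_int k * pi / n) b s" "(sgn_parity k, b, s) \<in> A"
      unfolding axial_group_def by blast
    have orth: "orthogonal_transformation g" unfolding g(1) by (rule orthogonal_axial[OF b[OF g(2)]])
    have "g x \<in> ?V" if "x \<in> ?V" for x
    proof -
      consider j where "x = equator (4 * n) j" | s' where "s' \<in> {1, -1}" "x = pole s'"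
        using \<open>x \<in> ?V\<close> unfolding bipyramid_vertices_def by blast
      then show ?thesis
      proof cases
        case 1
        then show ?thesis
          unfolding bipyramid_vertices_def g(1) by (simp add: axial_equator[OF n b(1)[OF g(2)]])
      next
        case 2
        then show ?thesis
          using b(2)[OF g(2)] unfolding bipyramid_vertices_def g(1) by (auto simp: axial_pole)
      qed
    qed
    then have "g ` ?V \<subseteq> ?V" by blast
    then have "g ` ?V = ?V"
      by (rule orthogonal_image_eq[OF orth triangulated_sphereD(1)[OF bipyramid_sphere[OF N]]])
    then show "g \<in> orthogonal_symmetries ?V" using orth unfolding orthogonal_symmetries_def by simp
  qed
  have "(sgn_parity 0, 1, 1) \<in> A" using A(2) by (simp add: sgn_parity_def)
  then show "axial_group n A \<noteq> {}" unfolding axial_group_def by blast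
  show "g \<circ> h \<in> axial_group n A" if "g \<in> axial_group n A" "h \<in> axial_group n A" for g h
    using axial_group_compose[OF A(1,3) that] .
  show "{pole 1, equator (4 * n) 0, equator (4 * n) (0 + 1)} \<in> bipyramid_facets (4 * n)"
    unfolding bipyramid_facets_def by blast
  fix h assume "h \<in> axial_group n A"
  then obtain k b s where h: "h = axial (of_int k * pi / n) b s" "(sgn_parity k, b, s) \<in> A"
    unfolding axial_group_def by blast
  have "h (pole 1) = pole s" unfolding h(1) by (simp add: axial_pole)
  then show "\<not> (h (pole 1) = equator (4 * n) 0 \<and> h (equator (4 * n) 0) = pole 1 \<and>
      h (equator (4 * n) (0 + 1)) = equator (4 * n) (0 + 1))"
    using b(2)[OF h(2)] equator_neq_pole(2)[of s "4 * n" 0] by auto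
qed

section \<open>The axial, dihedral and cyclic families as sign-restricted groups\<close>

lemma rotation_z_axial: "rotation_z \<theta> = axial \<theta> 1 1"
  by (simp add: fun_eq_iff vec_eq_iff forall_3 rotation_z_def)

lemma mirror_3_axial: "mirror (axis 3 1) = axial 0 1 (-1)"
  by (auto simp: fun_eq_iff vec_eq_iff forall_3 mirror_def axis_def inner_vec_def sum_3)

lemma mirror_2_axial: "mirror (axis 2 1) = axial 0 (-1) 1"
  by (auto simp: fun_eq_iff vec_eq_iff forall_3 mirror_def axis_def inner_vec_def sum_3)

lemma half_turn_1_axial: "half_turn (axis 1 1) = axial 0 (-1) (-1)"
  by (auto simp: fun_eq_iff vec_eq_iff forall_3 half_turn_def axis_def inner_vec_def sum_3)

lemma mirror_vertical_axial: "mirror (vector [- sin \<alpha>, cos \<alpha>, 0]) = axial (2 * \<alpha>) (-1) 1"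
proof -
  have c: "cos (2 * \<alpha>) = 1 - 2 * (sin \<alpha> * sin \<alpha>)" "cos (2 * \<alpha>) = 2 * (cos \<alpha> * cos \<alpha>) - 1"
    using cos_double_sin[of \<alpha>] cos_double_cos[of \<alpha>] by (simp_all add: power2_eq_square)
  have "mirror (vector [- sin \<alpha>, cos \<alpha>, 0]) x $ 1 = axial (2 * \<alpha>) (-1) 1 x $ 1" for x
    by (simp add: mirror_def inner_vec_def sum_3 c(1) sin_double) (simp add: algebra_simps)
  moreover have "mirror (vector [- sin \<alpha>, cos \<alpha>, 0]) x $ 2 = axial (2 * \<alpha>) (-1) 1 x $ 2" for x
    by (simp add: mirror_def inner_vec_def sum_3 c(2) sin_double) (simp add: algebra_simps)
  moreover have "mirror (vector [- sin \<alpha>, cos \<alpha>, 0]) x $ 3 = axial (2 * \<alpha>) (-1) 1 x $ 3" for x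
    by (simp add: mirror_def)
  ultimately show ?thesis by (simp add: fun_eq_iff vec_eq_iff forall_3)
qed

lemma axial_power: "axial \<theta> 1 s ^^ k = axial (k * \<theta>) 1 (s ^ k)"
proof (induction k)
  case 0
  show ?case by (simp add: fun_eq_iff vec_eq_iff forall_3)
next
  case (Suc k)
  have "axial \<theta> 1 s ^^ Suc k = axial \<theta> 1 s \<circ> axial (k * \<theta>) 1 (s ^ k)" by (simp add: Suc)
  also have "\<dots> = axial (\<theta> + k * \<theta>) 1 (s * s ^ k)" by (subst axial_compose) auto
  finally show ?case by (simp add: algebra_simps)
qed

text \<open>Reduction modulo the full turn 2n keeps the parity, because 2n is even. It matches
  integer multiples with the natural exponents of \<open>powers\<close>.\<close>

lemma axial_nat_multiple:
  fixes n :: nat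
  assumes "n \<ge> 1"
  obtains j :: nat where "axial (of_int k * pi / n) b s = axial (j * pi / n) b s" "even j \<longleftrightarrow> even k"
proof -
  define q where "q = k div (2 * int n)"
  define j where "j = nat (k mod (2 * int n))"
  have j: "int j = k mod (2 * int n)" using assms by (simp add: j_def)
  then have k: "k = int j + 2 * int n * q" by (simp add: q_def)
  have "of_int k * pi / n = j * pi / n + 2 * pi * of_int q"
    using assms unfolding k by (simp add: field_simps)
  then have "axial (of_int k * pi / n) b s = axial (j * pi / n) b s" by (simp only: axial_periodic)
  moreover have "even j \<longleftrightarrow> even k" unfolding k by simp
  ultimately show ?thesis using that by blast
qed

lemma powers_axial:
  assumes "n \<ge> 1"
  shows "powers (rotation_z (2 * pi / n)) = axial_group n {(1, 1, 1)}"
    and "powers (mirror (axis 3 1) \<circ> rotation_z (pi / n)) = axial_group n {(1, 1, 1), (-1, 1, -1)}"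
proof -
  show "powers (rotation_z (2 * pi / n)) = axial_group n {(1, 1, 1)}"
  proof
    show "powers (rotation_z (2 * pi / n)) \<subseteq> axial_group n {(1, 1, 1)}"
    proof
      fix g assume "g \<in> powers (rotation_z (2 * pi / n))"
      then obtain k where "g = axial (of_int (2 * int k) * pi / n) 1 1"
        unfolding powers_def rotation_z_axial axial_power by (auto simp: mult_ac)
      moreover have "(sgn_parity (2 * int k), 1, 1) \<in> {(1, 1, 1) :: int \<times> int \<times> int}" by (simp add: sgn_parity_def)
      ultimately show "g \<in> axial_group n {(1, 1, 1)}" unfolding axial_group_def by blast
    qed
    show "axial_group n {(1, 1, 1)} \<subseteq> powers (rotation_z (2 * pi / n))"
    proof
      fix g assume "g \<in> axial_group n {(1, 1, 1)}"
      then obtain k :: int where k: "even k" "g = axial (of_int k * pi / n) 1 1"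
        unfolding axial_group_def by (auto simp: sgn_parity_def split: if_splits)
      then obtain j :: nat where j: "g = axial (j * pi / n) 1 1" "even j"
        using axial_nat_multiple[OF assms, of k 1 1] by metis
      then obtain i where "j = 2 * i" by blast
      then have "g = axial (i * (2 * pi / n)) 1 (1 ^ i)" using j(1) by (simp add: mult_ac)
      then show "g \<in> powers (rotation_z (2 * pi / n))"
        unfolding powers_def rotation_z_axial axial_power by blast
    qed
  qed
  have r: "mirror (axis 3 1) \<circ> rotation_z (pi / n) = axial (pi / n) 1 (-1)"
    unfolding mirror_3_axial rotation_z_axial by (subst axial_compose) auto
  show "powers (mirror (axis 3 1) \<circ> rotation_z (pi / n)) = axial_group n {(1, 1, 1), (-1, 1, -1)}"
    unfolding r
  proof
    show "powers (axial (pi / n) 1 (-1)) \<subseteq> axial_group n {(1, 1, 1), (-1, 1, -1)}"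
    proof
      fix g assume "g \<in> powers (axial (pi / n) 1 (-1))"
      then obtain k :: nat where "g = axial (of_int (int k) * pi / n) 1 ((-1) ^ k)"
        unfolding powers_def axial_power by auto
      moreover have "(sgn_parity (int k), 1, (-1) ^ k) \<in> {(1, 1, 1), (-1, 1, -1) :: int \<times> int \<times> int}"
        by (simp add: sgn_parity_def)
      ultimately show "g \<in> axial_group n {(1, 1, 1), (-1, 1, -1)}" unfolding axial_group_def by blast
    qed
    show "axial_group n {(1, 1, 1), (-1, 1, -1)} \<subseteq> powers (axial (pi / n) 1 (-1))"
    proof
      fix g assume "g \<in> axial_group n {(1, 1, 1), (-1, 1, -1)}"
      then obtain k b s where g: "g = axial (of_int k * pi / n) b s"
        "(sgn_parity k, b, s) \<in> {(1, 1, 1), (-1, 1, -1)}"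
        unfolding axial_group_def by blast
      then have k: "g = axial (of_int k * pi / n) 1 (sgn_parity k)" by auto
      then obtain j :: nat where j: "g = axial (j * pi / n) 1 (sgn_parity k)" "even j \<longleftrightarrow> even k"
        using axial_nat_multiple[OF assms, of k 1 "sgn_parity k"] by metis
      then have "g = axial (j * (pi / n)) 1 ((-1) ^ j)" by (simp add: sgn_parity_def)
      then show "g \<in> powers (axial (pi / n) 1 (-1))" unfolding powers_def axial_power by blast
    qed
  qed
qed

text \<open>Composing with the new element multiplies sign vectors by its own one, and every element
  with such a product as sign vector arises: k' = k0 + b0 k is solvable for k because b0 is its own
  inverse.\<close>

lemma adjoin_axial:
  assumes "(sgn_parity k0, b0, s0) \<in> signs" and A: "A \<subseteq> signs"
  shows "adjoin (axial (of_int k0 * pi / n) b0 s0) (axial_group n A) =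
    axial_group n (A \<union> sign_mult (sgn_parity k0, b0, s0) ` A)"
proof -
  let ?s = "axial (of_int k0 * pi / n) b0 s0"
  have b0: "b0 = 1 \<or> b0 = -1" using assms(1) by (auto simp: signs_def)
  have comp: "?s \<circ> axial (of_int k * pi / n) b s = axial (of_int (k0 + b0 * k) * pi / n) (b0 * b) (s0 * s)" for k b s
  proof -
    have "of_int k0 * pi / n + b0 * (of_int k * pi / n) = of_int (k0 + b0 * k) * pi / n"
      by (simp add: add_divide_distrib ring_distribs)
    then show ?thesis unfolding axial_compose[OF b0] by simp
  qed
  have "(\<lambda>g. ?s \<circ> g) ` axial_group n A = axial_group n (sign_mult (sgn_parity k0, b0, s0) ` A)"
  proof
    show "(\<lambda>g. ?s \<circ> g) ` axial_group n A \<subseteq> axial_group n (sign_mult (sgn_parity k0, b0, s0) ` A)"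
    proof
      fix f assume "f \<in> (\<lambda>g. ?s \<circ> g) ` axial_group n A"
      then obtain k b s where f: "(sgn_parity k, b, s) \<in> A" "f = ?s \<circ> axial (of_int k * pi / n) b s"
        unfolding axial_group_def by blast
      have "(sgn_parity (k0 + b0 * k), b0 * b, s0 * s) = sign_mult (sgn_parity k0, b0, s0) (sgn_parity k, b, s)"
        by (simp add: sign_mult_def sgn_parity_add[OF b0])
      then have "(sgn_parity (k0 + b0 * k), b0 * b, s0 * s) \<in> sign_mult (sgn_parity k0, b0, s0) ` A"
        using f(1) by blast
      then show "f \<in> axial_group n (sign_mult (sgn_parity k0, b0, s0) ` A)"
        unfolding axial_group_def f(2) comp by blast
    qed
    show "axial_group n (sign_mult (sgn_parity k0, b0, s0) ` A) \<subseteq> (\<lambda>g. ?s \<circ> g) ` axial_group n A"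
    proof
      fix f assume "f \<in> axial_group n (sign_mult (sgn_parity k0, b0, s0) ` A)"
      then obtain k' b' s' p b s where f: "f = axial (of_int k' * pi / n) b' s'" "(p, b, s) \<in> A"
        "(sgn_parity k', b', s') = sign_mult (sgn_parity k0, b0, s0) (p, b, s)"
        unfolding axial_group_def by auto
      have p: "sgn_parity k' = sgn_parity k0 * p" "b' = b0 * b" "s' = s0 * s"
        using f(3) by (simp_all add: sign_mult_def)
      define k where "k = b0 * (k' - k0)"
      have k': "k' = k0 + b0 * k" using b0 by (auto simp: k_def)
      have "sgn_parity k0 * sgn_parity k = sgn_parity k0 * p" using p(1) unfolding k' sgn_parity_add[OF b0] .
      then have "sgn_parity k = p" by (simp add: sgn_parity_def split: if_splits)
      then have "axial (of_int k * pi / n) b s \<in> axial_group n A" using f(2) unfolding axial_group_def by blast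
      moreover have "f = ?s \<circ> axial (of_int k * pi / n) b s" unfolding comp f(1) p(2,3) k'[symmetric] ..
      ultimately show "f \<in> (\<lambda>g. ?s \<circ> g) ` axial_group n A" by blast
    qed
  qed
  then show ?thesis unfolding adjoin_def axial_group_def by blast
qed

text \<open>Each family corresponds to one subgroup of sign vectors. Odd multiples of pi/n occur
  only for D_nd and S_2n, there always with b s = -1, that is, with orientation reversed.\<close>

lemma realizable_axial_families:
  assumes n: "n \<ge> 1"
  shows "realizable (group_C n)" "realizable (group_Ch n)" "realizable (group_Cv n)"
    "realizable (group_D n)" "realizable (group_Dh n)" "realizable (group_Dd n)" "realizable (group_S2 n)"
proof -
  have sg: "sgn_parity 0 = 1" "sgn_parity 1 = -1" by (simp_all add: sgn_parity_def)
  have C: "group_C n = axial_group n {(1, 1, 1)}" unfolding group_C_def by (rule powers_axial(1)[OF n])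
  have Ch: "group_Ch n = axial_group n {(1, 1, 1), (1, 1, -1)}"
    using adjoin_axial[of 0 1 "-1" "{(1, 1, 1)}" n]
    by (simp add: group_Ch_def C mirror_3_axial sg sign_mult_def signs_def insert_commute)
  have Cv: "group_Cv n = axial_group n {(1, 1, 1), (1, -1, 1)}"
    using adjoin_axial[of 0 "-1" 1 "{(1, 1, 1)}" n]
    by (simp add: group_Cv_def C mirror_2_axial sg sign_mult_def signs_def insert_commute)
  have D: "group_D n = axial_group n {(1, 1, 1), (1, -1, -1)}"
    using adjoin_axial[of 0 "-1" "-1" "{(1, 1, 1)}" n]
    by (simp add: group_D_def C half_turn_1_axial sg sign_mult_def signs_def insert_commute)
  have Dh: "group_Dh n = axial_group n ({(1, 1, 1), (1, -1, -1)} \<union> {(1, 1, -1), (1, -1, 1)})"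
    using adjoin_axial[of 0 1 "-1" "{(1, 1, 1), (1, -1, -1)}" n]
    by (simp add: group_Dh_def D mirror_3_axial sg sign_mult_def signs_def)
  have "2 * (pi / (2 * real n)) = of_int 1 * pi / n" by simp
  then have m: "mirror (vector [- sin (pi / (2 * real n)), cos (pi / (2 * real n)), 0]) = axial (of_int 1 * pi / n) (-1) 1"
    unfolding mirror_vertical_axial by simp
  have Dd: "group_Dd n = axial_group n ({(1, 1, 1), (1, -1, -1)} \<union> {(-1, -1, 1), (-1, 1, -1)})"
    using adjoin_axial[of 1 "-1" 1 "{(1, 1, 1), (1, -1, -1)}" n]
    unfolding group_Dd_def D m by (simp add: sg sign_mult_def signs_def)
  have S2: "group_S2 n = axial_group n {(1, 1, 1), (-1, 1, -1)}"
    unfolding group_S2_def by (rule powers_axial(2)[OF n])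
  show "realizable (group_C n)" "realizable (group_Ch n)" "realizable (group_Cv n)"
    "realizable (group_D n)" "realizable (group_Dh n)" "realizable (group_Dd n)" "realizable (group_S2 n)"
    unfolding C Ch Cv D Dh Dd S2
    by (rule realizable_axial_group[OF n], simp add: signs_def, simp,
        elim UnE insertE emptyE; simp add: sign_mult_def)+
qed

text \<open>These are the cases n = 1 of C_nh, S_2n and C_n.\<close>

lemma realizable_low_symmetry: "realizable group_Cs" "realizable group_Ci" "realizable group_C1"
proof -
  have r: "rotation_z (2 * pi) = id" "mirror (axis 3 1) \<circ> rotation_z pi = uminus"
    by (simp_all add: rotation_z_axial mirror_3_axial fun_eq_iff vec_eq_iff forall_3)
  have idp: "(id :: real^3 \<Rightarrow> real^3) ^^ k = id" for k by (induction k) auto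
  have C: "group_C 1 = {id}" by (auto simp: group_C_def powers_def r idp)
  have um: "(uminus :: real^3 \<Rightarrow> real^3) ^^ k = (if even k then id else uminus)" for k
    by (induction k) (auto simp: fun_eq_iff)
  have "group_S2 1 = range (\<lambda>k::nat. if even k then id else uminus)"
    by (simp add: group_S2_def powers_def r um)
  also have "\<dots> = {id, uminus}"
  proof
    show "{id, uminus} \<subseteq> range (\<lambda>k::nat. if even k then id else (uminus :: real^3 \<Rightarrow> real^3))"
      using rangeI[of "\<lambda>k::nat. if even k then id else (uminus :: real^3 \<Rightarrow> real^3)" 0]
        rangeI[of "\<lambda>k::nat. if even k then id else (uminus :: real^3 \<Rightarrow> real^3)" 1] by simp
  qed auto
  finally have S: "group_S2 1 = group_Ci" by (simp add: group_Ci_def)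
  have Cs: "group_Ch 1 = group_Cs" unfolding group_Ch_def C adjoin_def group_Cs_def by auto
  show "realizable group_Cs" "realizable group_Ci" "realizable group_C1"
    using realizable_axial_families(1,2,7)[OF order_refl] unfolding C S Cs group_C1_def by auto
qed

section \<open>Tetrahedral and octahedral groups\<close>

text \<open>The regular octahedron is the bipyramid over a square, so convexity and rigidity are
  inherited.\<close>

definition octahedron_vertices :: "(real^3) set" where
  "octahedron_vertices = bipyramid_vertices 4"

lemma octahedron_vertices_eq:
  "octahedron_vertices = {vector [1,0,0], vector [-1,0,0], vector [0,1,0], vector [0,-1,0], vector [0,0,1], vector [0,0,-1]}"
proof -
  have r: "range (equator 4) = equator 4 ` {0, 1, 2, 3}"
  proof -
    have "{0..<int 4} = {0, 1, 2, 3}" by auto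
    then show ?thesis using range_equator[of 4] by simp
  qed
  have a: "2 * pi * real_of_int 3 / real 4 = pi + pi / 2" by simp
  have "equator 4 3 = vector [0, -1, 0]" unfolding equator_def a cos_add sin_add by simp
  moreover have "equator 4 0 = vector [1, 0, 0]" "equator 4 1 = vector [0, 1, 0]" "equator 4 2 = vector [-1, 0, 0]"
    by (simp_all add: equator_def)
  ultimately have "equator 4 0 = vector [1, 0, 0]" "equator 4 1 = vector [0, 1, 0]"
    "equator 4 2 = vector [-1, 0, 0]" "equator 4 3 = vector [0, -1, 0]" by simp_all
  then show ?thesis unfolding octahedron_vertices_def bipyramid_vertices_def r
    by (auto simp: pole_def)
qed

lemma octahedron_facet: "{vector [1,0,0], vector [0,1,0], vector [0,0,1]} \<in> bipyramid_facets 4"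
proof -
  have "{pole 1, equator 4 0, equator 4 (0 + 1)} \<in> bipyramid_facets 4"
    unfolding bipyramid_facets_def by blast
  moreover have "equator 4 0 = vector [1, 0, 0]" "equator 4 1 = vector [0, 1, 0]" "pole 1 = vector [0, 0, 1]"
    by (simp_all add: equator_def pole_def)
  ultimately show ?thesis by (simp add: insert_commute)
qed

text \<open>8 is the squared length of an edge of the tetrahedron and of a face diagonal of the
  cube. In both cases the midpoints are the face centres of the cube, the vertices of the
  octahedron. The condition is metric, hence respected by every symmetry of X.\<close>

definition half_sums :: "(real^3) set \<Rightarrow> (real^3) set" where
  "half_sums X = {(1 / 2) *\<^sub>R (x + y) |x y. x \<in> X \<and> y \<in> X \<and> (x - y) \<bullet> (x - y) = 8}"

text \<open>The way back: a cube vertex is the sum of three mutually orthogonal octahedron vertices.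
  Both passages together identify the symmetry groups of cube and octahedron.\<close>

definition orthogonal_sums :: "(real^3) set \<Rightarrow> (real^3) set" where
  "orthogonal_sums X = {x + y + z |x y z. x \<in> X \<and> y \<in> X \<and> z \<in> X \<and> x \<bullet> y = 0 \<and> x \<bullet> z = 0 \<and> y \<bullet> z = 0}"

lemma half_sums_image:
  assumes "orthogonal_transformation g" "g ` X = X"
  shows "g ` half_sums X \<subseteq> half_sums X"
proof
  have lin: "linear g" using assms(1) by (rule orthogonal_transformation_linear)
  fix z assume "z \<in> g ` half_sums X"
  then obtain x y where xy: "x \<in> X" "y \<in> X" "(x - y) \<bullet> (x - y) = 8" "z = g ((1 / 2) *\<^sub>R (x + y))"
    unfolding half_sums_def by blast
  have "(g x - g y) \<bullet> (g x - g y) = 8"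
    using xy(3) assms(1) unfolding linear_diff[OF lin, symmetric] orthogonal_transformation_def by simp
  moreover have "z = (1 / 2) *\<^sub>R (g x + g y)" unfolding xy(4) by (simp add: linear_scale[OF lin] linear_add[OF lin])
  moreover have "g x \<in> X" "g y \<in> X" using xy(1,2) assms(2) by auto
  ultimately show "z \<in> half_sums X" unfolding half_sums_def by blast
qed

lemma orthogonal_sums_image:
  assumes "orthogonal_transformation g" "g ` X = X"
  shows "g ` orthogonal_sums X \<subseteq> orthogonal_sums X"
proof
  have lin: "linear g" using assms(1) by (rule orthogonal_transformation_linear)
  fix u assume "u \<in> g ` orthogonal_sums X"
  then obtain x y z where xyz: "x \<in> X" "y \<in> X" "z \<in> X" "x \<bullet> y = 0" "x \<bullet> z = 0" "y \<bullet> z = 0" "u = g (x + y + z)"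
    unfolding orthogonal_sums_def by blast
  have "g x \<bullet> g y = 0" "g x \<bullet> g z = 0" "g y \<bullet> g z = 0"
    using xyz(4-6) assms(1) unfolding orthogonal_transformation_def by simp_all
  moreover have "u = g x + g y + g z" unfolding xyz(7) by (simp add: linear_add[OF lin])
  moreover have "g x \<in> X" "g y \<in> X" "g z \<in> X" using xyz(1-3) assms(2) by auto
  ultimately show "u \<in> orthogonal_sums X" unfolding orthogonal_sums_def by blast
qed

lemma half_sums_tetrahedron: "half_sums tetrahedron_vertices = octahedron_vertices"
proof
  show "half_sums tetrahedron_vertices \<subseteq> octahedron_vertices"
    unfolding half_sums_def tetrahedron_vertices_def octahedron_vertices_eq
    by (auto simp: vec_eq_iff forall_3 inner_vec_def sum_3)
  have h: "(1 / 2) *\<^sub>R (x + y) \<in> half_sums tetrahedron_vertices"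
    if "x \<in> tetrahedron_vertices" "y \<in> tetrahedron_vertices" "(x - y) \<bullet> (x - y) = 8" for x y
    using that unfolding half_sums_def by blast
  let ?a = "vector [1,1,1] :: real^3" and ?b = "vector [1,-1,-1] :: real^3"
    and ?c = "vector [-1,1,-1] :: real^3" and ?d = "vector [-1,-1,1] :: real^3"
  have "vector [1,0,0] = (1 / 2) *\<^sub>R (?a + ?b)" "vector [-1,0,0] = (1 / 2) *\<^sub>R (?c + ?d)"
    "vector [0,1,0] = (1 / 2) *\<^sub>R (?a + ?c)" "vector [0,-1,0] = (1 / 2) *\<^sub>R (?b + ?d)"
    "vector [0,0,1] = (1 / 2) *\<^sub>R (?a + ?d)" "vector [0,0,-1] = (1 / 2) *\<^sub>R (?b + ?c)"
    by (simp_all add: vec_eq_iff forall_3)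
  moreover have "(?a - ?b) \<bullet> (?a - ?b) = 8" "(?c - ?d) \<bullet> (?c - ?d) = 8" "(?a - ?c) \<bullet> (?a - ?c) = 8"
    "(?b - ?d) \<bullet> (?b - ?d) = 8" "(?a - ?d) \<bullet> (?a - ?d) = 8" "(?b - ?c) \<bullet> (?b - ?c) = 8"
    by (simp_all add: inner_vec_def sum_3)
  moreover have "?a \<in> tetrahedron_vertices" "?b \<in> tetrahedron_vertices" "?c \<in> tetrahedron_vertices" "?d \<in> tetrahedron_vertices"
    by (simp_all add: tetrahedron_vertices_def)
  ultimately show "octahedron_vertices \<subseteq> half_sums tetrahedron_vertices"
    unfolding octahedron_vertices_eq using h by (simp only: insert_subset empty_subsetI simp_thms)
qed

lemma cube_vertices_iff:
  "x \<in> cube_vertices \<longleftrightarrow> (x$1 = 1 \<or> x$1 = -1) \<and> (x$2 = 1 \<or> x$2 = -1) \<and> (x$3 = 1 \<or> x$3 = -1)"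
  unfolding cube_vertices_def by (auto simp: forall_3)

lemma octahedron_vertices_iff:
  "x \<in> octahedron_vertices \<longleftrightarrow>
    ((x$1 = 1 \<or> x$1 = -1) \<and> x$2 = 0 \<and> x$3 = 0) \<or> (x$1 = 0 \<and> (x$2 = 1 \<or> x$2 = -1) \<and> x$3 = 0) \<or>
    (x$1 = 0 \<and> x$2 = 0 \<and> (x$3 = 1 \<or> x$3 = -1))"
  unfolding octahedron_vertices_eq by (auto simp: vec_eq_iff forall_3)

lemma half_sums_cube: "half_sums cube_vertices = octahedron_vertices"
proof
  show "half_sums cube_vertices \<subseteq> octahedron_vertices"
  proof
    fix z assume "z \<in> half_sums cube_vertices"
    then obtain x y where xy: "x \<in> cube_vertices" "y \<in> cube_vertices" "(x - y) \<bullet> (x - y) = 8" "z = (1 / 2) *\<^sub>R (x + y)"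
      unfolding half_sums_def by blast
    have d: "(x$1 - y$1) * (x$1 - y$1) + (x$2 - y$2) * (x$2 - y$2) + (x$3 - y$3) * (x$3 - y$3) = 8"
      using xy(3) by (simp add: inner_vec_def sum_3)
    have "z$1 = (x$1 + y$1) / 2" "z$2 = (x$2 + y$2) / 2" "z$3 = (x$3 + y$3) / 2" by (simp_all add: xy(4))
    then show "z \<in> octahedron_vertices"
      using xy(1,2) d unfolding octahedron_vertices_iff cube_vertices_iff
      by (elim conjE disjE) simp_all
  qed
  show "octahedron_vertices \<subseteq> half_sums cube_vertices"
  proof -
    \<comment> \<open>The tetrahedron is inscribed in the cube, and \<open>half_sums\<close> is
      monotone.\<close>
    have "half_sums tetrahedron_vertices \<subseteq> half_sums cube_vertices"
      unfolding half_sums_def using tetrahedron_vertices_def cube_vertices_iff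
      by (auto 4 4 simp: tetrahedron_vertices_def cube_vertices_iff)
    then show ?thesis unfolding half_sums_tetrahedron .
  qed
qed

lemma orthogonal_sums_octahedron: "orthogonal_sums octahedron_vertices = cube_vertices"
proof
  show "orthogonal_sums octahedron_vertices \<subseteq> cube_vertices"
  proof
    fix u assume "u \<in> orthogonal_sums octahedron_vertices"
    then obtain x y z where xyz: "x \<in> octahedron_vertices" "y \<in> octahedron_vertices" "z \<in> octahedron_vertices"
      "x \<bullet> y = 0" "x \<bullet> z = 0" "y \<bullet> z = 0" "u = x + y + z"
      unfolding orthogonal_sums_def by blast
    have d: "x$1 * y$1 + x$2 * y$2 + x$3 * y$3 = 0" "x$1 * z$1 + x$2 * z$2 + x$3 * z$3 = 0"
      "y$1 * z$1 + y$2 * z$2 + y$3 * z$3 = 0"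
      using xyz(4-6) by (simp_all add: inner_vec_def sum_3)
    have u: "u$1 = x$1 + y$1 + z$1" "u$2 = x$2 + y$2 + z$2" "u$3 = x$3 + y$3 + z$3" by (simp_all add: xyz(7))
    show "u \<in> cube_vertices"
      using xyz(1-3) d unfolding octahedron_vertices_iff cube_vertices_iff u
      by (elim conjE disjE) simp_all
  qed
  show "cube_vertices \<subseteq> orthogonal_sums octahedron_vertices"
  proof
    fix u assume u: "u \<in> cube_vertices"
    let ?x = "vector [u$1, 0, 0] :: real^3" and ?y = "vector [0, u$2, 0] :: real^3" and ?z = "vector [0, 0, u$3] :: real^3"
    have "u = ?x + ?y + ?z" by (simp add: vec_eq_iff forall_3)
    moreover have "?x \<in> octahedron_vertices" "?y \<in> octahedron_vertices" "?z \<in> octahedron_vertices"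
      using u unfolding octahedron_vertices_iff cube_vertices_iff by simp_all
    moreover have "?x \<bullet> ?y = 0" "?x \<bullet> ?z = 0" "?y \<bullet> ?z = 0" by (simp_all add: inner_vec_def sum_3)
    ultimately show "u \<in> orthogonal_sums octahedron_vertices" unfolding orthogonal_sums_def by blast
  qed
qed

lemma octahedron_polytope:
  "triangulated_sphere octahedron_vertices (bipyramid_facets 4)"
  "isostatic_graph octahedron_vertices (edges_of (bipyramid_facets 4))"
  "\<Sum>octahedron_vertices = 0" "x \<in> octahedron_vertices \<Longrightarrow> norm x = 1"
  unfolding octahedron_vertices_def
  using bipyramid_sphere[of 4] bipyramid_isostatic[of 4] bipyramid_sum_zero[of 1] bipyramid_norm[of x 4] by simp_all

lemma octahedron_finite: "finite octahedron_vertices"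
  by (rule triangulated_sphereD(1)[OF octahedron_polytope(1)])

lemma cube_finite: "finite cube_vertices"
proof -
  have "cube_vertices \<subseteq> (\<lambda>(x, y, z). x + y + z) ` (octahedron_vertices \<times> octahedron_vertices \<times> octahedron_vertices)"
    unfolding orthogonal_sums_octahedron[symmetric] orthogonal_sums_def by force
  then show ?thesis using octahedron_finite by (meson finite_SigmaI finite_imageI finite_subset)
qed

lemma symmetries_half_sums:
  assumes "half_sums X = octahedron_vertices"
  shows "orthogonal_symmetries X \<subseteq> orthogonal_symmetries octahedron_vertices"
proof
  fix g assume "g \<in> orthogonal_symmetries X"
  then have g: "orthogonal_transformation g" "g ` X = X" unfolding orthogonal_symmetries_def by auto
  have "g ` octahedron_vertices = octahedron_vertices"
    using orthogonal_image_eq[OF g(1) octahedron_finite] half_sums_image[OF g] assms by simp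
  then show "g \<in> orthogonal_symmetries octahedron_vertices" using g(1) unfolding orthogonal_symmetries_def by simp
qed

lemma symmetries_cube: "orthogonal_symmetries cube_vertices = orthogonal_symmetries octahedron_vertices"
proof
  show "orthogonal_symmetries cube_vertices \<subseteq> orthogonal_symmetries octahedron_vertices"
    by (rule symmetries_half_sums[OF half_sums_cube])
  show "orthogonal_symmetries octahedron_vertices \<subseteq> orthogonal_symmetries cube_vertices"
  proof
    fix g assume "g \<in> orthogonal_symmetries octahedron_vertices"
    then have g: "orthogonal_transformation g" "g ` octahedron_vertices = octahedron_vertices"
      unfolding orthogonal_symmetries_def by auto
    have "g ` cube_vertices = cube_vertices"
      using orthogonal_image_eq[OF g(1) cube_finite] orthogonal_sums_image[OF g]
      unfolding orthogonal_sums_octahedron by simp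
    then show "g \<in> orthogonal_symmetries cube_vertices" using g(1) unfolding orthogonal_symmetries_def by simp
  qed
qed

section \<open>Rotation groups, and the group T_h\<close>

lemma orthogonal_symmetries_compose:
  assumes "g \<in> orthogonal_symmetries X" "h \<in> orthogonal_symmetries X"
  shows "g \<circ> h \<in> orthogonal_symmetries X"
proof -
  have "orthogonal_transformation g" "orthogonal_transformation h" "g ` X = X" "h ` X = X"
    using assms unfolding orthogonal_symmetries_def by auto
  moreover from this have "orthogonal_transformation (g \<circ> h)" by (intro orthogonal_transformation_compose)
  moreover have "(g \<circ> h) ` X = g ` h ` X" by (rule image_comp[symmetric])
  ultimately show ?thesis unfolding orthogonal_symmetries_def by (simp del: o_apply)
qed

lemma rotational_symmetries_compose:
  assumes "g \<in> rotational_symmetries X" "h \<in> rotational_symmetries X"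
  shows "g \<circ> h \<in> rotational_symmetries X"
proof -
  have "linear g" "linear h"
    using assms orthogonal_transformation_linear unfolding rotational_symmetries_def orthogonal_symmetries_def by auto
  then have "det (matrix (g \<circ> h)) = 1"
    using assms unfolding rotational_symmetries_def by (simp add: matrix_compose det_mul)
  then show ?thesis
    using assms orthogonal_symmetries_compose unfolding rotational_symmetries_def by blast
qed

lemma id_rotational_symmetry: "id \<in> rotational_symmetries X"
  unfolding rotational_symmetries_def orthogonal_symmetries_def
  using orthogonal_transformation_id by (simp add: matrix_id_mat_1 id_def[symmetric])

text \<open>A rotation commutes with the cross product and so preserves triple products, whereas
  exchanging u and v with w fixed would reverse the sign of this one. Rotation groups thus meet the
  asymmetry condition on every facet.\<close>

lemma rotation_no_swap:
  assumes "h \<in> rotational_symmetries X" "u \<bullet> cross3 v w \<noteq> 0"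
  shows "\<not> (h u = v \<and> h v = u \<and> h w = w)"
proof
  assume h: "h u = v \<and> h v = u \<and> h w = w"
  have orth: "orthogonal_transformation h" "det (matrix h) = 1"
    using assms(1) unfolding rotational_symmetries_def orthogonal_symmetries_def by auto
  have "cross3 v u = h (cross3 u v)"
    using cross_orthogonal_transformation[OF orth(1), of u v] h orth(2) by simp
  then have "cross3 v u \<bullet> w = cross3 u v \<bullet> w"
    using h orth(1) unfolding orthogonal_transformation_def by metis
  moreover have "cross3 v u \<bullet> w = - (u \<bullet> cross3 v w)" "cross3 u v \<bullet> w = u \<bullet> cross3 v w"
    by (simp_all add: cross3_simps)
  ultimately show False using assms(2) by simp
qed

lemma realizable_rotations:
  assumes S: "triangulated_sphere V T" "isostatic_graph V (edges_of T)" "\<Sum>V = 0" "\<And>x. x \<in> V \<Longrightarrow> norm x = r"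
    and "{u, v, w} \<in> T" "u \<bullet> cross3 v w \<noteq> 0" "rotational_symmetries X \<subseteq> orthogonal_symmetries V"
  shows "realizable (rotational_symmetries X)"
  by (rule realizable_subgroup[OF S assms(7) _ rotational_symmetries_compose assms(5) rotation_no_swap[OF _ assms(6)]])
    (use id_rotational_symmetry in blast)+

lemma octahedron_triple: "vector [1,0,0] \<bullet> cross3 (vector [0,1,0]) (vector [0,0,1]) = (1 :: real)"
  by (simp add: cross3_def inner_vec_def sum_3)

lemma realizable_octahedral: "realizable group_T" "realizable group_O" "realizable group_Oh"
proof -
  have sub: "rotational_symmetries X \<subseteq> orthogonal_symmetries octahedron_vertices"
    if "half_sums X = octahedron_vertices" for X
    using symmetries_half_sums[OF that] unfolding rotational_symmetries_def by blast
  note R = realizable_rotations[OF octahedron_polytope octahedron_facet _ sub]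
  show "realizable group_T" unfolding group_T_def by (rule R) (simp_all add: octahedron_triple half_sums_tetrahedron)
  show "realizable group_O" unfolding group_O_def by (rule R) (simp_all add: octahedron_triple half_sums_cube)
  show "realizable group_Oh" unfolding group_Oh_def symmetries_cube
    by (rule realizable_full_symmetry[OF octahedron_polytope])
qed

text \<open>The determinant argument does not reach the orientation-reversing half of T_h. An
  element -g of it that exchanges the first two basis vectors and fixes the third would make g send
  (1, 1, 1) to its negative, which is no vertex of the tetrahedron preserved by g.\<close>

lemma realizable_Th: "realizable group_Th"
  unfolding group_Th_def
proof (rule realizable_subgroup[OF octahedron_polytope _ _ _ octahedron_facet])
  have T: "group_T \<subseteq> orthogonal_symmetries octahedron_vertices"
    using symmetries_half_sums[OF half_sums_tetrahedron] unfolding group_T_def rotational_symmetries_def by blast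
  have m: "uminus \<in> orthogonal_symmetries octahedron_vertices"
  proof -
    have "uminus ` octahedron_vertices = octahedron_vertices"
      by (rule orthogonal_image_eq) (auto simp: octahedron_finite octahedron_vertices_iff orthogonal_transformation_neg)
    then show ?thesis unfolding orthogonal_symmetries_def by (simp add: orthogonal_transformation_neg)
  qed
  show "adjoin uminus group_T \<subseteq> orthogonal_symmetries octahedron_vertices"
    unfolding adjoin_def using T orthogonal_symmetries_compose[OF m] by blast
  show "adjoin uminus group_T \<noteq> {}" unfolding adjoin_def group_T_def using id_rotational_symmetry by blast
  have comm: "g (- x) = - g x" if "g \<in> group_T" for g x
    using that orthogonal_transformation_linear linear_neg
    unfolding group_T_def rotational_symmetries_def orthogonal_symmetries_def by blast
  show "g \<circ> h \<in> adjoin uminus group_T" if gh: "g \<in> adjoin uminus group_T" "h \<in> adjoin uminus group_T" for g h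
  proof -
    obtain g' where g': "g' \<in> group_T" "g = g' \<or> g = uminus \<circ> g'" using gh(1) unfolding adjoin_def by blast
    obtain h' where h': "h' \<in> group_T" "h = h' \<or> h = uminus \<circ> h'" using gh(2) unfolding adjoin_def by blast
    have "g' \<circ> h' \<in> group_T" using g'(1) h'(1) rotational_symmetries_compose unfolding group_T_def by blast
    moreover have "g \<circ> h = g' \<circ> h' \<or> g \<circ> h = uminus \<circ> (g' \<circ> h')"
      using g'(2) h'(2) comm[OF g'(1)] by (auto simp: fun_eq_iff)
    ultimately show ?thesis unfolding adjoin_def by (elim disjE) (simp_all only: UnI1 UnI2 imageI)
  qed
  fix h assume "h \<in> adjoin uminus group_T"
  then consider "h \<in> group_T" | g where "g \<in> group_T" "h = uminus \<circ> g" unfolding adjoin_def by blast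
  then show "\<not> (h (vector [1,0,0]) = vector [0,1,0] \<and> h (vector [0,1,0]) = vector [1,0,0] \<and> h (vector [0,0,1]) = vector [0,0,1])"
  proof cases
    case 1
    then show ?thesis 
      using rotation_no_swap[OF 1[unfolded group_T_def], of "vector [1,0,0]" "vector [0,1,0]" "vector [0,0,1]"]
        octahedron_triple by simp
  next
    case 2
    show ?thesis
    proof
      assume swap: "h (vector [1,0,0]) = vector [0,1,0] \<and> h (vector [0,1,0]) = vector [1,0,0] \<and> h (vector [0,0,1]) = vector [0,0,1]"
      have g: "linear g" "g ` tetrahedron_vertices = tetrahedron_vertices"
        using 2(1) orthogonal_transformation_linear unfolding group_T_def rotational_symmetries_def orthogonal_symmetries_def by auto
      have gv: "g (vector [1,0,0]) = - vector [0,1,0]" "g (vector [0,1,0]) = - vector [1,0,0]" "g (vector [0,0,1]) = - vector [0,0,1]"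
        using swap unfolding 2(2) by (auto simp: minus_equation_iff)
      have e: "(vector [1,1,1] :: real^3) = vector [1,0,0] + vector [0,1,0] + vector [0,0,1]"
        by (simp add: vec_eq_iff forall_3)
      have "g (vector [1,1,1]) = - vector [1,1,1]"
        unfolding e linear_add[OF g(1)] gv by (simp add: vec_eq_iff forall_3)
      moreover have "g (vector [1,1,1]) \<in> tetrahedron_vertices" using g(2) unfolding tetrahedron_vertices_def by blast
      ultimately show False unfolding tetrahedron_vertices_def by (auto simp: vec_eq_iff forall_3)
    qed
  qed
qed

section \<open>The regular tetrahedron\<close>

lemma tetrahedron_inner:
  assumes "x \<in> tetrahedron_vertices" "y \<in> tetrahedron_vertices"
  shows "x \<bullet> y = (if x = y then 3 else -1)"
  using assms unfolding tetrahedron_vertices_def by (auto simp: inner_vec_def sum_3 vec_eq_iff forall_3)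

lemma tetrahedron_card: "finite tetrahedron_vertices" "card tetrahedron_vertices = 4"
  unfolding tetrahedron_vertices_def by (auto simp: vec_eq_iff forall_3)

lemma realizable_Td: "realizable group_Td"
proof -
  let ?V = tetrahedron_vertices
  let ?T = "(\<lambda>v. ?V - {v}) ` ?V"
  have fin: "finite ?V" by (rule tetrahedron_card)
  have sphere: "triangulated_sphere ?V ?T"
    unfolding triangulated_sphere_def
  proof (intro conjI ballI)
    show "finite ?V" by (rule fin)
    show "?T \<noteq> {}" unfolding tetrahedron_vertices_def by blast
    have "vector [1,1,1] \<in> ?V" "vector [1,-1,-1] \<in> ?V" "vector [1,1,1] \<noteq> (vector [1,-1,-1] :: real^3)"
      by (auto simp: tetrahedron_vertices_def vec_eq_iff forall_3)
    then show "\<Union>?T = ?V" by blast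
    fix t assume "t \<in> ?T"
    then obtain v where v: "v \<in> ?V" "t = ?V - {v}" by blast
    show "card t = 3" unfolding v(2) using v(1) tetrahedron_card by simp
    show "independent t"
    proof
      assume "dependent t"
      then obtain f where f: "\<exists>w\<in>t. f w \<noteq> 0" "(\<Sum>x\<in>t. f x *\<^sub>R x) = 0"
        using dependent_finite[of t] v(2) fin by auto
      obtain w where w: "w \<in> t" "f w \<noteq> 0" using f(1) by blast
      \<comment> \<open>The vector w - v has inner product 4 with w and 0 with the other two
        vertices of the facet opposite v.\<close>
      have "(w - v) \<bullet> (\<Sum>x\<in>t. f x *\<^sub>R x) = (\<Sum>x\<in>t. if x = w then 4 * f w else 0)"
        unfolding inner_sum_right
        by (rule sum.cong) (use w v in \<open>auto simp: inner_diff_left tetrahedron_inner\<close>)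
      also have "\<dots> = 4 * f w" using w(1) v(2) fin by simp
      finally show False using f(2) w(2) by simp
    qed
    \<comment> \<open>The facet opposite v has normal -v, whose value is 1 on the facet and -3 at
      v.\<close>
    show "\<exists>n. (\<forall>x\<in>t. n \<bullet> x = 1) \<and> (\<forall>x\<in>?V - t. n \<bullet> x < 1)"
      using v by (intro exI[of _ "- v"]) (auto simp: tetrahedron_inner)
    fix w assume "w \<in> t"
    then show "\<exists>t'\<in>?T. t - {w} \<subseteq> t' \<and> w \<notin> t'" using v by blast
  qed
  have E: "edges_of ?T = {e. e \<subseteq> ?V \<and> card e = 2}"
  proof
    show "{e. e \<subseteq> ?V \<and> card e = 2} \<subseteq> edges_of ?T"
    proof
      fix e assume e: "e \<in> {e. e \<subseteq> ?V \<and> card e = 2}"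
      then have "e \<noteq> ?V" using tetrahedron_card(2) by auto
      then obtain v where "v \<in> ?V" "v \<notin> e" using e by blast
      then have "e \<subseteq> ?V - {v}" "?V - {v} \<in> ?T" using e by auto
      then show "e \<in> edges_of ?T" using e unfolding edges_of_def by blast
    qed
  qed (auto simp: edges_of_def)
  have "isostatic_graph ?V (edges_of ?T)"
    unfolding isostatic_graph_def E
  proof (intro conjI fin ballI)
    show "card {e. e \<subseteq> ?V \<and> card e = 2} + 6 = 3 * card ?V"
      using n_subsets[OF fin, of 2] tetrahedron_card(2) by (simp add: choose_two)
    show "stress_free {e. e \<subseteq> ?V \<and> card e = 2}"
      unfolding stress_free_def
    proof (intro allI impI ballI)
      fix \<omega> e assume eq: "\<forall>v. (\<Sum>e | e \<in> {e. e \<subseteq> ?V \<and> card e = 2} \<and> v \<in> e. \<omega> e *\<^sub>R (\<Sum>u\<in>e. v - u)) = 0"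
        and e: "e \<in> {e. e \<subseteq> ?V \<and> card e = 2}"
      obtain v w where vw: "e = {v, w}" "v \<noteq> w" "v \<in> ?V" "w \<in> ?V" using e by (auto simp: card_2_iff)
      have finE: "finite {e. e \<subseteq> ?V \<and> card e = 2}" using fin by simp
      have "{u. {v, u} \<in> {e. e \<subseteq> ?V \<and> card e = 2}} = ?V - {v}" using vw(3) by (auto simp: card_insert_if)
      then have "(\<Sum>u\<in>?V - {v}. \<omega> {v, u} *\<^sub>R (v - u)) = 0"
        using eq equilibrium_sum[OF finE, of \<omega> v] by simp
      \<comment> \<open>Pairing with w isolates one edge: w \<bullet> (v - u) is -4 for u = w and 0
        for the other two neighbours of v.\<close>
      then have "w \<bullet> (\<Sum>u\<in>?V - {v}. \<omega> {v, u} *\<^sub>R (v - u)) = 0" by simp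
      moreover have "w \<bullet> (\<Sum>u\<in>?V - {v}. \<omega> {v, u} *\<^sub>R (v - u)) = (\<Sum>u\<in>?V - {v}. if u = w then - 4 * \<omega> {v, w} else 0)"
        unfolding inner_sum_right
        by (rule sum.cong) (use vw in \<open>auto simp: inner_diff_right tetrahedron_inner\<close>)
      ultimately show "\<omega> e = 0" using vw fin by simp
    qed
  qed auto
  moreover have "\<Sum>?V = 0"
    unfolding tetrahedron_vertices_def by (simp add: vec_eq_iff forall_3)
  moreover have "norm x = sqrt 3" if "x \<in> ?V" for x
    using tetrahedron_inner[OF that that] by (simp add: norm_eq_sqrt_inner)
  ultimately show ?thesis unfolding group_Td_def by (intro realizable_full_symmetry[OF sphere])
qed

section \<open>Icosahedral groups\<close>

text \<open>The quadratic relation linearizes all polynomial expressions in the golden ratio, and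
  the rational bounds then decide the inequalities for the supporting planes.\<close>

lemma golden_ratio_facts:
  "golden_ratio * golden_ratio = golden_ratio + 1" "8 / 5 < golden_ratio" "golden_ratio < 17 / 10"
proof -
  show "golden_ratio * golden_ratio = golden_ratio + 1"
    unfolding golden_ratio_def by (simp add: field_simps)
  have "11 / 5 < sqrt 5" by (rule real_less_rsqrt) (simp add: power2_eq_square)
  then show "8 / 5 < golden_ratio" unfolding golden_ratio_def by simp
  have "sqrt 5 < 12 / 5" by (rule real_less_lsqrt) (simp_all add: power2_eq_square)
  then show "golden_ratio < 17 / 10" unfolding golden_ratio_def by simp
qed

definition sgn_bool :: "bool \<Rightarrow> real" where
  "sgn_bool s = (if s then 1 else -1)"

lemma sgn_bool_simps [simp]: "sgn_bool True = 1" "sgn_bool False = -1"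
  by (simp_all add: sgn_bool_def)

text \<open>The vertices form three golden rectangles in the coordinate planes; s is the sign along
  the short side and t the sign along the long one. The arrangement is such that the cyclic
  permutation of the coordinates takes \<open>ico_x\<close> to \<open>ico_y\<close>, then to
  \<open>ico_z\<close> and back.\<close>

definition ico_x :: "bool \<Rightarrow> bool \<Rightarrow> real^3" where
  "ico_x s t = vector [0, sgn_bool s, sgn_bool t * golden_ratio]"

definition ico_y :: "bool \<Rightarrow> bool \<Rightarrow> real^3" where
  "ico_y s t = vector [sgn_bool t * golden_ratio, 0, sgn_bool s]"

definition ico_z :: "bool \<Rightarrow> bool \<Rightarrow> real^3" where
  "ico_z s t = vector [sgn_bool s, sgn_bool t * golden_ratio, 0]"

lemma ico_components [simp]:
  "ico_x s t $ 1 = 0" "ico_x s t $ 2 = sgn_bool s" "ico_x s t $ 3 = sgn_bool t * golden_ratio"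
  "ico_y s t $ 1 = sgn_bool t * golden_ratio" "ico_y s t $ 2 = 0" "ico_y s t $ 3 = sgn_bool s"
  "ico_z s t $ 1 = sgn_bool s" "ico_z s t $ 2 = sgn_bool t * golden_ratio" "ico_z s t $ 3 = 0"
  by (simp_all add: ico_x_def ico_y_def ico_z_def)

lemma sgn_bool_nonzero [simp]: "sgn_bool s \<noteq> 0"
  by (simp add: sgn_bool_def)

lemma sgn_bool_eq_iff [simp]: "sgn_bool s = sgn_bool t \<longleftrightarrow> s = t"
  by (simp add: sgn_bool_def)

lemma golden_ratio_nonzero [simp]: "golden_ratio \<noteq> 0"
  using golden_ratio_facts(2) by simp

lemma ico_eq_iff [simp]:
  "ico_x s t = ico_x s' t' \<longleftrightarrow> s = s' \<and> t = t'"
  "ico_y s t = ico_y s' t' \<longleftrightarrow> s = s' \<and> t = t'"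
  "ico_z s t = ico_z s' t' \<longleftrightarrow> s = s' \<and> t = t'"
  by (auto simp: vec_eq_iff forall_3)

lemma ico_neq [simp]:
  "ico_x s t \<noteq> ico_y s' t'" "ico_x s t \<noteq> ico_z s' t'" "ico_y s t \<noteq> ico_z s' t'"
  "ico_y s t \<noteq> ico_x s' t'" "ico_z s t \<noteq> ico_x s' t'" "ico_z s t \<noteq> ico_y s' t'"
  by (auto simp: vec_eq_iff forall_3)

lemma icosahedron_vertices_eq:
  "icosahedron_vertices = {ico_x s t |s t. True} \<union> {ico_y s t |s t. True} \<union> {ico_z s t |s t. True}"
proof -
  have "{f s t |s t. True} = {f True True, f True False, f False True, f False False}" for f :: "bool \<Rightarrow> bool \<Rightarrow> real^3"
    by (simp add: set_eq_iff ex_bool_eq disj_ac)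
  then show ?thesis
    unfolding icosahedron_vertices_def by (simp add: ico_x_def ico_y_def ico_z_def) blast
qed

lemma icosahedron_cases:
  assumes "x \<in> icosahedron_vertices"
  obtains s t where "x = ico_x s t" | s t where "x = ico_y s t" | s t where "x = ico_z s t"
  using assms unfolding icosahedron_vertices_eq by blast

text \<open>Vertices of consecutive rectangles are adjacent if the long sign of the first is the
  short sign of the second. Eight facets, one per octant, take a vertex from each rectangle; the
  other twelve join a short side to a vertex of the next rectangle.\<close>

definition icosahedron_facets :: "(real^3) set set" where
  "icosahedron_facets =
     {{ico_x s t, ico_y t q, ico_z q s} |s t q. True} \<union>
     {{ico_x True t, ico_x False t, ico_y t q} |t q. True} \<union>
     {{ico_y True t, ico_y False t, ico_z t q} |t q. True} \<union>
     {{ico_z True t, ico_z False t, ico_x t q} |t q. True}"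

lemma icosahedron_facetsI:
  "{ico_x s t, ico_y t q, ico_z q s} \<in> icosahedron_facets"
  "{ico_x True t, ico_x False t, ico_y t q} \<in> icosahedron_facets"
  "{ico_y True t, ico_y False t, ico_z t q} \<in> icosahedron_facets"
  "{ico_z True t, ico_z False t, ico_x t q} \<in> icosahedron_facets"
  unfolding icosahedron_facets_def by blast+

lemma icosahedron_facets_cases:
  assumes "f \<in> icosahedron_facets"
  obtains s t q where "f = {ico_x s t, ico_y t q, ico_z q s}"
  | t q where "f = {ico_x True t, ico_x False t, ico_y t q}"
  | t q where "f = {ico_y True t, ico_y False t, ico_z t q}"
  | t q where "f = {ico_z True t, ico_z False t, ico_x t q}"
  using assms unfolding icosahedron_facets_def by blast

lemma icosahedron_supporting:
  assumes f: "f = {u, v, w}" and "u \<bullet> cross3 v w \<noteq> 0"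
    and "n \<bullet> u = 1" "n \<bullet> v = 1" "n \<bullet> w = 1"
    and "\<And>s t. ico_x s t \<in> f \<or> n \<bullet> ico_x s t < 1"
    and "\<And>s t. ico_y s t \<in> f \<or> n \<bullet> ico_y s t < 1"
    and "\<And>s t. ico_z s t \<in> f \<or> n \<bullet> ico_z s t < 1"
  shows "card f = 3 \<and> independent f \<and>
    (\<exists>n. (\<forall>x\<in>f. n \<bullet> x = 1) \<and> (\<forall>x\<in>icosahedron_vertices - f. n \<bullet> x < 1))"
proof -
  have "n \<bullet> x < 1" if x: "x \<in> icosahedron_vertices - f" for x
  proof -
    have "x \<in> icosahedron_vertices" "x \<notin> f" using x by auto
    from this(1) show ?thesis by (rule icosahedron_cases) (use assms(6-8) \<open>x \<notin> f\<close> in blast)+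
  qed
  moreover have "\<forall>x\<in>f. n \<bullet> x = 1" using assms(3-5) f by blast
  ultimately show ?thesis using triple_product_imp_independent[OF assms(2)] f by blast
qed

lemma icosahedron_sphere: "triangulated_sphere icosahedron_vertices icosahedron_facets"
proof -
  let ?g = golden_ratio
  note g = golden_ratio_facts
  have gg: "?g * (?g * x) = (?g + 1) * x" for x by (simp flip: mult.assoc add: g(1))
  note eval = inner_vec_def sum_3 algebra_simps gg
  have bool_sets: "{f s t |s t. True} = (\<lambda>(s, t). f s t) ` UNIV" for f :: "bool \<Rightarrow> bool \<Rightarrow> real^3" by auto
  have fin: "finite icosahedron_vertices"
    unfolding icosahedron_vertices_eq bool_sets by simp
  have ne: "icosahedron_facets \<noteq> {}" using icosahedron_facetsI(1) by blast
  have un: "\<Union>icosahedron_facets = icosahedron_vertices"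
  proof
    show "\<Union>icosahedron_facets \<subseteq> icosahedron_vertices"
      unfolding icosahedron_facets_def icosahedron_vertices_eq by blast
    show "icosahedron_vertices \<subseteq> \<Union>icosahedron_facets"
    proof
      fix x assume "x \<in> icosahedron_vertices"
      then show "x \<in> \<Union>icosahedron_facets"
        by (rule icosahedron_cases) (use icosahedron_facetsI(1) in blast)+
    qed
  qed
  have facet: "card f = 3 \<and> independent f \<and>
      (\<exists>n. (\<forall>x\<in>f. n \<bullet> x = 1) \<and> (\<forall>x\<in>icosahedron_vertices - f. n \<bullet> x < 1))" if "f \<in> icosahedron_facets" for f
    using that
  proof (cases rule: icosahedron_facets_cases)
    case (1 s t q)
    \<comment> \<open>The normal points into the octant of the facet; the factor is 1/(1 + g) = 2 -
      g, where 1 + g is the value of the sign vector at each vertex of the facet.\<close>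
    let ?n = "(2 - ?g) *\<^sub>R vector [sgn_bool q, sgn_bool s, sgn_bool t] :: real^3"
    show ?thesis
    proof (rule icosahedron_supporting[OF 1, where n = ?n])
      show "ico_x s t \<bullet> cross3 (ico_y t q) (ico_z q s) \<noteq> 0"
        using g by (cases s; cases t; cases q) (simp_all add: cross3_def eval)
      show "?n \<bullet> ico_x s t = 1" "?n \<bullet> ico_y t q = 1" "?n \<bullet> ico_z q s = 1"
        using g by (cases s; cases t; cases q; simp add: eval)+
      show "ico_x a b \<in> f \<or> ?n \<bullet> ico_x a b < 1" "ico_y a b \<in> f \<or> ?n \<bullet> ico_y a b < 1" "ico_z a b \<in> f \<or> ?n \<bullet> ico_z a b < 1" for a b
        using g unfolding 1 by (cases s; cases t; cases q; cases a; cases b; simp add: eval)+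
    qed
  next
    case (2 t q)
    \<comment> \<open>The facet contains a short side parallel to the second axis, hence the 0. The
      other entries are, up to sign, g - 1 = 1/g and 2g - 3 = 1/g^3, obtained by solving for the
      value 1.\<close>
    let ?n = "vector [(2 * ?g - 3) * sgn_bool q, 0, (?g - 1) * sgn_bool t] :: real^3"
    show ?thesis
    proof (rule icosahedron_supporting[OF 2, where n = ?n])
      show "ico_x True t \<bullet> cross3 (ico_x False t) (ico_y t q) \<noteq> 0"
        using g by (cases t; cases q) (simp_all add: cross3_def eval)
      show "?n \<bullet> ico_x True t = 1" "?n \<bullet> ico_x False t = 1" "?n \<bullet> ico_y t q = 1"
        using g by (cases t; cases q; simp add: eval)+
      show "ico_x a b \<in> f \<or> ?n \<bullet> ico_x a b < 1" "ico_y a b \<in> f \<or> ?n \<bullet> ico_y a b < 1" "ico_z a b \<in> f \<or> ?n \<bullet> ico_z a b < 1" for a b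
        using g unfolding 2 by (cases t; cases q; cases a; cases b; simp add: eval)+
    qed
  next
    case (3 t q)
    let ?n = "vector [(?g - 1) * sgn_bool t, (2 * ?g - 3) * sgn_bool q, 0] :: real^3"
    show ?thesis
    proof (rule icosahedron_supporting[OF 3, where n = ?n])
      show "ico_y True t \<bullet> cross3 (ico_y False t) (ico_z t q) \<noteq> 0"
        using g by (cases t; cases q) (simp_all add: cross3_def eval)
      show "?n \<bullet> ico_y True t = 1" "?n \<bullet> ico_y False t = 1" "?n \<bullet> ico_z t q = 1"
        using g by (cases t; cases q; simp add: eval)+
      show "ico_x a b \<in> f \<or> ?n \<bullet> ico_x a b < 1" "ico_y a b \<in> f \<or> ?n \<bullet> ico_y a b < 1" "ico_z a b \<in> f \<or> ?n \<bullet> ico_z a b < 1" for a b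
        using g unfolding 3 by (cases t; cases q; cases a; cases b; simp add: eval)+
    qed
  next
    case (4 t q)
    let ?n = "vector [0, (?g - 1) * sgn_bool t, (2 * ?g - 3) * sgn_bool q] :: real^3"
    show ?thesis
    proof (rule icosahedron_supporting[OF 4, where n = ?n])
      show "ico_z True t \<bullet> cross3 (ico_z False t) (ico_x t q) \<noteq> 0"
        using g by (cases t; cases q) (simp_all add: cross3_def eval)
      show "?n \<bullet> ico_z True t = 1" "?n \<bullet> ico_z False t = 1" "?n \<bullet> ico_x t q = 1"
        using g by (cases t; cases q; simp add: eval)+
      show "ico_x a b \<in> f \<or> ?n \<bullet> ico_x a b < 1" "ico_y a b \<in> f \<or> ?n \<bullet> ico_y a b < 1" "ico_z a b \<in> f \<or> ?n \<bullet> ico_z a b < 1" for a b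
        using g unfolding 4 by (cases t; cases q; cases a; cases b; simp add: eval)+
    qed
  qed
  have swap: "{p True, p False, r} = {p s, p (\<not> s), r}" for p :: "bool \<Rightarrow> real^3" and r s
    by (cases s) auto
  have neighbour: "\<exists>f'\<in>icosahedron_facets. f - {w} \<subseteq> f' \<and> w \<notin> f'" if "f \<in> icosahedron_facets" "w \<in> f" for f w
    using that(1)
  proof (cases rule: icosahedron_facets_cases)
    case (1 s t q)
    then consider "w = ico_x s t" | "w = ico_y t q" | "w = ico_z q s" using \<open>w \<in> f\<close> by blast
    then show ?thesis
    proof cases
      case x: 1
      show ?thesis using icosahedron_facetsI(3)[of q s] unfolding swap[of _ _ t] 1 x
        by (rule bexI[rotated]) auto
    next
      case y: 2
      show ?thesis using icosahedron_facetsI(4)[of s t] unfolding swap[of _ _ q] 1 y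
        by (rule bexI[rotated]) auto
    next
      case z: 3
      show ?thesis using icosahedron_facetsI(2)[of t q] unfolding swap[of _ _ s] 1 z
        by (rule bexI[rotated]) auto
    qed
  next
    case (2 t q)
    then consider s where "w = ico_x s t" | "w = ico_y t q" using \<open>w \<in> f\<close> by blast
    then show ?thesis
    proof cases
      case x: (1 s)
      show ?thesis using icosahedron_facetsI(1)[of "\<not> s" t q] unfolding 2 x swap[of _ _ s]
        by (rule bexI[rotated]) auto
    next
      case y: 2
      show ?thesis using icosahedron_facetsI(2)[of t "\<not> q"] unfolding 2 y
        by (rule bexI[rotated]) auto
    qed
  next
    case (3 t q)
    then consider s where "w = ico_y s t" | "w = ico_z t q" using \<open>w \<in> f\<close> by blast
    then show ?thesis
    proof cases
      case y: (1 s)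
      show ?thesis using icosahedron_facetsI(1)[of q "\<not> s" t] unfolding 3 y swap[of _ _ s]
        by (rule bexI[rotated]) auto
    next
      case z: 2
      show ?thesis using icosahedron_facetsI(3)[of t "\<not> q"] unfolding 3 z
        by (rule bexI[rotated]) auto
    qed
  next
    case (4 t q)
    then consider s where "w = ico_z s t" | "w = ico_x t q" using \<open>w \<in> f\<close> by blast
    then show ?thesis
    proof cases
      case z: (1 s)
      show ?thesis using icosahedron_facetsI(1)[of t q "\<not> s"] unfolding 4 z swap[of _ _ s]
        by (rule bexI[rotated]) auto
    next
      case x: 2
      show ?thesis using icosahedron_facetsI(4)[of t "\<not> q"] unfolding 4 x
        by (rule bexI[rotated]) auto
    qed
  qed
  show ?thesis unfolding triangulated_sphere_def
    by (intro conjI[OF fin conjI[OF ne conjI[OF un conjI]]] ballI facet neighbour)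
qed

text \<open>Multiplying the last equation by g turns its coefficients g - 1 and g into 1 and g + 1,
  so A = -(g + 1) C; substitution in the other one gives x. In use, A and C are the sums of the
  stresses from one vertex to the next and to the previous rectangle.\<close>

lemma icosahedral_vertex_equations:
  fixes g A C x :: real
  assumes "g * g = g + 1" "2 * x + A - (g - 1) * C = 0" "(g - 1) * A + g * C = 0"
  shows "x = g * C" "A = - g * x"
proof -
  have "g * ((g - 1) * A + g * C) = (g * g - g) * A + (g * g) * C" by (simp add: algebra_simps)
  also have "\<dots> = A + (g + 1) * C" unfolding assms(1) by simp
  finally have "A + (g + 1) * C = 0" using assms(3) by simp
  then have A: "A = - (g + 1) * C" by (simp add: algebra_simps)
  then show x: "x = g * C" using assms(2) by (simp add: algebra_simps)
  show "A = - g * x" unfolding A x assms(1)[symmetric] by simp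
qed

text \<open>Equilibrium of a stress on the icosahedron: \<open>x t\<close>, \<open>y t\<close>, \<open>z t\<close> are the stresses of the six edges in
  the coordinate planes and \<open>a\<close>, \<open>b\<close>, \<open>c\<close> those of the other 24. The cyclic symmetry of the
  coordinates gives relations such as \<open>y = - g\<^sup>2 x\<close>, whose threefold iteration forces \<open>x = 0\<close>.\<close>

lemma icosahedral_equilibrium:
  fixes a b c :: "bool \<Rightarrow> bool \<Rightarrow> bool \<Rightarrow> real" and x y z :: "bool \<Rightarrow> real" and g :: real
  assumes g: "g * g = g + 1" "1 < g"
    and X: "\<And>s t. g * (a s t True - a s t False) + (c True s t - c False s t) = 0"
      "\<And>s t. 2 * x t + (a s t True + a s t False) - (g - 1) * (c True s t + c False s t) = 0"
      "\<And>s t. (g - 1) * (a s t True + a s t False) + g * (c True s t + c False s t) = 0"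
    and Y: "\<And>s t. g * (b s t True - b s t False) + (a True s t - a False s t) = 0"
      "\<And>s t. 2 * y t + (b s t True + b s t False) - (g - 1) * (a True s t + a False s t) = 0"
      "\<And>s t. (g - 1) * (b s t True + b s t False) + g * (a True s t + a False s t) = 0"
    and Z: "\<And>s t. g * (c s t True - c s t False) + (b True s t - b False s t) = 0"
      "\<And>s t. 2 * z t + (c s t True + c s t False) - (g - 1) * (b True s t + b False s t) = 0"
      "\<And>s t. (g - 1) * (c s t True + c s t False) + g * (b True s t + b False s t) = 0"
  shows "x t = 0" "y t = 0" "z t = 0" "a s t q = 0" "b s t q = 0" "c s t q = 0"
proof -
  note rows = icosahedral_vertex_equations[OF g(1) X(2,3)] icosahedral_vertex_equations[OF g(1) Y(2,3)]
    icosahedral_vertex_equations[OF g(1) Z(2,3)]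
  \<comment> \<open>For fixed m the four stresses \<open>d s m t\<close> are summed once by rows and
    once by columns.\<close>
  have sum_rel: "y' True + y' False = - 2 * (g * g) * x' m"
    if row: "\<And>s t. d s t True + d s t False = - g * x' t" and col: "\<And>s t. y' t = g * (d True s t + d False s t)"
    for d :: "bool \<Rightarrow> bool \<Rightarrow> bool \<Rightarrow> real" and x' y' m
  proof -
    have "y' True + y' False = g * ((d True m True + d True m False) + (d False m True + d False m False))"
      unfolding col[of True m] col[of False m] by (simp add: algebra_simps)
    also have "\<dots> = - 2 * (g * g) * x' m" unfolding row by (simp add: algebra_simps)
    finally show ?thesis .
  qed
  note rel = sum_rel[where d = a and x' = x and y' = y, OF rows(2,3)]
    sum_rel[where d = b and x' = y and y' = z, OF rows(4,5)] sum_rel[where d = c and x' = z and y' = x, OF rows(6,1)]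
  define h where "h = g * g"
  have h: "0 < h" using g(2) by (simp add: h_def)
  have const: "x' True = x' False" if "\<And>m. k = - 2 * (g * g) * x' m" for k and x' :: "bool \<Rightarrow> real"
    using that[of True] that[of False] g(2) by simp
  have cx: "x True = x False" using const rel(1) by blast
  have cy: "y True = y False" using const rel(2) by blast
  have cz: "z True = z False" using const rel(3) by blast
  have yx: "y True = - h * x True" using rel(1)[of True] cy by (simp add: h_def)
  have zy: "z True = - h * y True" using rel(2)[of True] cz by (simp add: h_def)
  have xz: "x True = - h * z True" using rel(3)[of True] cx by (simp add: h_def)
  have "(1 + h * h * h) * x True = 0" using xz unfolding zy yx by (simp add: algebra_simps)
  moreover have "0 < 1 + h * h * h" using h by (intro add_pos_pos) simp_all
  ultimately have x0: "x True = 0" by simp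
  then have y0: "y True = 0" using yx by simp
  then have z0: "z True = 0" using zy by simp
  have x: "x t = 0" and y: "y t = 0" and z: "z t = 0" for t
    using x0 y0 z0 cx cy cz by (cases t; simp)+
  then show "x t = 0" "y t = 0" "z t = 0" by blast+
  have row0: "a s t False = - a s t True" "b s t False = - b s t True" "c s t False = - c s t True" for s t
    using rows(2)[of s t] rows(4)[of s t] rows(6)[of s t] x y z by simp_all
  have col0: "a False s t = - a True s t" "b False s t = - b True s t" "c False s t = - c True s t" for s t
    using rows(1)[of t s] rows(3)[of t s] rows(5)[of t s] x y z g(2) by simp_all
  \<comment> \<open>Once the short sides carry no stress, the remaining equations link a, b and c
    cyclically by the factor -g, and the threefold iteration repeats with 1 + g^3.\<close>
  have Xr: "g * a True t True = - c True True t" "g * a True t True = c True False t" for t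
    using X(1)[of True t] X(1)[of False t] row0 col0 by simp_all
  have Yr: "g * b True t True = - a True True t" "g * b True t True = a True False t" for t
    using Y(1)[of True t] Y(1)[of False t] row0 col0 by simp_all
  have Zr: "g * c True t True = - b True True t" "g * c True t True = b True False t" for t
    using Z(1)[of True t] Z(1)[of False t] row0 col0 by simp_all
  have "c True True True = - g * a True True True" using Xr(1)[of True] by simp
  moreover have "a True True True = - g * b True True True" using Yr(1)[of True] by simp
  moreover have "b True True True = - g * c True True True" using Zr(1)[of True] by simp
  ultimately have "(1 + g * g * g) * c True True True = 0" by (simp add: algebra_simps)
  moreover have "0 < 1 + g * g * g" using g(2) by (intro add_pos_pos) simp_all
  ultimately have c0: "c True True True = 0" by simp
  then have b0: "b True True True = 0" using Zr(1)[of True] by simp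
  then have a0: "a True True True = 0" using Yr(1)[of True] by simp
  have F0: "a True False True = 0" "b True False True = 0" "c True False True = 0"
    using Yr(2)[of True] Zr(2)[of True] Xr(2)[of True] a0 b0 c0 by simp_all
  have "a True t True = 0" "b True t True = 0" "c True t True = 0" for t
    using a0 b0 c0 F0 by (cases t; simp)+
  then have "a s t True = 0" "b s t True = 0" "c s t True = 0" for s t
    using col0 by (cases s; simp)+
  then show "a s t q = 0" "b s t q = 0" "c s t q = 0"
    using row0 by (cases q; simp)+
qed

lemma icosahedron_edges:
  "edges_of icosahedron_facets =
     {{ico_x True t, ico_x False t} |t. True} \<union> {{ico_y True t, ico_y False t} |t. True} \<union>
     {{ico_z True t, ico_z False t} |t. True} \<union> {{ico_x s t, ico_y t q} |s t q. True} \<union>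
     {{ico_y s t, ico_z t q} |s t q. True} \<union> {{ico_z s t, ico_x t q} |s t q. True}" (is "?E = ?R")
proof
  show "?E \<subseteq> ?R"
  proof
    fix e assume "e \<in> ?E"
    then obtain f where f: "f \<in> icosahedron_facets" "e \<subseteq> f" "card e = 2" unfolding edges_of_def by blast
    from f(1) show "e \<in> ?R"
    proof (cases rule: icosahedron_facets_cases)
      case (1 s t q)
      have "{ico_x s t, ico_z q s} = {ico_z q s, ico_x s t}" by blast
      then show ?thesis using two_subset_of_triple[OF f(2)[unfolded 1] f(3)] by blast
    next
      case (2 t q)
      show ?thesis using two_subset_of_triple[OF f(2)[unfolded 2] f(3)] by blast
    next
      case (3 t q)
      show ?thesis using two_subset_of_triple[OF f(2)[unfolded 3] f(3)] by blast
    next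
      case (4 t q)
      show ?thesis using two_subset_of_triple[OF f(2)[unfolded 4] f(3)] by blast
    qed
  qed
  have E: "{u, v} \<in> ?E" if "{u, v, w} \<in> icosahedron_facets" "u \<noteq> v" for u v w
    using that unfolding edges_of_def by (auto intro!: bexI[of _ "{u, v, w}"])
  have E': "{v, w} \<in> ?E" if "{u, v, w} \<in> icosahedron_facets" "v \<noteq> w" for u v w
    using that unfolding edges_of_def by (auto intro!: bexI[of _ "{u, v, w}"])
  have E'': "{w, u} \<in> ?E" if "{u, v, w} \<in> icosahedron_facets" "w \<noteq> u" for u v w
    using that unfolding edges_of_def by (auto intro!: bexI[of _ "{u, v, w}"])
  have "{ico_x True t, ico_x False t} \<in> ?E" "{ico_y True t, ico_y False t} \<in> ?E" "{ico_z True t, ico_z False t} \<in> ?E" for t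
    by (rule E[OF icosahedron_facetsI(2)] E[OF icosahedron_facetsI(3)] E[OF icosahedron_facetsI(4)]; simp)+
  moreover have "{ico_x s t, ico_y t q} \<in> ?E" "{ico_y s t, ico_z t q} \<in> ?E" "{ico_z s t, ico_x t q} \<in> ?E" for s t q
    by (rule E[OF icosahedron_facetsI(1)] E'[OF icosahedron_facetsI(1)] E''[OF icosahedron_facetsI(1)]; simp)+
  ultimately show "?R \<subseteq> ?E" by blast
qed

lemma icosahedron_neighbours:
  "{u. {ico_x s t, u} \<in> edges_of icosahedron_facets} = {ico_x (\<not> s) t, ico_y t True, ico_y t False, ico_z True s, ico_z False s}"
  "{u. {ico_y s t, u} \<in> edges_of icosahedron_facets} = {ico_y (\<not> s) t, ico_z t True, ico_z t False, ico_x True s, ico_x False s}"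
  "{u. {ico_z s t, u} \<in> edges_of icosahedron_facets} = {ico_z (\<not> s) t, ico_x t True, ico_x t False, ico_y True s, ico_y False s}"
  unfolding icosahedron_edges by (cases s; auto simp: doubleton_eq_iff ex_bool_eq all_bool_eq)+

lemma icosahedron_edges_finite: "finite (edges_of icosahedron_facets)"
proof -
  have "edges_of icosahedron_facets \<subseteq> Pow icosahedron_vertices"
    using triangulated_sphereD(4)[OF icosahedron_sphere] unfolding edges_of_def by blast
  then show ?thesis using triangulated_sphereD(1)[OF icosahedron_sphere] by (auto intro: finite_subset)
qed

lemma icosahedron_stress_free: "stress_free (edges_of icosahedron_facets)"
  unfolding stress_free_def
proof (intro allI impI)
  let ?E = "edges_of icosahedron_facets"
  let ?g = golden_ratio
  fix \<omega> assume eq: "\<forall>v. (\<Sum>e | e \<in> ?E \<and> v \<in> e. \<omega> e *\<^sub>R (\<Sum>u\<in>e. v - u)) = 0"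
  have c2: "card e = 2" if "e \<in> ?E" for e using that unfolding edges_of_def by blast
  have eq': "(\<Sum>u | {v, u} \<in> ?E. \<omega> {v, u} *\<^sub>R (v - u)) = 0" for v
    using eq equilibrium_sum[OF icosahedron_edges_finite c2, of \<omega> v] by simp
  define x where "x t = \<omega> {ico_x True t, ico_x False t}" for t
  define y where "y t = \<omega> {ico_y True t, ico_y False t}" for t
  define z where "z t = \<omega> {ico_z True t, ico_z False t}" for t
  define a where "a s t q = \<omega> {ico_x s t, ico_y t q}" for s t q
  define b where "b s t q = \<omega> {ico_y s t, ico_z t q}" for s t q
  define c where "c s t q = \<omega> {ico_z s t, ico_x t q}" for s t q
  have sw: "\<omega> {ico_x s t, ico_x (\<not> s) t} = x t" "\<omega> {ico_y s t, ico_y (\<not> s) t} = y t" "\<omega> {ico_z s t, ico_z (\<not> s) t} = z t"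
    "\<omega> {ico_x s t, ico_z p s} = c p s t" "\<omega> {ico_y s t, ico_x p s} = a p s t" "\<omega> {ico_z s t, ico_y p s} = b p s t" for s t p
    unfolding x_def y_def z_def a_def b_def c_def by (cases s; simp add: insert_commute)+
  have X: "x t *\<^sub>R (ico_x s t - ico_x (\<not> s) t) + (a s t True *\<^sub>R (ico_x s t - ico_y t True) +
      (a s t False *\<^sub>R (ico_x s t - ico_y t False) + (c True s t *\<^sub>R (ico_x s t - ico_z True s) +
       c False s t *\<^sub>R (ico_x s t - ico_z False s)))) = 0" (is "?X s t = 0") for s t
    using eq'[of "ico_x s t"] unfolding icosahedron_neighbours by (simp add: sw a_def[symmetric])
  have Y: "y t *\<^sub>R (ico_y s t - ico_y (\<not> s) t) + (b s t True *\<^sub>R (ico_y s t - ico_z t True) +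
      (b s t False *\<^sub>R (ico_y s t - ico_z t False) + (a True s t *\<^sub>R (ico_y s t - ico_x True s) +
       a False s t *\<^sub>R (ico_y s t - ico_x False s)))) = 0" (is "?Y s t = 0") for s t
    using eq'[of "ico_y s t"] unfolding icosahedron_neighbours by (simp add: sw b_def[symmetric])
  have Z: "z t *\<^sub>R (ico_z s t - ico_z (\<not> s) t) + (c s t True *\<^sub>R (ico_z s t - ico_x t True) +
      (c s t False *\<^sub>R (ico_z s t - ico_x t False) + (b True s t *\<^sub>R (ico_z s t - ico_y True s) +
       b False s t *\<^sub>R (ico_z s t - ico_y False s)))) = 0" (is "?Z s t = 0") for s t
    using eq'[of "ico_z s t"] unfolding icosahedron_neighbours by (simp add: sw c_def[symmetric])
  have comp: "?X s t $ i = 0" "?Y s t $ i = 0" "?Z s t $ i = 0" for s t i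
    unfolding X Y Z by simp_all
  have g: "?g * ?g = ?g + 1" "1 < ?g" using golden_ratio_facts by simp_all
  \<comment> \<open>Equilibrium at \<open>ico_x s t\<close> in the directions orthogonal to its
    rectangle, along the short side and along the long side. After factoring out signs the equations
    have the same form at all vertices.\<close>
  have X1: "?g * (a s t True - a s t False) + (c True s t - c False s t) = 0" (is "?e1 s t = 0")
    and X2: "2 * x t + (a s t True + a s t False) - (?g - 1) * (c True s t + c False s t) = 0" (is "?e2 s t = 0")
    and X3: "(?g - 1) * (a s t True + a s t False) + ?g * (c True s t + c False s t) = 0" (is "?e3 s t = 0") for s t
  proof -
    have "?X s t $ 1 = - ?e1 s t" by (simp add: algebra_simps)
    then show "?e1 s t = 0" unfolding comp(1) by simp
    have "?X s t $ 2 = sgn_bool s * ?e2 s t" by (cases s) (simp_all add: algebra_simps)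
    then show "?e2 s t = 0" unfolding comp(1) by simp
    have "?X s t $ 3 = sgn_bool t * ?e3 s t" by (cases t) (simp_all add: algebra_simps)
    then show "?e3 s t = 0" unfolding comp(1) by simp
  qed
  have Y1: "?g * (b s t True - b s t False) + (a True s t - a False s t) = 0" (is "?e1 s t = 0")
    and Y2: "2 * y t + (b s t True + b s t False) - (?g - 1) * (a True s t + a False s t) = 0" (is "?e2 s t = 0")
    and Y3: "(?g - 1) * (b s t True + b s t False) + ?g * (a True s t + a False s t) = 0" (is "?e3 s t = 0") for s t
  proof -
    have "?Y s t $ 2 = - ?e1 s t" by (simp add: algebra_simps)
    then show "?e1 s t = 0" unfolding comp(2) by simp
    have "?Y s t $ 3 = sgn_bool s * ?e2 s t" by (cases s) (simp_all add: algebra_simps)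
    then show "?e2 s t = 0" unfolding comp(2) by simp
    have "?Y s t $ 1 = sgn_bool t * ?e3 s t" by (cases t) (simp_all add: algebra_simps)
    then show "?e3 s t = 0" unfolding comp(2) by simp
  qed
  have Z1: "?g * (c s t True - c s t False) + (b True s t - b False s t) = 0" (is "?e1 s t = 0")
    and Z2: "2 * z t + (c s t True + c s t False) - (?g - 1) * (b True s t + b False s t) = 0" (is "?e2 s t = 0")
    and Z3: "(?g - 1) * (c s t True + c s t False) + ?g * (b True s t + b False s t) = 0" (is "?e3 s t = 0") for s t
  proof -
    have "?Z s t $ 3 = - ?e1 s t" by (simp add: algebra_simps)
    then show "?e1 s t = 0" unfolding comp(3) by simp
    have "?Z s t $ 1 = sgn_bool s * ?e2 s t" by (cases s) (simp_all add: algebra_simps)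
    then show "?e2 s t = 0" unfolding comp(3) by simp
    have "?Z s t $ 2 = sgn_bool t * ?e3 s t" by (cases t) (simp_all add: algebra_simps)
    then show "?e3 s t = 0" unfolding comp(3) by simp
  qed
  note zero = icosahedral_equilibrium[where x = x and y = y and z = z and a = a and b = b and c = c, OF g X1 X2 X3 Y1 Y2 Y3 Z1 Z2 Z3]
  show "\<forall>e\<in>?E. \<omega> e = 0"
  proof
    fix e assume "e \<in> ?E"
    then consider t where "e = {ico_x True t, ico_x False t}" | t where "e = {ico_y True t, ico_y False t}"
      | t where "e = {ico_z True t, ico_z False t}" | s t q where "e = {ico_x s t, ico_y t q}"
      | s t q where "e = {ico_y s t, ico_z t q}" | s t q where "e = {ico_z s t, ico_x t q}"
      unfolding icosahedron_edges by blast
    then show "\<omega> e = 0"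
      by cases (use zero in \<open>simp_all add: x_def y_def z_def a_def b_def c_def\<close>)
  qed
qed

section \<open>Counting, and the groups I and I_h\<close>

lemma icosahedron_card: "card icosahedron_vertices = 12"
proof -
  have b: "{f s t |s t. True} = (\<lambda>(s, t). f s t) ` UNIV" for f :: "bool \<Rightarrow> bool \<Rightarrow> real^3" by auto
  have U: "card (UNIV :: (bool \<times> bool) set) = 4" by (simp add: card_UNIV_bool flip: UNIV_Times_UNIV)
  have c: "card {ico_x s t |s t. True} = 4" "card {ico_y s t |s t. True} = 4" "card {ico_z s t |s t. True} = 4"
    unfolding b by (subst card_image; auto simp: inj_on_def U)+
  have f: "finite {f s t |s t. True}" for f :: "bool \<Rightarrow> bool \<Rightarrow> real^3" unfolding b by simp
  have "{ico_x s t |s t. True} \<inter> {ico_y s t |s t. True} = {}"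
    "({ico_x s t |s t. True} \<union> {ico_y s t |s t. True}) \<inter> {ico_z s t |s t. True} = {}" by auto
  then show ?thesis unfolding icosahedron_vertices_eq using c f by (simp add: card_Un_disjoint)
qed

lemma icosahedron_card_edges: "card (edges_of icosahedron_facets) = 30"
proof -
  have b: "{f t |t. True} = f ` UNIV" for f :: "bool \<Rightarrow> (real^3) set" by auto
  have b3: "{f s t q |s t q. True} = (\<lambda>(s, t, q). f s t q) ` UNIV" for f :: "bool \<Rightarrow> bool \<Rightarrow> bool \<Rightarrow> (real^3) set" by auto
  have U: "card (UNIV :: (bool \<times> bool \<times> bool) set) = 8" by (simp add: card_UNIV_bool flip: UNIV_Times_UNIV)
  have c: "card {{ico_x True t, ico_x False t} |t. True} = 2" "card {{ico_y True t, ico_y False t} |t. True} = 2"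
    "card {{ico_z True t, ico_z False t} |t. True} = 2" "card {{ico_x s t, ico_y t q} |s t q. True} = 8"
    "card {{ico_y s t, ico_z t q} |s t q. True} = 8" "card {{ico_z s t, ico_x t q} |s t q. True} = 8"
    unfolding b b3 by (subst card_image; auto simp: inj_on_def doubleton_eq_iff U card_UNIV_bool)+
  have f: "finite {f t |t. True}" for f :: "bool \<Rightarrow> (real^3) set" unfolding b by simp
  have f3: "finite {f s t q |s t q. True}" for f :: "bool \<Rightarrow> bool \<Rightarrow> bool \<Rightarrow> (real^3) set" unfolding b3 by simp
  let ?A = "{{ico_x True t, ico_x False t} |t. True}" and ?B = "{{ico_y True t, ico_y False t} |t. True}"
    and ?C = "{{ico_z True t, ico_z False t} |t. True}" and ?D = "{{ico_x s t, ico_y t q} |s t q. True}"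
    and ?F = "{{ico_y s t, ico_z t q} |s t q. True}" and ?G = "{{ico_z s t, ico_x t q} |s t q. True}"
  have disj: "?A \<inter> ?B = {}" "(?A \<union> ?B) \<inter> ?C = {}" "(?A \<union> ?B \<union> ?C) \<inter> ?D = {}"
    "(?A \<union> ?B \<union> ?C \<union> ?D) \<inter> ?F = {}" "(?A \<union> ?B \<union> ?C \<union> ?D \<union> ?F) \<inter> ?G = {}"
    by (auto simp: doubleton_eq_iff)
  have "card (edges_of icosahedron_facets) = 2 + 2 + 2 + 8 + 8 + 8"
    unfolding icosahedron_edges by (simp only: card_Un_disjoint finite_UnI f f3 disj c)
  then show ?thesis by simp
qed

lemma icosahedron_isostatic: "isostatic_graph icosahedron_vertices (edges_of icosahedron_facets)"
proof -
  have "e \<subseteq> icosahedron_vertices \<and> card e = 2" if "e \<in> edges_of icosahedron_facets" for e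
    using that triangulated_sphereD(4)[OF icosahedron_sphere] unfolding edges_of_def by blast
  then show ?thesis
    unfolding isostatic_graph_def
    using icosahedron_stress_free triangulated_sphereD(1)[OF icosahedron_sphere]
    by (simp add: icosahedron_card icosahedron_card_edges)
qed

lemma icosahedron_norm: "x \<in> icosahedron_vertices \<Longrightarrow> norm x = sqrt (golden_ratio + 2)"
  by (erule icosahedron_cases)
    (auto simp: norm_eq_sqrt_inner inner_vec_def sum_3 golden_ratio_facts(1) sgn_bool_def)

lemma icosahedron_sum_zero: "\<Sum>icosahedron_vertices = 0"
proof (rule sum_zero_of_antipodal)
  have neg: "- ico_x s t = ico_x (\<not> s) (\<not> t)" "- ico_y s t = ico_y (\<not> s) (\<not> t)" "- ico_z s t = ico_z (\<not> s) (\<not> t)" for s t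
    by (cases s; cases t; simp add: vec_eq_iff forall_3)+
  have "uminus ` icosahedron_vertices \<subseteq> icosahedron_vertices"
  proof
    fix x assume "x \<in> uminus ` icosahedron_vertices"
    then obtain v where v: "v \<in> icosahedron_vertices" "x = - v" by blast
    from v(1) show "x \<in> icosahedron_vertices"
      by (rule icosahedron_cases) (unfold v(2) icosahedron_vertices_eq, auto simp: neg)
  qed
  then show "uminus ` icosahedron_vertices = icosahedron_vertices"
    by (rule orthogonal_image_eq[rotated 2])
      (simp_all add: orthogonal_transformation_neg triangulated_sphereD(1)[OF icosahedron_sphere])
qed

lemma realizable_icosahedral: "realizable group_I" "realizable group_Ih"
proof -
  note P = icosahedron_sphere icosahedron_isostatic icosahedron_sum_zero icosahedron_norm
  show "realizable group_Ih" unfolding group_Ih_def by (rule realizable_full_symmetry[OF P])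
  \<comment> \<open>This determinant is 1 + g^3 for the golden ratio g.\<close>
  have "ico_x True True \<bullet> cross3 (ico_y True True) (ico_z True True) \<noteq> 0"
    using golden_ratio_facts(2) mult_pos_pos[of golden_ratio golden_ratio]
    by (simp add: cross3_def inner_vec_def sum_3 golden_ratio_facts(1) algebra_simps flip: mult.assoc)
  moreover have "rotational_symmetries icosahedron_vertices \<subseteq> orthogonal_symmetries icosahedron_vertices"
    unfolding rotational_symmetries_def by blast
  ultimately show "realizable group_I" unfolding group_I_def
    by (intro realizable_rotations[OF P icosahedron_facetsI(1)[of True True True]])
qed

section \<open>The complete list of point groups\<close>

lemma realizable_schoenflies:
  assumes "H \<in> schoenflies_groups"
  shows "realizable H"
proof -
  consider "H \<in> {group_I, group_Ih}" | "H \<in> {group_T, group_Th, group_Td, group_O, group_Oh}"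
    | n where "n \<ge> 1" "H \<in> {group_C n, group_Ch n, group_Cv n}"
    | n where "n \<ge> 1" "H \<in> {group_D n, group_Dh n, group_Dd n}"
    | n where "n \<ge> 1" "H \<in> {group_S2 n}"
    | "H \<in> {group_Cs, group_Ci, group_C1}"
    using assms unfolding schoenflies_groups_def
    by (elim UnE UN_E) (simp_all only: atLeast_iff)
  then show ?thesis
  proof cases
    case 1
    then show ?thesis using realizable_icosahedral by auto
  next
    case 2
    then show ?thesis using realizable_octahedral realizable_Th realizable_Td by auto
  next
    case (3 n)
    then show ?thesis using realizable_axial_families[OF 3(1)] by auto
  next
    case (4 n)
    then show ?thesis using realizable_axial_families[OF 4(1)] by auto
  next
    case (5 n)
    then show ?thesis using realizable_axial_families[OF 5(1)] by auto
  next
    case 6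
    then show ?thesis using realizable_low_symmetry by auto
  qed
qed

theorem mainTheorem3:
  fixes G :: "(real^3 \<Rightarrow> real^3) set"
  assumes "three_dimensional_point_group G"
  shows "(\<exists>P. triangulated_convex_polyhedron P \<and> polyhedron_point_group P = G \<and>
              isostatic (polyhedral_framework P)) \<and>
         (\<exists>F :: (real^3) framework. isostatic F \<and> framework_point_group F = G)"
proof -
  obtain H h where H: "H \<in> schoenflies_groups" "orthogonal_transformation h"
    "G = (\<lambda>g. h \<circ> g \<circ> inv h) ` H"
    using assms unfolding three_dimensional_point_group_def by blast
  have "realizable G" unfolding H(3) by (rule realizable_conjugate[OF realizable_schoenflies[OF H(1)] H(2)])
  then show ?thesis by (rule realizable_imp)
qed

end
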